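(* Let $\overline M_{\mathrm{sph}}^{D,k}$ and $\overline M_{\mathrm{box}}^{D,k}$ denote the optimal interior weights, for polynomials in $D\ge1$ variables of degree at most $k$, of the ball and of the cube $[0,1]^D$ in $\mathbb R^D$. Then for every integer $n\ge0$, $$\overline M_{\mathrm{sph}}^{D,2n}=\overline M_{\mathrm{sph}}^{D,2n+1}=\frac{\bigl(\lfloor\frac n2\rfloor+1\bigr)\bigl(2\lfloor\frac{n+1}2\rfloor+D\bigr)}{D}.$$ Furthermore, $\overline M_{\mathrm{box}}^{D,k}\le\overline M_{\mathrm{sph}}^{D,k}$ for all $k\ge0$, with equality precisely when $D=1$ or $k<4$.
   Context: For a mesh cell $K\subset\mathbb R^D$, $\overline{\mathcal C}(U)$ is the average of $U$ over $K$, $\overline{\mathcal B}(U)$ is the average of $U$ over $\partial K$, and the optimal interior weight is $\overline M_K^k:=\sup\{\overline{\mathcal B}(U)/\overline{\mathcal C}(U)\}$ over real polynomials $U$ in $D$ variables of degree at most $k$ with $U\ge0$ in $K$ and $\overline{\mathcal C}(U)>0$. The spherical mesh cell is the solid ball $\{\mathbf x\in\mathbb R^D:|\mathbf x|\le1\}$ (an interval when $D=1$). *)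

theory Defs
  imports "HOL-Analysis.Analysis"
begin

definition poly_fun_deg_le :: "nat \<Rightarrow> (real ^ 'n \<Rightarrow> real) \<Rightarrow> bool" where
  "poly_fun_deg_le k U \<longleftrightarrow>
     (\<exists>c :: ('n \<Rightarrow> nat) \<Rightarrow> real. \<forall>x.
        U x = (\<Sum>\<alpha> | (\<Sum>i\<in>UNIV. \<alpha> i) \<le> k. c \<alpha> * (\<Prod>i\<in>UNIV. (x $ i) ^ \<alpha> i)))"

(* The d-dimensional Hausdorff measure, without the customary normalising factor, which
   cancels in averages. Empty covering sets cost 0 also for d = 0, whereas a singleton
   then costs 0 ^ 0 = 1, so that dimension 0 gives the counting measure. *)

definition hausdorff_pre :: "nat \<Rightarrow> real \<Rightarrow> 'a::metric_space set \<Rightarrow> ennreal" where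
  "hausdorff_pre d \<delta> A =
     (INF C \<in> {C :: nat \<Rightarrow> 'a set. A \<subseteq> (\<Union>i. C i) \<and> (\<forall>i. bounded (C i) \<and> diameter (C i) \<le> \<delta>)}.
        \<Sum>i. if C i = {} then 0 else ennreal (diameter (C i) ^ d))"

definition hausdorff_outer :: "nat \<Rightarrow> 'a::metric_space set \<Rightarrow> ennreal" where
  "hausdorff_outer d A = (SUP \<delta> \<in> {0<..}. hausdorff_pre d \<delta> A)"

definition hausdorff_measure :: "nat \<Rightarrow> 'a::metric_space measure" where
  "hausdorff_measure d = measure_of UNIV (sets borel) (hausdorff_outer d)"

definition average :: "'a measure \<Rightarrow> 'a set \<Rightarrow> ('a \<Rightarrow> real) \<Rightarrow> real" where
  "average M A U = (LINT x:A|M. U x) / measure M A"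

definition cell_average :: "(real ^ 'n) set \<Rightarrow> (real ^ 'n \<Rightarrow> real) \<Rightarrow> real" where
  "cell_average K U = average lborel K U"

(* Surface measure on the boundary of K is Hausdorff measure in codimension one. *)

definition boundary_average :: "(real ^ 'n) set \<Rightarrow> (real ^ 'n \<Rightarrow> real) \<Rightarrow> real" where
  "boundary_average K U = average (hausdorff_measure (CARD('n) - 1)) (frontier K) U"

(* The supremum is taken in the extended reals, so that a real value of it includes
   the boundedness of the ratios. *)

definition interior_weight :: "(real ^ 'n) set \<Rightarrow> nat \<Rightarrow> ereal" where
  "interior_weight K k =
     (SUP U \<in> {U. poly_fun_deg_le k U \<and> (\<forall>x\<in>K. 0 \<le> U x) \<and> 0 < cell_average K U}.
        ereal (boundary_average K U / cell_average K U))"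

end

theory Submission
  imports Defs "HOL-Computational_Algebra.Polynomial"
begin

text \<open>
  Let \<open>K\<close> be the unit ball or the unit cube of dimension \<open>D\<close>, with centre \<open>z\<close>. Both bodies are
  circumscribed about a ball with centre \<open>z\<close>: the distance from \<open>z\<close> to the tangent hyperplanes of \<open>K\<close>
  is constant. Cutting \<open>K\<close> into cones with apex \<open>z\<close> therefore gives, for the cell average \<open>C\<close>, the
  boundary average \<open>B\<close> and a polynomial \<open>h\<close> that is homogeneous of degree \<open>j\<close> about \<open>z\<close>,
  \<open>C h = D / (D + j) * B h\<close>. By central symmetry \<open>B h = 0\<close> if \<open>j\<close> is odd. Hence for \<open>U\<close> of degree at
  most \<open>k\<close> the boundary average of \<open>y \<mapsto> U (z + r (y - z))\<close> is \<open>p (r\<^sup>2)\<close> with \<open>degree p \<le> n = k div 2\<close>,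
  while \<open>B U = p 1\<close> and \<open>C U\<close> is the integral of \<open>D r ^ (D - 1) p (r\<^sup>2)\<close> over \<open>[0, 1]\<close>
  (lemma \<open>radial_profile\<close>). If \<open>U \<ge> 0\<close> on \<open>K\<close>, then \<open>p \<ge> 0\<close> on \<open>[0, 1]\<close>.

  What remains is the largest ratio of \<open>p 1\<close> to that integral. A Gauss-Radau rule (\<open>n\<close> even) or a
  Gauss-Lobatto rule (\<open>n\<close> odd) is exact in degree \<open>n\<close>, has \<open>1\<close> among its nodes and positive weights,
  and its weight at \<open>1\<close> is the reciprocal of the claimed value (lemma \<open>endpoint_quadrature\<close>). So that
  value bounds the interior weight of both bodies. On the ball it is attained by \<open>U x = q (norm x ^ 2)\<close>,
  where \<open>q\<close> is nonnegative and vanishes at all nodes except \<open>1\<close>; this also works for the interval,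
  since \<open>norm (y - z)\<close> is constant on its boundary. On the cube \<open>norm (x - z) ^ 2\<close> attains the bound
  for \<open>k = 2, 3\<close> and the constants do for \<open>k < 2\<close>.

  If \<open>D \<ge> 2\<close> and \<open>k \<ge> 4\<close>, the rule has \<open>m = n div 2 \<ge> 1\<close> nodes inside \<open>(0, 1)\<close>. A nonnegative \<open>U\<close> that
  attains the bound on the cube would vanish on the boundaries of \<open>m\<close> concentric cubes. A polynomial
  that vanishes on a facet vanishes on its whole hyperplane, and so does its gradient because \<open>U\<close> is
  minimal on the facet. A generic line in direction \<open>e_i + e_j\<close> crosses \<open>4 m\<close> of these hyperplanes, so
  that \<open>U\<close> has \<open>8 m\<close> zeros on it, counted with multiplicity, which exceeds \<open>k\<close>; thus \<open>U = 0\<close> (lemma \<open>nonneg_vanishing_on_cubes\<close>).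
  Compactness of the nonnegative polynomials with normalised coefficients turns this into a uniform
  gap, hence a strict inequality between the suprema.

  The moment identity rests on properties of Hausdorff measure. It is a metric outer measure, hence a
  Borel measure by Caratheodory's criterion, and it is invariant under isometries. On a hyperplane it
  is translation invariant, hence proportional to Lebesgue measure, which reduces the cube to products
  of one-dimensional integrals. For the ball, rotation invariance determines the integral of
  \<open>(a \<bullet> x) ^ j\<close> as a multiple of \<open>norm a ^ j\<close> over the ball as well as over the sphere, integrating
  \<open>(x \<bullet> y) ^ j\<close> over both compares the factors, and powers of linear forms span the homogeneous
  polynomials.
\<close>

section \<open>Lagrange interpolation\<close>

definition lagrange_basis :: "real set \<Rightarrow> real \<Rightarrow> real poly" where
  "lagrange_basis N x = (\<Prod>y\<in>N - {x}. smult (1 / (x - y)) [:- y, 1:])"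

lemma poly_lagrange_basis:
  assumes "finite N" "x \<in> N" "y \<in> N"
  shows "poly (lagrange_basis N x) y = (if y = x then 1 else 0)"
proof (cases "y = x")
  case True
  then show ?thesis
    by (auto simp: lagrange_basis_def poly_prod diff_divide_distrib[symmetric] intro!: prod.neutral)
next
  case False
  then show ?thesis using assms
    by (auto simp: lagrange_basis_def poly_prod)
qed

lemma degree_lagrange_basis:
  assumes "finite N" "x \<in> N"
  shows "degree (lagrange_basis N x) < card N"
proof -
  have "degree (lagrange_basis N x) \<le> (\<Sum>y\<in>N - {x}. degree (smult (1 / (x - y)) [:- y, 1:]))"
    unfolding lagrange_basis_def by (rule degree_prod_sum_le[OF finite_Diff[OF assms(1)], unfolded o_def])
  also have "\<dots> \<le> (\<Sum>y\<in>N - {x}. 1)"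
    by (intro sum_mono) auto
  also have "\<dots> < card N"
    using card_Diff1_less[OF assms] by simp
  finally show ?thesis .
qed

lemma lagrange_interpolation:
  assumes "finite N" "degree p < card N"
  shows "p = (\<Sum>x\<in>N. smult (poly p x) (lagrange_basis N x))"
proof (rule poly_eqI_degree[where A = N])
  show "poly p x = poly (\<Sum>x\<in>N. smult (poly p x) (lagrange_basis N x)) x" if "x \<in> N" for x
    using assms that by (simp add: poly_sum poly_lagrange_basis if_distrib sum.delta cong: if_cong)
  show "degree (\<Sum>x\<in>N. smult (poly p x) (lagrange_basis N x)) < card N"
    using assms degree_lagrange_basis[OF assms(1)]
    by (intro degree_sum_less) (auto intro: le_less_trans[OF degree_smult_le])
qed (use assms in auto)

lemma degree_prod_linear: "degree (\<Prod>i\<in>A. [:- f i, 1 :: real:]) = card A"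
proof (cases "finite A")
  case True
  then show ?thesis by (subst degree_prod_eq_sum_degree) auto
qed auto

lemma coeff_prod_linear_top: "poly.coeff (\<Prod>i\<in>A. [:- f i, 1 :: real:]) (card A) = 1"
  using lead_coeff_prod[of "\<lambda>i. [:- f i, 1 :: real:]" A] by (simp add: degree_prod_linear)

text \<open>Vieta: the second coefficient is minus the sum of the roots.\<close>

lemma coeff_prod_linear_second:
  fixes f :: "nat \<Rightarrow> real"
  shows "poly.coeff (\<Prod>i\<in>{..m}. [:- f i, 1:]) m = - (\<Sum>i\<le>m. f i)"
proof (induction m)
  case 0
  then show ?case by simp
next
  case (Suc m)
  have "poly.coeff (\<Prod>i\<in>{..m}. [:- f i, 1:]) (Suc m) = 1"
    using coeff_prod_linear_top[of f "{..m}"] by simp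
  then show ?case using Suc
    by (simp add: mult.commute[of _ "[:- f (Suc m), 1:]"])
qed

lemma prod_linear_dvd:
  fixes p :: "real poly"
  assumes "finite N" "\<And>x. x \<in> N \<Longrightarrow> poly p x = 0"
  shows "(\<Prod>x\<in>N. [:- x, 1:]) dvd p"
  using assms
proof (induction N arbitrary: p rule: finite_induct)
  case empty
  then show ?case by simp
next
  case (insert x N)
  then have "[:- x, 1:] dvd p" by (simp add: poly_eq_0_iff_dvd)
  then obtain q where q: "p = [:- x, 1:] * q" by (auto simp: dvd_def)
  have "poly q y = 0" if "y \<in> N" for y
  proof -
    have "y \<noteq> x" "poly p y = 0" using insert that by auto
    then show ?thesis by (simp add: q)
  qed
  then have "(\<Prod>x\<in>N. [:- x, 1:]) dvd q" using insert by blast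
  then show ?case using insert(1,2) q by (simp add: mult_dvd_mono del: mult_pCons_left)
qed

section \<open>The radial functional\<close>

text \<open>For a unit ball in dimension \<open>D\<close> this is the average of \<open>x \<mapsto> poly p (norm x ^ 2)\<close>. The substitution
  \<open>s = r\<^sup>2\<close> would give the Jacobi weight \<open>D / 2 * s powr (D / 2 - 1)\<close>, which is singular at \<open>0\<close> for
  \<open>D = 1\<close>; in the variable \<open>r\<close> the integrand is continuous.\<close>

definition radial_functional :: "nat \<Rightarrow> real poly \<Rightarrow> real" where
  "radial_functional D p = integral {0..1} (\<lambda>r. real D * r ^ (D - 1) * poly p (r\<^sup>2))"

lemma radial_integrable: "(\<lambda>r. real D * r ^ (D - 1) * poly p (r\<^sup>2)) integrable_on {0..1}"
  by (intro integrable_continuous_real continuous_intros)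

lemma radial_add: "radial_functional D (p + q) = radial_functional D p + radial_functional D q"
  unfolding radial_functional_def
  unfolding poly_add distrib_left by (intro integral_add radial_integrable)

lemma radial_smult: "radial_functional D (smult c p) = c * radial_functional D p"
  unfolding radial_functional_def
  by (subst integral_mult_right[symmetric]) (auto simp: algebra_simps)

lemma radial_zero: "radial_functional D 0 = 0"
  by (simp add: radial_functional_def)

lemma radial_sum: "radial_functional D (\<Sum>i\<in>A. f i) = (\<Sum>i\<in>A. radial_functional D (f i))"
  by (induction A rule: infinite_finite_induct) (auto simp: radial_add radial_zero)

lemma radial_diff: "radial_functional D (p - q) = radial_functional D p - radial_functional D q"
  using radial_add[of D "p - q" q] by simp

lemma integral_power_01: "integral {0..1} (\<lambda>r::real. r ^ j) = 1 / (real j + 1)"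
proof -
  have "((\<lambda>r::real. r ^ j) has_integral (1 ^ (j + 1) / real (j + 1) - 0 ^ (j + 1) / real (j + 1))) {0..1}"
    by (intro fundamental_theorem_of_calculus)
       (auto intro!: derivative_eq_intros simp: has_real_derivative_iff_has_vector_derivative[symmetric]
          field_simps simp del: of_nat_Suc power_Suc)
  then show ?thesis by (auto dest!: integral_unique simp: add.commute)
qed

lemma radial_monom:
  assumes "D > 0"
  shows "radial_functional D (monom c j) = c * (real D / real (D + 2 * j))"
proof -
  have *: "real D * r ^ (D - 1) * poly (monom c j) (r\<^sup>2) = (real D * c) * r ^ (D - 1 + 2 * j)" for r
    by (simp add: poly_monom power_add power_mult[symmetric] mult.commute algebra_simps)
  show ?thesis using assms
    unfolding radial_functional_def *
    by (simp add: integral_mult_right integral_power_01 field_simps of_nat_diff)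
qed

lemma radial_one: "D > 0 \<Longrightarrow> radial_functional D 1 = 1"
  using radial_monom[of D 1 0] by (simp add: monom_0 one_pCons)

lemma radial_pos:
  assumes "D > 0" "p \<noteq> 0" "\<And>s. 0 < s \<Longrightarrow> s < 1 \<Longrightarrow> 0 \<le> poly p s"
  shows "radial_functional D p > 0"
proof -
  let ?g = "\<lambda>r. real D * r ^ (D - 1) * poly p (r\<^sup>2)"
  have p01: "0 \<le> poly p s" if "s \<in> {0..1}" for s
  proof -
    have "continuous_on (closure {0<..<1}) (poly p)" by (intro continuous_intros)
    then show ?thesis
      using continuous_ge_on_closure[of "{0<..<1}" "poly p" s 0] assms(3) that by auto
  qed
  have g0: "0 \<le> ?g r" if "r \<in> {0..1}" for r
    using that p01[of "r\<^sup>2"] by (auto simp: power_le_one)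
  have c: "continuous_on {0..1} ?g" by (intro continuous_intros)
  have "integral {0..1} ?g \<noteq> 0"
  proof
    assume "integral {0..1} ?g = 0"
    then have z: "\<forall>r\<in>{0..1}. ?g r = 0"
      using integral_eq_0_iff[OF c] g0 by auto
    have "{0<..1} \<subseteq> {s. poly p s = 0}"
    proof
      fix s :: real assume s: "s \<in> {0<..1}"
      have "sqrt s \<in> {0..1}" using s by auto
      then have "?g (sqrt s) = 0" using z by blast
      then show "s \<in> {s. poly p s = 0}" using s assms(1) by auto
    qed
    moreover have "infinite {0<..1::real}" by (simp add: infinite_Ioc)
    ultimately show False using poly_roots_finite[OF assms(2)] infinite_super by blast
  qed
  moreover have "integral {0..1} ?g \<ge> 0" using g0 by (intro integral_nonneg radial_integrable) auto
  ultimately show ?thesis by (simp add: radial_functional_def)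
qed

text \<open>Multiplication by \<open>s\<close> shifts the dimension by two. This reduces the Lobatto rule with nodes at both
  endpoints to a Radau rule in dimension \<open>D + 2\<close>.\<close>

lemma radial_pCons_0:
  assumes "D > 0"
  shows "radial_functional D (pCons 0 q) = real D / real (D + 2) * radial_functional (D + 2) q"
proof -
  have *: "real D * r ^ (D - 1) * poly (pCons 0 q) (r\<^sup>2)
      = real D / real (D + 2) * (real (D + 2) * r ^ (D + 2 - 1) * poly q (r\<^sup>2))" for r
  proof -
    have "r ^ (D + 2 - 1) = r ^ (D - 1) * r\<^sup>2"
      using assms by (simp flip: power_add)
    then show ?thesis by (simp add: divide_simps)
  qed
  show ?thesis unfolding radial_functional_def * by (rule integral_mult_right)
qed

section \<open>The reproducing kernel at the endpoint\<close>

text \<open>The kernel \<open>\<kappa>\<close> represents evaluation at \<open>1\<close> on polynomials of degree at most \<open>m\<close>. Its coefficients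
  \<open>k i\<close> solve the Cauchy system \<open>(\<Sum>i\<le>m. k i * D / (D + 2 * i + 2 * j)) = 1\<close> for \<open>j \<le> m\<close>, that is, the
  rational function \<open>(\<Sum>i\<le>m. D * k i / (x + D + 2 * i)) - 1\<close> vanishes at \<open>0, 2, ..., 2 m\<close>. It is
  therefore minus the product of the \<open>x - 2 j\<close> divided by the product of the \<open>x + D + 2 i\<close>, and its
  expansion at infinity gives \<open>D * poly \<kappa> 1\<close>.\<close>

lemma endpoint_kernel_exists:
  assumes "D > 0"
  obtains \<kappa> where "degree \<kappa> \<le> m"
    "\<And>q. degree q \<le> m \<Longrightarrow> radial_functional D (\<kappa> * q) = poly q 1"
    "poly \<kappa> 1 = real ((m + 1) * (2 * m + D)) / real D"
proof -
  define y where "y i = - (real D + 2 * real i)" for i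
  have inj: "inj_on y {..m}" by (auto simp: inj_on_def y_def)
  define N where "N = y ` {..m}"
  have N: "finite N" "card N = Suc m" by (auto simp: N_def card_image[OF inj])
  \<comment> \<open>The numerator of \<open>(\<Sum>i\<le>m. D * k i / (x + D + 2 * i))\<close> over the common denominator.\<close>
  define Q where "Q = (\<Prod>i\<in>{..m}. [:- y i, 1:]) - (\<Prod>i\<in>{..m}. [:- (2 * real i), 1:])"
  have dQ: "degree Q \<le> m"
  proof (rule degree_le, intro allI impI)
    fix j assume j: "m < j"
    show "poly.coeff Q j = 0"
    proof (cases "j = Suc m")
      case True
      then show ?thesis
        using coeff_prod_linear_top[of y "{..m}"] coeff_prod_linear_top[of "\<lambda>i. 2 * real i" "{..m}"]
        by (simp add: Q_def)
    next
      case False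
      then show ?thesis using j unfolding Q_def
        by (simp add: coeff_eq_0 degree_prod_linear[of y] degree_prod_linear[of "\<lambda>i. 2 * real i"])
    qed
  qed
  have cQ: "poly.coeff Q m = real ((m + 1) * (2 * m + D))"
  proof -
    have "poly.coeff Q m = (\<Sum>i\<le>m. 2 * real i) - (\<Sum>i\<le>m. y i)"
      unfolding Q_def coeff_diff coeff_prod_linear_second by simp
    also have "\<dots> = (\<Sum>i\<le>m. real D + 4 * real i)"
      unfolding sum_subtractf[symmetric] by (rule sum.cong) (auto simp: y_def)
    also have "\<dots> = real ((m + 1) * (2 * m + D))"
      by (induction m) (auto simp: algebra_simps)
    finally show ?thesis .
  qed
  \<comment> \<open>The residues of the rational function, divided by \<open>D\<close>.\<close>
  define k where "k i = poly Q (y i) * (\<Prod>z\<in>N - {y i}. 1 / (y i - z)) / real D" for i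
  define \<kappa> where "\<kappa> = (\<Sum>i\<le>m. monom (k i) i)"
  have basis: "lagrange_basis N x = smult (\<Prod>z\<in>N - {x}. 1 / (x - z)) (\<Prod>z\<in>N - {x}. [:- z, 1:])" for x
    unfolding lagrange_basis_def by (rule prod_smult)
  have Q_eq: "Q = (\<Sum>i\<le>m. smult (real D * k i) (\<Prod>z\<in>N - {y i}. [:- z, 1:]))"
  proof -
    have "Q = (\<Sum>x\<in>N. smult (poly Q x) (lagrange_basis N x))"
      using dQ N by (intro lagrange_interpolation) auto
    also have "\<dots> = (\<Sum>i\<le>m. smult (real D * k i) (\<Prod>z\<in>N - {y i}. [:- z, 1:]))"
      unfolding N_def[symmetric] sum.reindex[OF inj, folded N_def] o_def basis k_def using assms by simp
    finally show ?thesis .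
  qed
  have sumk: "(\<Sum>i\<le>m. real D * k i) = real ((m + 1) * (2 * m + D))"
  proof -
    have "poly.coeff (\<Prod>z\<in>N - {y i}. [:- z, 1:]) m = 1" if "i \<le> m" for i
    proof -
      have "card (N - {y i}) = m" using N that by (simp add: N_def)
      then show ?thesis using coeff_prod_linear_top[of "\<lambda>z. z" "N - {y i}"] by simp
    qed
    then have "poly.coeff Q m = (\<Sum>i\<le>m. real D * k i)"
      unfolding Q_eq coeff_sum by (intro sum.cong) auto
    with cQ show ?thesis by simp
  qed
  have moments: "(\<Sum>i\<le>m. k i * (real D / real (D + 2 * (i + j)))) = 1" if "j \<le> m" for j
  proof -
    let ?x = "2 * real j"
    have nz: "?x - z \<noteq> 0" if "z \<in> N" for z
      using that assms by (auto simp: N_def y_def)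
    let ?P = "\<Prod>z\<in>N. ?x - z"
    have P0: "?P \<noteq> 0" using nz N by (simp add: prod_zero_iff)
    have "poly Q ?x = ?P"
    proof -
      have "(\<Prod>i\<in>{..m}. ?x - 2 * real i) = 0" using that by (auto simp: prod_zero_iff)
      then show ?thesis
        unfolding N_def prod.reindex[OF inj] o_def by (simp add: Q_def poly_prod)
    qed
    moreover have "poly Q ?x = (\<Sum>i\<le>m. real D * k i * (\<Prod>z\<in>N - {y i}. ?x - z))"
      unfolding Q_eq by (simp add: poly_sum poly_prod)
    moreover have "(\<Prod>z\<in>N - {y i}. ?x - z) = ?P / (?x - y i)" if "i \<le> m" for i
      using N nz[of "y i"] that by (subst prod.remove[of N "y i"]) (auto simp: N_def)
    ultimately have "?P = (\<Sum>i\<le>m. real D * k i * (?P / (?x - y i)))" by simp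
    also have "\<dots> = ?P * (\<Sum>i\<le>m. k i * (real D / real (D + 2 * (i + j))))"
      unfolding sum_distrib_left by (intro sum.cong) (auto simp: y_def algebra_simps)
    finally show ?thesis using P0 by simp
  qed
  show thesis
  proof
    show "degree \<kappa> \<le> m" unfolding \<kappa>_def
      by (intro degree_sum_le) (auto intro: order.trans[OF degree_monom_le])
    show "poly \<kappa> 1 = real ((m + 1) * (2 * m + D)) / real D"
      using sumk assms by (simp add: \<kappa>_def poly_sum poly_monom sum_distrib_left[symmetric] field_simps)
    show "radial_functional D (\<kappa> * q) = poly q 1" if "degree q \<le> m" for q
    proof -
      have mon: "radial_functional D (\<kappa> * monom c j) = c" if "j \<le> m" for c j
      proof -
        have "radial_functional D (\<kappa> * monom c j) = (\<Sum>i\<le>m. k i * c * (real D / real (D + 2 * (i + j))))"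
          unfolding \<kappa>_def sum_distrib_right mult_monom radial_sum radial_monom[OF assms] by simp
        also have "\<dots> = c * (\<Sum>i\<le>m. k i * (real D / real (D + 2 * (i + j))))"
          unfolding sum_distrib_left by (intro sum.cong) auto
        finally show ?thesis using moments[OF that] by simp
      qed
      have "radial_functional D (\<kappa> * q) = radial_functional D (\<Sum>j\<le>m. \<kappa> * monom (poly.coeff q j) j)"
        using poly_as_sum_of_monoms'[OF that] by (simp add: sum_distrib_left[symmetric])
      also have "\<dots> = (\<Sum>j\<le>m. poly.coeff q j)" unfolding radial_sum by (intro sum.cong) (auto simp: mon)
      also have "\<dots> = poly q 1"
        by (subst (2) poly_as_sum_of_monoms'[OF that, symmetric]) (simp add: poly_sum poly_monom)
      finally show ?thesis .
    qed
  qed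
qed

section \<open>Gauss-Radau and Gauss-Lobatto quadrature\<close>

lemma even_roots_no_sign_change:
  fixes p :: "real poly"
  assumes "p \<noteq> 0" "\<And>x. a < x \<Longrightarrow> x < b \<Longrightarrow> even (order x p)"
  shows "(\<forall>x. a < x \<and> x < b \<longrightarrow> 0 \<le> poly p x) \<or> (\<forall>x. a < x \<and> x < b \<longrightarrow> poly p x \<le> 0)"
  using assms
proof (induction "degree p" arbitrary: p rule: less_induct)
  case less
  show ?case
  proof (cases "\<exists>z. a < z \<and> z < b \<and> poly p z = 0")
    case True
    then obtain z where z: "a < z" "z < b" "poly p z = 0" by auto
    then have "order z p \<noteq> 0" "even (order z p)" using less.prems by (auto simp: order_root)
    then have "2 \<le> order z p" by presburger
    then have "[:- z, 1:] ^ 2 dvd p" by (simp add: order_divides less.prems(1))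
    then obtain q where q: "p = [:- z, 1:] ^ 2 * q" by (auto simp: dvd_def)
    have q0: "q \<noteq> 0" using less.prems q by auto
    have "degree q < degree p" using q0 by (simp add: q degree_mult_eq degree_power_eq)
    moreover have "even (order x q)" if "a < x" "x < b" for x
    proof -
      have "order x p = order x ([:- z, 1:] ^ 2) + order x q"
        using less.prems(1) unfolding q by (rule order_mult)
      moreover have "even (order x ([:- z, 1:] ^ 2))"
        by (metis (no_types) even_add order_mult pCons_eq_0_iff power2_eq_square zero_neq_one
            mult_eq_0_iff)
      ultimately show ?thesis using less.prems(2)[OF that] by simp
    qed
    ultimately have "(\<forall>x. a < x \<and> x < b \<longrightarrow> 0 \<le> poly q x) \<or> (\<forall>x. a < x \<and> x < b \<longrightarrow> poly q x \<le> 0)"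
      using less.hyps[OF _ q0] by blast
    then show ?thesis by (auto simp: q mult_nonneg_nonpos)
  next
    case False
    show ?thesis
    proof (rule ccontr)
      assume "\<not> ?thesis"
      then obtain x y where xy: "a < x" "x < b" "poly p x < 0" "a < y" "y < b" "poly p y > 0"
        by (auto simp: not_le)
      then have "\<exists>z. a < z \<and> z < b \<and> poly p z = 0"
        by (cases x y rule: linorder_cases)
          (use poly_IVT_pos[of x y p] poly_IVT_neg[of y x p] less_trans in \<open>blast, simp, blast\<close>)
      with False show False by blast
    qed
  qed
qed

text \<open>The classical argument for zeros of orthogonal polynomials: multiplying \<open>\<kappa>\<close> by the linear factors of
  its sign changes in \<open>(0, 1)\<close> gives a polynomial without sign change, which has a nonzero integral
  against the weight \<open>1 - s\<close>. By orthogonality there are at least \<open>m\<close> sign changes.\<close>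

lemma kernel_roots:
  assumes D: "D > 0" and \<kappa>: "degree \<kappa> \<le> m" "\<kappa> \<noteq> 0"
    and orth: "\<And>q. degree q < m \<Longrightarrow> radial_functional D ([:1, - 1:] * \<kappa> * q) = 0"
  obtains Z where "finite Z" "Z \<subseteq> {0<..<1}" "card Z = m" "\<And>z. z \<in> Z \<Longrightarrow> poly \<kappa> z = 0"
proof -
  define Z where "Z = {z. 0 < z \<and> z < 1 \<and> odd (order z \<kappa>)}"
  have sub: "Z \<subseteq> {z. poly \<kappa> z = 0}" by (auto simp: Z_def order_root \<kappa> intro: ccontr)
  then have fin: "finite Z" using poly_roots_finite[OF \<kappa>(2)] finite_subset by blast
  have le: "card Z \<le> m"
    using card_mono[OF poly_roots_finite[OF \<kappa>(2)] sub] card_poly_roots_bound[OF \<kappa>(2)] \<kappa>(1) by linarith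
  define q where "q = (\<Prod>z\<in>Z. [:- z, 1:])"
  have q0: "q \<noteq> 0" by (simp add: q_def prod_zero_iff fin)
  have dq: "degree q = card Z" unfolding q_def by (rule degree_prod_linear)
  have oq: "order x q = (if x \<in> Z then 1 else 0)" for x
    using fin unfolding q_def
  proof (induction Z rule: finite_induct)
    case empty
    then show ?case by (simp add: order_0I)
  next
    case (insert z Z)
    have o1: "order x [:- z, 1:] = (if z = x then 1 else 0)"
      using order_power_n_n[of x 1] by (auto intro: order_0I)
    have "[:- z, 1:] * (\<Prod>z\<in>Z. [:- z, 1:]) \<noteq> 0"
      using insert by (simp add: prod_zero_iff del: mult_pCons_left)
    from order_mult[OF this, of x] show ?case using insert o1 by (auto simp del: mult_pCons_left)
  qed
  let ?h = "\<kappa> * q"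
  have h0: "?h \<noteq> 0" using \<kappa> q0 by simp
  have "even (order x ?h)" if "0 < x" "x < 1" for x
    unfolding order_mult[OF h0] oq using that by (auto simp: Z_def)
  from even_roots_no_sign_change[OF h0 this]
  obtain c :: real where c: "c \<noteq> 0" "\<And>x. 0 < x \<Longrightarrow> x < 1 \<Longrightarrow> 0 \<le> c * poly ?h x"
  proof
    assume "\<forall>x. 0 < x \<and> x < 1 \<longrightarrow> 0 \<le> poly ?h x"
    then show thesis by (intro that[of 1]) auto
  next
    assume "\<forall>x. 0 < x \<and> x < 1 \<longrightarrow> poly ?h x \<le> 0"
    then show thesis by (intro that[of "- 1"]) auto
  qed
  have "radial_functional D (smult c ([:1, - 1:] * ?h)) > 0"
  proof (rule radial_pos[OF D])
    show "smult c ([:1, - 1:] * ?h) \<noteq> 0" using c(1) h0 by (simp del: mult_pCons_left)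
    show "0 \<le> poly (smult c ([:1, - 1:] * ?h)) s" if "0 < s" "s < 1" for s
    proof -
      have "poly (smult c ([:1, - 1:] * ?h)) s = (1 - s) * (c * poly ?h s)" by (simp add: algebra_simps)
      also have "\<dots> \<ge> 0" using that by (intro mult_nonneg_nonneg[OF _ c(2)[OF that]]) auto
      finally show ?thesis .
    qed
  qed
  then have "radial_functional D ([:1, - 1:] * \<kappa> * q) \<noteq> 0"
    unfolding radial_smult mult.assoc by auto
  then have "\<not> card Z < m" using orth[of q] dq by auto
  with le have "card Z = m" by simp
  show thesis
    by (rule that[of Z]) (use fin sub \<open>card Z = m\<close> in \<open>auto simp: Z_def\<close>)
qed

text \<open>The kernel at \<open>1\<close> is orthogonal to lower degrees for the weight \<open>1 - s\<close>, so its zeros together with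
  \<open>1\<close> are the Radau nodes, and the weights are the integrals of the Lagrange basis.\<close>

lemma radau_quadrature:
  assumes D: "D > 0"
  obtains Z w where "finite Z" "Z \<subseteq> {0<..<1}" "card Z = m" "\<And>z. z \<in> Z \<Longrightarrow> (w z :: real) > 0"
    "\<And>p. degree p \<le> 2 * m \<Longrightarrow> radial_functional D p
        = real D / real ((m + 1) * (2 * m + D)) * poly p 1 + (\<Sum>z\<in>Z. w z * poly p z)"
proof -
  let ?L = "radial_functional D"
  obtain \<kappa> where \<kappa>: "degree \<kappa> \<le> m" "\<And>q. degree q \<le> m \<Longrightarrow> ?L (\<kappa> * q) = poly q 1"
    "poly \<kappa> 1 = real ((m + 1) * (2 * m + D)) / real D"
    by (rule endpoint_kernel_exists[OF D, of m]) (rule that)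
  have \<kappa>1: "poly \<kappa> 1 > 0" unfolding \<kappa>(3) using D by (intro divide_pos_pos) (simp_all del: of_nat_mult)
  then have \<kappa>0: "\<kappa> \<noteq> 0" by auto
  have orth: "?L ([:1, - 1:] * \<kappa> * q) = 0" if "degree q < m" for q
  proof -
    have "degree ([:1, - 1:] * q) \<le> m"
      using degree_mult_le[of "[:1, - 1:]" q] that by (simp del: mult_pCons_left)
    from \<kappa>(2)[OF this] show ?thesis by (simp add: ac_simps del: mult_pCons_left mult_pCons_right)
  qed
  obtain Z where Z: "finite Z" "Z \<subseteq> {0<..<1}" "card Z = m" "\<And>z. z \<in> Z \<Longrightarrow> poly \<kappa> z = 0"
    using kernel_roots[OF D \<kappa>(1) \<kappa>0 orth] by metis
  define N where "N = insert 1 Z"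
  have "1 \<notin> Z" using Z(2) by auto
  then have N: "finite N" "card N = Suc m" "1 \<notin> Z" using Z by (auto simp: N_def)
  define W where "W x = ?L (lagrange_basis N x)" for x
  \<comment> \<open>Interpolation at the \<open>m + 1\<close> nodes leaves an error divisible by \<open>(s - 1) * \<kappa>\<close>, whose cofactor has
    degree below \<open>m\<close>; so the rule is exact up to degree \<open>2 m\<close>.\<close>
  have quad: "?L p = (\<Sum>x\<in>N. W x * poly p x)" if "degree p \<le> 2 * m" for p
  proof -
    define I where "I = (\<Sum>x\<in>N. smult (poly p x) (lagrange_basis N x))"
    have "degree I < Suc m" unfolding I_def
      using degree_lagrange_basis[OF N(1)] N(2)
      by (intro degree_sum_less) (auto intro: le_less_trans[OF degree_smult_le])
    then have dI: "degree I \<le> m" by simp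
    have Iv: "poly I x = poly p x" if "x \<in> N" for x
      using that N unfolding I_def
      by (simp add: poly_sum poly_lagrange_basis if_distrib sum.delta cong: if_cong)
    have "(\<Prod>x\<in>N. [:- x, 1:]) dvd p - I" using N Iv by (intro prod_linear_dvd) auto
    then obtain q where q: "p - I = (\<Prod>x\<in>N. [:- x, 1:]) * q" by (auto simp: dvd_def)
    have "?L (p - I) = 0"
    proof (cases "p - I = 0")
      case True
      then show ?thesis by (simp add: radial_zero)
    next
      case False
      have "degree (p - I) = Suc m + degree q"
        using False unfolding q by (subst degree_mult_eq) (auto simp: degree_prod_linear N)
      moreover have "degree (p - I) \<le> 2 * m" using that dI by (intro degree_diff_le) auto
      ultimately have dq: "degree q < m" by simp
      have "(\<Prod>x\<in>Z. [:- x, 1:]) dvd \<kappa>" using Z by (intro prod_linear_dvd) auto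
      then obtain r where r: "\<kappa> = (\<Prod>x\<in>Z. [:- x, 1:]) * r" by (auto simp: dvd_def)
      have "degree r = 0"
      proof -
        have "degree \<kappa> = m + degree r"
          using \<kappa>0 unfolding r by (subst degree_mult_eq) (auto simp: degree_prod_linear Z)
        then show ?thesis using \<kappa>(1) by simp
      qed
      then obtain c where c: "r = [:c:]" by (meson degree_eq_zeroE)
      have c0: "c \<noteq> 0" using \<kappa>0 r c by auto
      have "[:1, - 1:] * \<kappa> * q = smult (- c) (p - I)"
      proof -
        have 1: "[:1, - 1:] * (P * [:c:]) * q = smult (- c) ([:- 1, 1:] * P * q)" for P
          by (simp add: algebra_simps smult_diff_right)
        show ?thesis unfolding q r c N_def prod.insert[OF Z(1) N(3)] by (rule 1)
      qed
      with orth[OF dq] have "- c * ?L (p - I) = 0" by (metis radial_smult)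
      then show ?thesis using c0 by simp
    qed
    then have "?L p = ?L I" by (simp add: radial_diff)
    also have "\<dots> = (\<Sum>x\<in>N. W x * poly p x)"
      unfolding I_def radial_sum radial_smult W_def by (simp add: mult.commute)
    finally show ?thesis .
  qed
  \<comment> \<open>Exactness for the square of a Lagrange basis polynomial, which is \<open>1\<close> at one node and \<open>0\<close> at the others.\<close>
  have Wpos: "W x > 0" if "x \<in> N" for x
  proof -
    let ?l = "lagrange_basis N x"
    have dl: "degree ?l \<le> m" using degree_lagrange_basis[OF N(1) that] N by simp
    have "degree (?l * ?l) \<le> 2 * m" using degree_mult_le[of ?l ?l] dl by simp
    from quad[OF this] have "?L (?l * ?l) = W x"
      using N that by (simp add: poly_lagrange_basis if_distrib sum.delta cong: if_cong)
    moreover have "?l \<noteq> 0" using poly_lagrange_basis[OF N(1) that that] by auto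
    then have "?L (?l * ?l) > 0" using D by (intro radial_pos) auto
    ultimately show ?thesis by simp
  qed
  \<comment> \<open>Exactness for \<open>\<kappa>\<close> itself, which vanishes at all nodes except \<open>1\<close> and has integral \<open>1\<close>.\<close>
  have "W 1 * poly \<kappa> 1 = 1"
  proof -
    have "degree \<kappa> \<le> 2 * m" using \<kappa> by simp
    from quad[OF this] have "?L \<kappa> = W 1 * poly \<kappa> 1"
      using N Z by (simp add: N_def)
    moreover have "?L (\<kappa> * 1) = 1" using \<kappa>(2)[of 1] by simp
    ultimately show ?thesis by simp
  qed
  then have W1: "W 1 = real D / real ((m + 1) * (2 * m + D))"
  proof -
    have "W 1 = 1 / poly \<kappa> 1"
      using \<open>W 1 * poly \<kappa> 1 = 1\<close> \<kappa>1 by (simp add: eq_divide_eq)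
    then show ?thesis unfolding \<kappa>(3) by simp
  qed
  show thesis
  proof (rule that[of Z W])
    show "?L p = real D / real ((m + 1) * (2 * m + D)) * poly p 1 + (\<Sum>z\<in>Z. W z * poly p z)"
      if "degree p \<le> 2 * m" for p
      using quad[OF that] N Z W1 by (simp add: N_def)
  qed (use Z Wpos in \<open>auto simp: N_def\<close>)
qed

text \<open>Here \<open>n\<close> bounds the degree of the radial profile. The value is that of the reproducing kernel at
  \<open>(1, 1)\<close>: in dimension \<open>D\<close> for even \<open>n\<close>, and in dimension \<open>D + 2\<close>, rescaled, for odd \<open>n\<close>.\<close>

definition radial_weight :: "nat \<Rightarrow> nat \<Rightarrow> real" where
  "radial_weight D n = real ((n div 2 + 1) * (2 * ((n + 1) div 2) + D)) / real D"

lemma radial_weight_pos: "D > 0 \<Longrightarrow> radial_weight D n > 0"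
  unfolding radial_weight_def by (intro divide_pos_pos) (simp_all del: of_nat_mult)

text \<open>For odd \<open>n = 2 m + 1\<close> write \<open>p s = p 0 + s * q s\<close> and apply the Radau rule in dimension \<open>D + 2\<close> to \<open>q\<close>.\<close>

lemma endpoint_quadrature:
  assumes D: "D > 0"
  obtains Z w w0 where "finite Z" "Z \<subseteq> {0<..<1}" "card Z = n div 2" "\<And>z. z \<in> Z \<Longrightarrow> (w z :: real) > 0"
    "w0 \<ge> 0" "even n \<Longrightarrow> w0 = 0"
    "\<And>p. degree p \<le> n \<Longrightarrow> radial_functional D p
        = poly p 1 / radial_weight D n + w0 * poly p 0 + (\<Sum>z\<in>Z. w z * poly p z)"
proof (cases "even n")
  case True
  then obtain m where n: "n = 2 * m" by (auto elim: evenE)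
  obtain Z and w :: "real \<Rightarrow> real" where Zw: "finite Z" "Z \<subseteq> {0<..<1}" "card Z = m" "\<And>z. z \<in> Z \<Longrightarrow> w z > 0"
    "\<And>p. degree p \<le> 2 * m \<Longrightarrow> radial_functional D p
        = real D / real ((m + 1) * (2 * m + D)) * poly p 1 + (\<Sum>z\<in>Z. w z * poly p z)"
    by (rule radau_quadrature[OF D, of m]) (rule that)
  show thesis
    by (rule that[of Z w 0]) (use Zw in \<open>auto simp: n radial_weight_def field_simps\<close>)
next
  case False
  then obtain m where n: "n = 2 * m + 1" by (auto elim: oddE)
  have D2: "D + 2 > 0" by simp
  let ?M = "real (D + 2) / real ((m + 1) * (2 * m + (D + 2)))"
  obtain Z and w :: "real \<Rightarrow> real" where Zw: "finite Z" "Z \<subseteq> {0<..<1}" "card Z = m" "\<And>z. z \<in> Z \<Longrightarrow> w z > 0"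
    "\<And>p. degree p \<le> 2 * m \<Longrightarrow> radial_functional (D + 2) p = ?M * poly p 1 + (\<Sum>z\<in>Z. w z * poly p z)"
    by (rule radau_quadrature[OF D2, of m]) (rule that)
  let ?t = "real D / real (D + 2)"
  define v where "v z = ?t * w z / z" for z
  define w0 where "w0 = 1 - (?t * ?M + (\<Sum>z\<in>Z. v z))"
  have tM: "?t * ?M = 1 / radial_weight D n"
  proof -
    have "n div 2 = m" "(n + 1) div 2 = m + 1" by (simp_all add: n)
    then have "1 / radial_weight D n = real D / real ((m + 1) * (2 * m + (D + 2)))"
      by (simp only: radial_weight_def divide_divide_eq_right mult_1) (simp add: algebra_simps)
    moreover have "real (D + 2) \<noteq> 0" by simp
    ultimately show ?thesis by (metis times_divide_times_eq mult.commute nonzero_mult_divide_mult_cancel_left)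
  qed
  have quad: "radial_functional D p = poly p 1 / radial_weight D n + w0 * poly p 0 + (\<Sum>z\<in>Z. v z * poly p z)"
    if "degree p \<le> n" for p
  proof -
    obtain a q where p: "p = pCons a q" by (cases p)
    have dq: "degree q \<le> 2 * m" using that unfolding p n by (cases "q = 0") auto
    have "p = smult a 1 + pCons 0 q" by (simp add: p one_pCons)
    then have "radial_functional D p = a + ?t * radial_functional (D + 2) q"
      using radial_pCons_0[OF D, of q] by (simp only: radial_add radial_smult radial_one[OF D])
    also have "\<dots> = a + ?t * ?M * poly q 1 + (\<Sum>z\<in>Z. ?t * w z * poly q z)"
      unfolding Zw(5)[OF dq] by (simp add: sum_distrib_left ring_distribs mult.assoc)
    also have "(\<Sum>z\<in>Z. ?t * w z * poly q z) = (\<Sum>z\<in>Z. v z * poly p z) - a * (\<Sum>z\<in>Z. v z)"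
      unfolding sum_distrib_left sum_subtractf[symmetric]
    proof (rule sum.cong[OF refl])
      fix z assume "z \<in> Z"
      then have "v z * z = ?t * w z" using Zw(2) by (auto simp: v_def)
      then have "?t * w z * poly q z = v z * (z * poly q z)" by (simp only: mult.assoc[symmetric])
      then show "?t * w z * poly q z = v z * poly p z - a * v z"
        by (simp add: p algebra_simps)
    qed
    finally have e: "radial_functional D p = a + 1 / radial_weight D n * poly q 1
        + ((\<Sum>z\<in>Z. v z * poly p z) - a * (\<Sum>z\<in>Z. v z))"
      unfolding tM .
    show ?thesis
      unfolding e w0_def tM by (simp add: p algebra_simps add_divide_distrib)
  qed
  \<comment> \<open>Exactness for \<open>1 - s\<close> times the squared node polynomial isolates the weight at \<open>0\<close>.\<close>
  have "w0 \<ge> 0"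
  proof -
    define q where "q = (\<Prod>z\<in>Z. [:- z, 1:])"
    let ?p = "[:1, - 1:] * (q * q)"
    have q0: "q \<noteq> 0" by (simp add: q_def prod_zero_iff Zw(1))
    have "degree q = m" using Zw by (simp add: q_def degree_prod_linear)
    then have "degree ?p \<le> n"
      using degree_mult_le[of "[:1, - 1:]" "q * q"] degree_mult_le[of q q] by (simp add: n del: mult_pCons_left)
    from quad[OF this] have "radial_functional D ?p = w0 * (poly q 0)\<^sup>2"
      using Zw(1) by (auto simp: q_def poly_prod power2_eq_square intro!: sum.neutral)
    moreover have "radial_functional D ?p > 0"
    proof (rule radial_pos[OF D])
      show "?p \<noteq> 0" using q0 by (simp del: mult_pCons_left)
      fix s :: real assume "0 < s" "s < 1"
      then have "0 \<le> (1 - s) * (poly q s * poly q s)" by (intro mult_nonneg_nonneg[OF _ zero_le_square]) auto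
      then show "0 \<le> poly ?p s" by (simp add: algebra_simps)
    qed
    ultimately show ?thesis by (simp add: zero_less_mult_iff)
  qed
  show thesis
    by (rule that[of Z v w0]) (use Zw quad \<open>w0 \<ge> 0\<close> False D in \<open>auto simp: v_def n\<close>)
qed

text \<open>Vanishing at every node except \<open>1\<close> makes the quadrature rule an identity between the integral and
  the value at \<open>1\<close>; squares keep the polynomial nonnegative.\<close>

lemma extremal_radial_polynomial:
  assumes D: "D > 0"
  obtains q where "degree q \<le> n" "\<And>s. 0 \<le> s \<Longrightarrow> 0 \<le> poly q s" "poly q 1 > 0"
    "radial_functional D q = poly q 1 / radial_weight D n"
proof -
  obtain Z and w :: "real \<Rightarrow> real" and w0 where Zw: "finite Z" "Z \<subseteq> {0<..<1}" "card Z = n div 2"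
    "even n \<Longrightarrow> w0 = 0"
    "\<And>p. degree p \<le> n \<Longrightarrow> radial_functional D p
        = poly p 1 / radial_weight D n + w0 * poly p 0 + (\<Sum>z\<in>Z. w z * poly p z)"
    by (rule endpoint_quadrature[OF D, of n], rule that)
  define q where "q = (\<Prod>z\<in>Z. [:- z, 1:])"
  define r where "r = (if even n then q * q else [:0, 1:] * (q * q))"
  have dq: "degree q = n div 2" using Zw by (simp add: q_def degree_prod_linear)
  have dr: "degree r \<le> n"
    using degree_mult_le[of "[:0, 1:]" "q * q"] degree_mult_le[of q q] dq
    by (auto simp: r_def simp del: mult_pCons_left) presburger
  have q1: "poly q 1 \<noteq> 0" using Zw by (auto simp: q_def poly_prod prod_zero_iff)
  show thesis
  proof (rule that[of r])
    show "radial_functional D r = poly r 1 / radial_weight D n"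
      unfolding Zw(5)[OF dr] using Zw(1,4) by (auto simp: r_def q_def poly_prod intro!: sum.neutral)
    show "poly r 1 > 0" using q1 by (auto simp: r_def zero_less_mult_iff)
    show "0 \<le> poly r s" if "0 \<le> s" for s using that by (auto simp: r_def)
  qed (use dr in auto)
qed

section \<open>Hausdorff measure\<close>

definition cover_cost :: "nat \<Rightarrow> 'a::metric_space set \<Rightarrow> ennreal" where
  "cover_cost d S = (if S = {} then 0 else ennreal (diameter S ^ d))"

definition small_cover :: "real \<Rightarrow> 'a::metric_space set \<Rightarrow> (nat \<Rightarrow> 'a set) \<Rightarrow> bool" where
  "small_cover \<delta> A C \<longleftrightarrow> A \<subseteq> (\<Union>i. C i) \<and> (\<forall>i. bounded (C i) \<and> diameter (C i) \<le> \<delta>)"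

lemma hausdorff_pre_eq: "hausdorff_pre d \<delta> A = (INF C \<in> Collect (small_cover \<delta> A). \<Sum>i. cover_cost d (C i))"
  unfolding hausdorff_pre_def small_cover_def cover_cost_def by simp

lemma hausdorff_pre_le: "small_cover \<delta> A C \<Longrightarrow> hausdorff_pre d \<delta> A \<le> (\<Sum>i. cover_cost d (C i))"
  unfolding hausdorff_pre_eq by (rule INF_lower) simp

lemma hausdorff_pre_geI:
  assumes "\<And>C. small_cover \<delta> A C \<Longrightarrow> b \<le> (\<Sum>i. cover_cost d (C i))"
  shows "b \<le> hausdorff_pre d \<delta> A"
  unfolding hausdorff_pre_eq by (rule INF_greatest) (use assms in auto)

lemma hausdorff_pre_approx:
  assumes "hausdorff_pre d \<delta> A < b"
  obtains C where "small_cover \<delta> A C" "(\<Sum>i. cover_cost d (C i)) < b"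
  using assms unfolding hausdorff_pre_eq INF_less_iff by auto

lemma cover_cost_empty [simp]: "cover_cost d {} = 0"
  by (simp add: cover_cost_def)

lemma cover_cost_mono: "S \<subseteq> T \<Longrightarrow> bounded T \<Longrightarrow> cover_cost d S \<le> cover_cost d T"
proof (cases "S = {}")
  case False
  assume *: "S \<subseteq> T" "bounded T"
  then have "diameter S ^ d \<le> diameter T ^ d"
    by (intro power_mono diameter_subset diameter_ge_0) (auto intro: bounded_subset)
  with * False show ?thesis by (auto simp: cover_cost_def intro!: ennreal_leI)
qed simp

lemma diameter_leI:
  fixes S :: "'a::metric_space set"
  assumes "0 \<le> b" "\<And>x y. x \<in> S \<Longrightarrow> y \<in> S \<Longrightarrow> dist x y \<le> b"
  shows "diameter S \<le> b"
  using assms by (auto simp: diameter_def intro!: cSUP_least)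

lemma hausdorff_pre_antimono: "\<delta> \<le> \<epsilon> \<Longrightarrow> hausdorff_pre d \<epsilon> A \<le> hausdorff_pre d \<delta> A"
  by (rule hausdorff_pre_geI, rule hausdorff_pre_le) (auto simp: small_cover_def intro: order.trans)

lemma hausdorff_pre_mono: "A \<subseteq> B \<Longrightarrow> hausdorff_pre d \<delta> A \<le> hausdorff_pre d \<delta> B"
  by (rule hausdorff_pre_geI, rule hausdorff_pre_le) (force simp: small_cover_def)

lemma hausdorff_pre_empty: "0 \<le> \<delta> \<Longrightarrow> hausdorff_pre d \<delta> {} = 0"
  using hausdorff_pre_le[of \<delta> "{}" "\<lambda>_. {}" d] by (simp add: small_cover_def)

text \<open>Choose covers of the \<open>A n\<close> that are optimal up to \<open>e / 2 ^ Suc n\<close> and enumerate them together.\<close>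

lemma hausdorff_pre_countably_subadditive:
  fixes A :: "nat \<Rightarrow> 'a::metric_space set"
  shows "hausdorff_pre d \<delta> (\<Union>n. A n) \<le> (\<Sum>n. hausdorff_pre d \<delta> (A n))"
proof (rule ennreal_le_epsilon)
  fix e :: real assume e: "0 < e" and fin: "(\<Sum>n. hausdorff_pre d \<delta> (A n)) < top"
  have "\<exists>C. small_cover \<delta> (A n) C
      \<and> (\<Sum>i. cover_cost d (C i)) \<le> hausdorff_pre d \<delta> (A n) + ennreal (e * (1 / 2) ^ Suc n)" for n
  proof -
    have "hausdorff_pre d \<delta> (A n) \<le> (\<Sum>n. hausdorff_pre d \<delta> (A n))"
      using sum_le_suminf[of "\<lambda>n. hausdorff_pre d \<delta> (A n)" "{n}"] by simp
    then have "hausdorff_pre d \<delta> (A n) < top" using fin by (rule le_less_trans)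
    then have "hausdorff_pre d \<delta> (A n) < hausdorff_pre d \<delta> (A n) + ennreal (e * (1 / 2) ^ Suc n)"
      using e by (simp add: ennreal_add_left_cancel_less[of _ 0, simplified])
    then show ?thesis by (elim hausdorff_pre_approx) auto
  qed
  then obtain C where C: "\<And>n. small_cover \<delta> (A n) (C n)"
    "\<And>n. (\<Sum>i. cover_cost d (C n i)) \<le> hausdorff_pre d \<delta> (A n) + ennreal (e * (1 / 2) ^ Suc n)"
    by metis
  define E where "E k = case_prod C (prod_decode k)" for k
  have "small_cover \<delta> (\<Union>n. A n) E"
    unfolding small_cover_def
  proof safe
    fix x n assume "x \<in> A n"
    then obtain i where "x \<in> C n i" using C(1)[of n] unfolding small_cover_def by blast
    then have "x \<in> E (prod_encode (n, i))" by (simp add: E_def)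
    then show "x \<in> (\<Union>k. E k)" by blast
  next
    fix k
    show "bounded (E k)" "diameter (E k) \<le> \<delta>"
      using C(1) by (auto simp: E_def small_cover_def split: prod.split)
  qed
  then have "hausdorff_pre d \<delta> (\<Union>n. A n) \<le> (\<Sum>k. cover_cost d (E k))" by (rule hausdorff_pre_le)
  also have "\<dots> = (\<Sum>n. \<Sum>i. cover_cost d (C n i))"
  proof -
    have "(\<Sum>k. cover_cost d (E k)) = (\<Sum>k. (\<lambda>(n, i). cover_cost d (C n i)) (prod_decode k))"
      by (simp add: E_def case_prod_beta)
    also have "\<dots> = (\<Sum>n. \<Sum>i. cover_cost d (C n i))"
      by (rule suminf_ennreal_2dimen) simp
    finally show ?thesis .
  qed
  also have "\<dots> \<le> (\<Sum>n. hausdorff_pre d \<delta> (A n) + ennreal (e * (1 / 2) ^ Suc n))"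
    by (intro suminf_le C(2) allI) auto
  also have "\<dots> = (\<Sum>n. hausdorff_pre d \<delta> (A n)) + (\<Sum>n. ennreal (e * (1 / 2) ^ Suc n))"
    by (rule suminf_add[symmetric]) auto
  also have "(\<Sum>n. ennreal (e * (1 / 2) ^ Suc n)) = ennreal e"
    using e sums_mult[OF power_half_series, of e]
    by (intro suminf_ennreal_eq) (auto simp del: power_Suc)
  finally show "hausdorff_pre d \<delta> (\<Union>n. A n) \<le> (\<Sum>n. hausdorff_pre d \<delta> (A n)) + ennreal e" .
qed

lemma hausdorff_outer_empty: "hausdorff_outer d {} = 0"
  using SUP_least[of "{0<..}" "\<lambda>\<delta>. hausdorff_pre d \<delta> {}" 0]
  unfolding hausdorff_outer_def by (simp add: hausdorff_pre_empty)

lemma hausdorff_outer_mono: "A \<subseteq> B \<Longrightarrow> hausdorff_outer d A \<le> hausdorff_outer d B"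
  unfolding hausdorff_outer_def by (intro SUP_mono') (rule hausdorff_pre_mono)

lemma hausdorff_pre_le_outer: "0 < \<delta> \<Longrightarrow> hausdorff_pre d \<delta> A \<le> hausdorff_outer d A"
  unfolding hausdorff_outer_def by (rule SUP_upper) simp

lemma hausdorff_outer_leI: "(\<And>\<delta>. 0 < \<delta> \<Longrightarrow> hausdorff_pre d \<delta> A \<le> b) \<Longrightarrow> hausdorff_outer d A \<le> b"
  unfolding hausdorff_outer_def by (rule SUP_least) simp

lemma hausdorff_outer_countably_subadditive:
  "hausdorff_outer d (\<Union>n. A n) \<le> (\<Sum>n. hausdorff_outer d (A n))"
proof (rule hausdorff_outer_leI)
  fix \<delta> :: real assume "0 < \<delta>"
  have "hausdorff_pre d \<delta> (\<Union>n. A n) \<le> (\<Sum>n. hausdorff_pre d \<delta> (A n))"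
    by (rule hausdorff_pre_countably_subadditive)
  also have "\<dots> \<le> (\<Sum>n. hausdorff_outer d (A n))"
    using \<open>0 < \<delta>\<close> by (intro suminf_le hausdorff_pre_le_outer allI) auto
  finally show "hausdorff_pre d \<delta> (\<Union>n. A n) \<le> (\<Sum>n. hausdorff_outer d (A n))" .
qed

lemma hausdorff_outer_Un: "hausdorff_outer d (A \<union> B) \<le> hausdorff_outer d A + hausdorff_outer d B"
proof -
  have "hausdorff_outer d (\<Union>n. binaryset A B n) \<le> (\<Sum>n. hausdorff_outer d (binaryset A B n))"
    by (rule hausdorff_outer_countably_subadditive)
  then show ?thesis
    by (simp add: UN_binaryset_eq suminf_binaryset_eq hausdorff_outer_empty)
qed

text \<open>Covering sets of diameter below the distance of \<open>A\<close> and \<open>B\<close> cannot meet both.\<close>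

lemma hausdorff_outer_separated:
  assumes r: "0 < r" "\<And>x y. x \<in> A \<Longrightarrow> y \<in> B \<Longrightarrow> r \<le> dist x y"
  shows "hausdorff_outer d A + hausdorff_outer d B \<le> hausdorff_outer d (A \<union> B)"
proof -
  have pre: "hausdorff_pre d \<delta> A + hausdorff_pre d \<delta> B \<le> hausdorff_pre d \<delta> (A \<union> B)" if \<delta>: "0 < \<delta>" "\<delta> < r" for \<delta>
  proof (rule hausdorff_pre_geI)
    fix C assume C: "small_cover \<delta> (A \<union> B) C"
    define CA where "CA i = (if C i \<inter> A = {} then {} else C i)" for i
    define CB where "CB i = (if C i \<inter> A = {} then C i else {})" for i
    have noB: "C i \<inter> B = {}" if CA: "C i \<inter> A \<noteq> {}" for i
    proof (rule ccontr)
      assume "C i \<inter> B \<noteq> {}"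
      then obtain x y where xy: "x \<in> C i" "x \<in> A" "y \<in> C i" "y \<in> B" using CA by blast
      have "dist x y \<le> diameter (C i)"
        using C xy by (intro diameter_bounded_bound) (auto simp: small_cover_def)
      also have "\<dots> \<le> \<delta>" using C by (auto simp: small_cover_def)
      finally show False using r(2)[OF xy(2,4)] \<delta> by simp
    qed
    have "small_cover \<delta> A CA" using C \<delta> unfolding small_cover_def CA_def by fastforce
    moreover have "small_cover \<delta> B CB"
      unfolding small_cover_def
    proof safe
      fix x assume "x \<in> B"
      then obtain i where i: "x \<in> C i" using C unfolding small_cover_def by blast
      then have "x \<in> CB i" using noB[of i] \<open>x \<in> B\<close> by (auto simp: CB_def)
      then show "x \<in> (\<Union>i. CB i)" by blast
    qed (use C \<delta> in \<open>auto simp: CB_def small_cover_def\<close>)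
    ultimately have "hausdorff_pre d \<delta> A + hausdorff_pre d \<delta> B
        \<le> (\<Sum>i. cover_cost d (CA i)) + (\<Sum>i. cover_cost d (CB i))"
      by (intro add_mono hausdorff_pre_le)
    also have "\<dots> = (\<Sum>i. cover_cost d (CA i) + cover_cost d (CB i))"
      by (rule suminf_add) auto
    also have "\<dots> = (\<Sum>i. cover_cost d (C i))"
      by (intro suminf_cong) (simp add: CA_def CB_def)
    finally show "hausdorff_pre d \<delta> A + hausdorff_pre d \<delta> B \<le> (\<Sum>i. cover_cost d (C i))" .
  qed
  have "hausdorff_pre d \<delta> A + hausdorff_pre d \<epsilon> B \<le> hausdorff_outer d (A \<union> B)" if "0 < \<delta>" "0 < \<epsilon>" for \<delta> \<epsilon>
  proof -
    define \<eta> where "\<eta> = min (min \<delta> \<epsilon>) (r / 2)"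
    have \<eta>: "0 < \<eta>" "\<eta> < r" "\<eta> \<le> \<delta>" "\<eta> \<le> \<epsilon>" using that r by (auto simp: \<eta>_def)
    have "hausdorff_pre d \<delta> A + hausdorff_pre d \<epsilon> B \<le> hausdorff_pre d \<eta> A + hausdorff_pre d \<eta> B"
      using \<eta> by (intro add_mono hausdorff_pre_antimono)
    also have "\<dots> \<le> hausdorff_outer d (A \<union> B)"
      using pre[OF \<eta>(1,2)] hausdorff_pre_le_outer[OF \<eta>(1)] order.trans by blast
    finally show ?thesis .
  qed
  then show ?thesis
    unfolding hausdorff_outer_def[of d A] hausdorff_outer_def[of d B]
    by (simp add: ennreal_SUP_add_left[symmetric] ennreal_SUP_add_right SUP_le_iff del: SUP_least)
qed

text \<open>Among the layers of one parity any two are at positive distance, so the outer measure is additive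
  on finitely many of them.\<close>

lemma hausdorff_outer_Union_separated_layers:
  fixes R :: "nat \<Rightarrow> 'a::metric_space set"
  assumes "\<And>i j. i + 2 \<le> j \<Longrightarrow> \<exists>r>0. \<forall>x\<in>R i. \<forall>y\<in>R j. r \<le> dist x y"
  shows "(\<Sum>i<n. hausdorff_outer d (R (2 * i + a))) \<le> hausdorff_outer d (\<Union>i<n. R (2 * i + a))"
proof (induction n)
  case 0
  then show ?case by simp
next
  case (Suc n)
  have "\<exists>r. \<forall>i<n. r i > 0 \<and> (\<forall>x\<in>R (2 * i + a). \<forall>y\<in>R (2 * n + a). r i \<le> dist x y)"
  proof (rule choice, rule)
    fix i
    show "\<exists>y. i < n \<longrightarrow> 0 < y \<and> (\<forall>x\<in>R (2 * i + a). \<forall>z\<in>R (2 * n + a). y \<le> dist x z)"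
      using assms[of "2 * i + a" "2 * n + a"] by (cases "i < n") auto
  qed
  then obtain r where r: "\<And>i. i < n \<Longrightarrow> r i > 0"
    "\<And>i x y. i < n \<Longrightarrow> x \<in> R (2 * i + a) \<Longrightarrow> y \<in> R (2 * n + a) \<Longrightarrow> r i \<le> dist x y" by blast
  define s where "s = Min (insert 1 (r ` {..<n}))"
  have s0: "s > 0" using r(1) by (auto simp: s_def)
  have sr: "s \<le> r i" if "i < n" for i using that by (auto simp: s_def intro: Min_le)
  have "(\<Sum>i<Suc n. hausdorff_outer d (R (2 * i + a)))
      \<le> hausdorff_outer d (\<Union>i<n. R (2 * i + a)) + hausdorff_outer d (R (2 * n + a))"
    using Suc by (simp add: add_right_mono)
  also have "\<dots> \<le> hausdorff_outer d ((\<Union>i<n. R (2 * i + a)) \<union> R (2 * n + a))"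
  proof (rule hausdorff_outer_separated[OF s0])
    fix x y assume "x \<in> (\<Union>i<n. R (2 * i + a))" "y \<in> R (2 * n + a)"
    then obtain i where "i < n" "x \<in> R (2 * i + a)" by blast
    then show "s \<le> dist x y" using r(2) sr \<open>y \<in> _\<close> order.trans by blast
  qed
  also have "(\<Union>i<n. R (2 * i + a)) \<union> R (2 * n + a) = (\<Union>i<Suc n. R (2 * i + a))"
    by (auto simp: less_Suc_eq)
  finally show ?case .
qed

text \<open>Caratheodory's criterion for metric outer measures. The part of \<open>A\<close> outside \<open>F\<close> is exhausted by the
  sets \<open>B n\<close> of points at distance at least \<open>1 / Suc n\<close> from \<open>F\<close>, which are separated from \<open>F\<close>. The
  remainder is covered by the layers \<open>R i\<close> with \<open>i \<ge> n\<close>. Their measures are summable, because the even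
  and the odd layers are each separated, so the remainder becomes negligible.\<close>

lemma hausdorff_closed_split:
  fixes F :: "'a::metric_space set"
  assumes F: "closed F"
  shows "hausdorff_outer d (A \<inter> F) + hausdorff_outer d (A - F) \<le> hausdorff_outer d A"
proof (cases "hausdorff_outer d A = top \<or> F = {}")
  case True
  then show ?thesis by (auto simp: hausdorff_outer_empty)
next
  case False
  then have fin: "hausdorff_outer d A < top" and F0: "F \<noteq> {}" by (auto simp: less_top)
  let ?H = "hausdorff_outer d"
  define B where "B n = {x \<in> A. 1 / real (Suc n) \<le> infdist x F}" for n
  define R where "R n = {x \<in> A. 1 / real (Suc (Suc n)) \<le> infdist x F \<and> infdist x F < 1 / real (Suc n)}" for n
  have sep: "\<exists>r>0. \<forall>x\<in>R i. \<forall>y\<in>R j. r \<le> dist x y" if "i + 2 \<le> j" for i j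
  proof (intro exI conjI ballI)
    have "real (Suc (Suc i)) < real (Suc j)" using that by simp
    then show "0 < 1 / real (Suc (Suc i)) - 1 / real (Suc j)"
      by (simp add: frac_less2 del: of_nat_Suc)
    fix x y assume "x \<in> R i" "y \<in> R j"
    then have "1 / real (Suc (Suc i)) \<le> infdist x F" "infdist y F \<le> 1 / real (Suc j)" by (auto simp: R_def)
    moreover have "infdist x F \<le> infdist y F + dist x y" by (rule infdist_triangle)
    ultimately show "1 / real (Suc (Suc i)) - 1 / real (Suc j) \<le> dist x y" by linarith
  qed
  have half: "(\<Sum>i<n. ?H (R (2 * i + a))) \<le> ?H A" for n a
    by (rule order.trans[OF hausdorff_outer_Union_separated_layers[OF sep]])
       (auto intro!: hausdorff_outer_mono simp: R_def)
  have partial: "(\<Sum>i<n. ?H (R i)) \<le> ?H A + ?H A" for n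
  proof -
    have "(\<Sum>i<n. ?H (R i)) \<le> (\<Sum>i<2 * n. ?H (R i))" by (rule sum_mono2) auto
    also have "\<dots> = (\<Sum>i<n. ?H (R (2 * i + 0))) + (\<Sum>i<n. ?H (R (2 * i + 1)))"
      by (induction n) (simp_all add: algebra_simps)
    also have "\<dots> \<le> ?H A + ?H A" by (intro add_mono half)
    finally show ?thesis .
  qed
  have summ: "(\<Sum>i. ?H (R i)) < top"
  proof -
    have "(\<Sum>i. ?H (R i)) \<le> ?H A + ?H A"
      unfolding suminf_eq_SUP by (rule SUP_least) (rule partial)
    also have "\<dots> < top" using fin by simp
    finally show ?thesis .
  qed
  have AF: "A - F = B n \<union> (\<Union>i. R (i + n))" for n
  proof (intro equalityI subsetI)
    fix x assume x: "x \<in> A - F"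
    then have pos: "0 < infdist x F"
      using F F0 in_closed_iff_infdist_zero[of F x] infdist_nonneg[of x F] by fastforce
    show "x \<in> B n \<union> (\<Union>i. R (i + n))"
    proof (cases "x \<in> B n")
      case False
      define m where "m = (LEAST m. 1 / real (Suc m) \<le> infdist x F)"
      obtain k where "1 / real (Suc k) < infdist x F"
        using pos reals_Archimedean by (auto simp: inverse_eq_divide)
      then have m: "1 / real (Suc m) \<le> infdist x F"
        unfolding m_def by (intro LeastI[of "\<lambda>m. 1 / real (Suc m) \<le> infdist x F" k]) simp
      have "\<not> m \<le> n"
      proof
        assume "m \<le> n"
        then have "1 / real (Suc n) \<le> 1 / real (Suc m)" by (simp add: frac_le)
        then show False using m False x by (auto simp: B_def)
      qed
      then obtain i where i: "m = Suc (i + n)" by (metis add.commute less_imp_Suc_add not_le)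
      have "\<not> 1 / real (Suc (i + n)) \<le> infdist x F"
        using not_less_Least[of "i + n" "\<lambda>m. 1 / real (Suc m) \<le> infdist x F"] i unfolding m_def by simp
      then have "x \<in> R (i + n)" using m i x by (auto simp: R_def)
      then show ?thesis by blast
    qed simp
  next
    fix x assume "x \<in> B n \<union> (\<Union>i. R (i + n))"
    then have "x \<in> A" "0 < infdist x F"
      by (auto simp: B_def R_def intro: less_le_trans[rotated])
    then show "x \<in> A - F" by auto
  qed
  have step: "?H (A \<inter> F) + ?H (A - F) \<le> ?H A + (\<Sum>i. ?H (R (i + n)))" for n
  proof -
    have "?H (A - F) \<le> ?H (B n) + ?H (\<Union>i. R (i + n))"
      using AF[of n] hausdorff_outer_Un by metis
    also have "\<dots> \<le> ?H (B n) + (\<Sum>i. ?H (R (i + n)))"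
      by (intro add_left_mono hausdorff_outer_countably_subadditive)
    finally have "?H (A \<inter> F) + ?H (A - F) \<le> (?H (A \<inter> F) + ?H (B n)) + (\<Sum>i. ?H (R (i + n)))"
      by (simp add: add.assoc add_left_mono)
    also have "?H (A \<inter> F) + ?H (B n) \<le> ?H (A \<inter> F \<union> B n)"
    proof (rule hausdorff_outer_separated)
      show "0 < 1 / real (Suc n)" by simp
      fix x y assume "x \<in> A \<inter> F" "y \<in> B n"
      then show "1 / real (Suc n) \<le> dist x y"
        using infdist_le[of x F y] by (auto simp: B_def dist_commute)
    qed
    also have "\<dots> \<le> ?H A" by (rule hausdorff_outer_mono) (auto simp: B_def)
    finally show ?thesis by (simp add: add_right_mono)
  qed
  have "(\<lambda>n. \<Sum>i. ?H (R (i + n))) \<longlonglongrightarrow> 0"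
  proof -
    have "summable (\<lambda>i. enn2real (?H (R i)))"
    proof (rule summableI_nonneg_bounded)
      fix n
      have f: "?H (R i) < top" for i
        using hausdorff_outer_mono[of "R i" A d] fin by (auto simp: R_def intro: le_less_trans)
      have "ennreal (\<Sum>i<n. enn2real (?H (R i))) = (\<Sum>i<n. ?H (R i))"
        using f by (simp add: sum_ennreal[symmetric])
      also have "\<dots> \<le> ?H A + ?H A" by (rule partial)
      also have "\<dots> = ennreal (enn2real (?H A) + enn2real (?H A))"
        using fin by (metis ennreal_enn2real ennreal_plus enn2real_nonneg)
      finally show "(\<Sum>i<n. enn2real (?H (R i))) \<le> enn2real (?H A) + enn2real (?H A)"
        by (subst (asm) ennreal_le_iff) auto
    qed simp
    then have lim: "(\<lambda>n. \<Sum>i. enn2real (?H (R (i + n)))) \<longlonglongrightarrow> 0"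
      by (rule suminf_exist_split2)
    have "(\<Sum>i. ?H (R (i + n))) = ennreal (\<Sum>i. enn2real (?H (R (i + n))))" for n
    proof -
      have f: "?H (R i) < top" for i
        using hausdorff_outer_mono[of "R i" A d] fin by (auto simp: R_def intro: le_less_trans)
      have "summable (\<lambda>i. enn2real (?H (R (i + n))))"
        using \<open>summable (\<lambda>i. enn2real (?H (R i)))\<close> by (rule summable_ignore_initial_segment)
      then show ?thesis using f
        by (subst suminf_ennreal2[symmetric]) auto
    qed
    then show ?thesis using tendsto_ennrealI[OF lim] by simp
  qed
  then have "(\<lambda>n. ?H A + (\<Sum>i. ?H (R (i + n)))) \<longlonglongrightarrow> ?H A + 0"
    by (intro tendsto_add tendsto_const)
  then show ?thesis using step by (intro LIMSEQ_le_const) auto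
qed

lemma measure_space_hausdorff: "measure_space UNIV (sets borel) (hausdorff_outer d :: 'a::metric_space set \<Rightarrow> ennreal)"
proof -
  let ?H = "hausdorff_outer d :: 'a set \<Rightarrow> ennreal"
  interpret P: sigma_algebra "UNIV :: 'a set" "Pow UNIV" by (rule sigma_algebra_Pow)
  have om: "outer_measure_space (Pow UNIV) ?H"
    unfolding outer_measure_space_def
    by (auto simp: positive_def increasing_def countably_subadditive_def hausdorff_outer_empty
        intro: hausdorff_outer_mono hausdorff_outer_countably_subadditive)
  let ?L = "lambda_system UNIV (Pow UNIV) ?H"
  have ms: "measure_space UNIV ?L ?H" by (rule P.caratheodory_lemma[OF om])
  then interpret L: sigma_algebra UNIV ?L by (simp add: measure_space_def)
  have "F \<in> ?L" if "closed F" for F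
  proof -
    have "?H (A \<inter> F) + ?H (A - F) = ?H A" for A
      using hausdorff_closed_split[OF that, of d A] hausdorff_outer_Un[of d "A \<inter> F" "A - F"]
      by (simp add: Int_Diff_Un antisym)
    then show ?thesis unfolding P.lambda_system_eq by auto
  qed
  then have "sigma_sets UNIV (Collect closed) \<subseteq> ?L"
    by (intro L.sigma_sets_subset) auto
  then have "sets borel \<subseteq> ?L" by (simp add: borel_eq_closed)
  then show ?thesis using measure_down[OF ms, of "sets borel"] sets.sigma_algebra_axioms[of borel] by simp
qed

lemma space_hausdorff [simp]: "space (hausdorff_measure d) = UNIV"
  by (simp add: hausdorff_measure_def)

lemma sets_hausdorff [simp, measurable_cong]: "sets (hausdorff_measure d) = sets borel"
  unfolding hausdorff_measure_def using sets.sigma_sets_eq[of borel] by simp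

lemma measurable_hausdorff [simp]: "measurable (hausdorff_measure d) N = measurable borel N"
  by (rule measurable_cong_sets) simp_all

lemma emeasure_hausdorff:
  assumes "A \<in> sets borel"
  shows "emeasure (hausdorff_measure d) A = hausdorff_outer d A"
  unfolding hausdorff_measure_def using assms measure_space_hausdorff[of d]
  by (subst emeasure_measure_of_sigma) (auto simp: measure_space_def)

text \<open>Covering sets are intersected with \<open>A\<close> because \<open>f\<close> is Lipschitz only there.\<close>

lemma hausdorff_pre_lipschitz_image:
  fixes f :: "'a::metric_space \<Rightarrow> 'b::metric_space"
  assumes L: "0 < L" "\<And>x y. x \<in> A \<Longrightarrow> y \<in> A \<Longrightarrow> dist (f x) (f y) \<le> L * dist x y"
  shows "hausdorff_pre d \<delta> (f ` A) \<le> ennreal (L ^ d) * hausdorff_pre d (\<delta> / L) A"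
proof -
  have "hausdorff_pre d \<delta> (f ` A) / ennreal (L ^ d) \<le> hausdorff_pre d (\<delta> / L) A"
  proof (rule hausdorff_pre_geI)
    fix C assume C: "small_cover (\<delta> / L) A C"
    have dia: "diameter (f ` (C i \<inter> A)) \<le> L * diameter (C i \<inter> A)"
      and bd: "bounded (f ` (C i \<inter> A))" for i
    proof -
      have b: "bounded (C i \<inter> A)" using C by (auto simp: small_cover_def)
      show "bounded (f ` (C i \<inter> A))"
        unfolding bounded_two_points
      proof (intro exI ballI)
        fix x y assume "x \<in> f ` (C i \<inter> A)" "y \<in> f ` (C i \<inter> A)"
        then obtain u v where uv: "x = f u" "y = f v" "u \<in> C i \<inter> A" "v \<in> C i \<inter> A" by auto
        have "dist x y \<le> L * dist u v" using uv L by auto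
        also have "\<dots> \<le> L * diameter (C i \<inter> A)"
          using L diameter_bounded_bound[OF b uv(3,4)] by simp
        finally show "dist x y \<le> L * diameter (C i \<inter> A)" .
      qed
      show "diameter (f ` (C i \<inter> A)) \<le> L * diameter (C i \<inter> A)"
      proof (rule diameter_leI)
        show "0 \<le> L * diameter (C i \<inter> A)"
          using diameter_ge_0[OF b] L by auto
        fix x y assume "x \<in> f ` (C i \<inter> A)" "y \<in> f ` (C i \<inter> A)"
        then obtain u v where uv: "x = f u" "y = f v" "u \<in> C i \<inter> A" "v \<in> C i \<inter> A" by auto
        have "dist x y \<le> L * dist u v" using uv L by auto
        also have "\<dots> \<le> L * diameter (C i \<inter> A)"
          using L diameter_bounded_bound[OF b uv(3,4)] by simp
        finally show "dist x y \<le> L * diameter (C i \<inter> A)" .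
      qed
    qed
    have dC: "diameter (C i \<inter> A) \<le> \<delta> / L" for i
      using C by (auto simp: small_cover_def intro: order.trans[OF diameter_subset])
    have "small_cover \<delta> (f ` A) (\<lambda>i. f ` (C i \<inter> A))"
      unfolding small_cover_def
    proof (intro conjI allI bd)
      show "f ` A \<subseteq> (\<Union>i. f ` (C i \<inter> A))" using C unfolding small_cover_def by blast
      fix i
      have "diameter (f ` (C i \<inter> A)) \<le> L * (\<delta> / L)"
        using dia[of i] dC[of i] L by (meson mult_left_mono order.trans less_imp_le)
      then show "diameter (f ` (C i \<inter> A)) \<le> \<delta>" using L by simp
    qed
    then have "hausdorff_pre d \<delta> (f ` A) \<le> (\<Sum>i. cover_cost d (f ` (C i \<inter> A)))"
      by (rule hausdorff_pre_le)
    also have "\<dots> \<le> (\<Sum>i. ennreal (L ^ d) * cover_cost d (C i))"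
    proof (intro suminf_le allI)
      fix i
      have "cover_cost d (f ` (C i \<inter> A)) \<le> ennreal (L ^ d) * cover_cost d (C i \<inter> A)"
      proof (cases "C i \<inter> A = {}")
        case False
        have "diameter (f ` (C i \<inter> A)) ^ d \<le> (L * diameter (C i \<inter> A)) ^ d"
          by (intro power_mono dia diameter_ge_0 bd)
        then show ?thesis using False L
          by (auto simp: cover_cost_def power_mult_distrib ennreal_mult'[symmetric] intro!: ennreal_leI)
      qed auto
      also have "\<dots> \<le> ennreal (L ^ d) * cover_cost d (C i)"
        using C by (intro mult_left_mono cover_cost_mono) (auto simp: small_cover_def)
      finally show "cover_cost d (f ` (C i \<inter> A)) \<le> ennreal (L ^ d) * cover_cost d (C i)" .
    qed auto
    also have "\<dots> = ennreal (L ^ d) * (\<Sum>i. cover_cost d (C i))"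
      by (rule ennreal_suminf_cmult)
    finally show "hausdorff_pre d \<delta> (f ` A) / ennreal (L ^ d) \<le> (\<Sum>i. cover_cost d (C i))"
      using L by (subst divide_le_posI_ennreal) (auto simp: mult.commute)
  qed
  then have "ennreal (L ^ d) * (hausdorff_pre d \<delta> (f ` A) / ennreal (L ^ d)) \<le> ennreal (L ^ d) * hausdorff_pre d (\<delta> / L) A"
    by (rule mult_left_mono) simp
  moreover have "ennreal (L ^ d) * (a / ennreal (L ^ d)) = a" for a
  proof -
    have "ennreal (L ^ d) / ennreal (L ^ d) = 1"
      using L by (intro ennreal_divide_self) (auto simp: ennreal_less_top)
    then show ?thesis by (subst mult.commute) (simp add: ennreal_divide_times)
  qed
  ultimately show ?thesis by simp
qed

lemma hausdorff_outer_lipschitz_image: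
  fixes f :: "'a::metric_space \<Rightarrow> 'b::metric_space"
  assumes L: "0 < L" "\<And>x y. x \<in> A \<Longrightarrow> y \<in> A \<Longrightarrow> dist (f x) (f y) \<le> L * dist x y"
  shows "hausdorff_outer d (f ` A) \<le> ennreal (L ^ d) * hausdorff_outer d A"
proof (rule hausdorff_outer_leI)
  fix \<delta> :: real assume \<delta>: "0 < \<delta>"
  have "hausdorff_pre d \<delta> (f ` A) \<le> ennreal (L ^ d) * hausdorff_pre d (\<delta> / L) A"
    by (rule hausdorff_pre_lipschitz_image[OF L])
  also have "\<dots> \<le> ennreal (L ^ d) * hausdorff_outer d A"
    using \<delta> L by (intro mult_left_mono hausdorff_pre_le_outer) auto
  finally show "hausdorff_pre d \<delta> (f ` A) \<le> ennreal (L ^ d) * hausdorff_outer d A" .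
qed

lemma hausdorff_outer_isometry_image:
  fixes T :: "'a::metric_space \<Rightarrow> 'b::metric_space"
  assumes T: "\<And>x y. dist (T x) (T y) = dist x y"
  shows "hausdorff_outer d (T ` A) = hausdorff_outer d A"
proof (rule antisym)
  show "hausdorff_outer d (T ` A) \<le> hausdorff_outer d A"
    using hausdorff_outer_lipschitz_image[of 1 A T d] T by simp
  have inj: "inj T" using T by (metis dist_eq_0_iff injI)
  have "hausdorff_outer d (inv T ` (T ` A)) \<le> ennreal (1 ^ d) * hausdorff_outer d (T ` A)"
    by (rule hausdorff_outer_lipschitz_image) (use T inj in \<open>auto simp: inv_f_f\<close>)
  then show "hausdorff_outer d A \<le> hausdorff_outer d (T ` A)"
    using inj by (simp add: image_inv_f_f)
qed

lemma distr_hausdorff_isometry: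
  fixes T :: "'a::metric_space \<Rightarrow> 'a"
  assumes T: "\<And>x y. dist (T x) (T y) = dist x y" "surj T"
  shows "distr (hausdorff_measure d) borel T = hausdorff_measure d"
proof (rule measure_eqI)
  have "continuous_on UNIV T"
    unfolding continuous_on_iff by (auto simp: T(1))
  then have m [measurable]: "T \<in> borel_measurable borel" by (rule borel_measurable_continuous_onI)
  fix A assume "A \<in> sets (distr (hausdorff_measure d) borel T)"
  then have A [measurable]: "A \<in> sets borel" by simp
  have "emeasure (distr (hausdorff_measure d) borel T) A = hausdorff_outer d (T -` A)"
    using measurable_sets[OF m A] by (simp add: emeasure_distr emeasure_hausdorff)
  also have "\<dots> = hausdorff_outer d (T ` (T -` A))"
    by (rule hausdorff_outer_isometry_image[OF T(1), symmetric])
  also have "T ` (T -` A) = A" using T(2) by (simp add: surj_image_vimage_eq)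
  finally show "emeasure (distr (hausdorff_measure d) borel T) A = emeasure (hausdorff_measure d) A"
    by (simp add: emeasure_hausdorff)
qed simp

lemma nn_integral_hausdorff_isometry:
  fixes T :: "'a::metric_space \<Rightarrow> 'a"
  assumes T: "\<And>x y. dist (T x) (T y) = dist x y" "surj T" and f: "f \<in> borel_measurable borel"
  shows "(\<integral>\<^sup>+x. f (T x) \<partial>hausdorff_measure d) = (\<integral>\<^sup>+x. f x \<partial>hausdorff_measure d)"
proof -
  have "continuous_on UNIV T" unfolding continuous_on_iff by (auto simp: T(1))
  then have "T \<in> borel_measurable borel" by (rule borel_measurable_continuous_onI)
  then have "(\<integral>\<^sup>+x. f x \<partial>distr (hausdorff_measure d) borel T) = (\<integral>\<^sup>+x. f (T x) \<partial>hausdorff_measure d)"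
    using f by (intro nn_integral_distr) simp_all
  then show ?thesis by (simp add: distr_hausdorff_isometry[OF T])
qed

section \<open>Surface measure on the boundary of the cube\<close>

definition slice :: "'n \<Rightarrow> real \<Rightarrow> real ^ 'n \<Rightarrow> real ^ 'n::finite" where
  "slice i e x = (\<chi> j. if j = i then e else x $ j)"

definition facet :: "'n \<Rightarrow> real \<Rightarrow> (real ^ 'n::finite) set" where
  "facet i e = {x \<in> cbox 0 1. x $ i = e}"

abbreviation surface :: "(real ^ 'n::finite) measure" where
  "surface \<equiv> hausdorff_measure (CARD('n) - 1)"

lemma slice_nth [simp]: "slice i e x $ j = (if j = i then e else x $ j)"
  by (simp add: slice_def)

lemma dist_vec_le:
  fixes x y u v :: "real ^ 'n::finite"
  assumes "\<And>j. \<bar>x $ j - y $ j\<bar> \<le> c * \<bar>u $ j - v $ j\<bar>" "0 \<le> c"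
  shows "dist x y \<le> c * dist u v"
proof -
  have "dist x y \<le> L2_set (\<lambda>j. c * dist (u $ j) (v $ j)) UNIV"
    unfolding dist_vec_def using assms by (intro L2_set_mono) (auto simp: dist_real_def)
  then show ?thesis using assms(2) by (simp add: dist_vec_def L2_set_right_distrib)
qed

lemma continuous_slice [continuous_intros]: "continuous_on S (slice i e)"
  unfolding slice_def
proof (rule continuous_on_vec_lambda)
  show "continuous_on S (\<lambda>x. if j = i then e else x $ j)" for j
    by (cases "j = i") (auto intro!: continuous_intros)
qed

lemma slice_measurable [measurable]: "slice i e \<in> borel_measurable borel"
  by (intro borel_measurable_continuous_onI continuous_slice)

lemma mem_cbox_01: "x \<in> cbox 0 (1 :: real ^ 'n::finite) \<longleftrightarrow> (\<forall>j. 0 \<le> x $ j \<and> x $ j \<le> 1)"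
  by (auto simp: mem_box_cart)

lemma closed_facet [simp]:
  fixes i :: "'n::finite"
  shows "closed (facet i e)"
proof -
  have "facet i e = cbox 0 1 \<inter> {x. x $ i = e}" by (auto simp: facet_def)
  moreover have "closed {x :: real ^ 'n. x $ i = e}"
    by (intro closed_Collect_eq continuous_intros)
  ultimately show ?thesis by (simp only:) (intro closed_Int closed_cbox)
qed

lemma emeasure_lborel_cbox_vec:
  fixes a b :: "real ^ 'n::finite"
  assumes "\<And>j. a $ j \<le> b $ j"
  shows "emeasure lborel (cbox a b) = ennreal (\<Prod>j\<in>UNIV. b $ j - a $ j)"
proof -
  have ne: "cbox a b \<noteq> {}" using assms by (auto simp: interval_ne_empty_cart)
  have "emeasure lborel (cbox a b) = ennreal (measure lborel (cbox a b))"
    by (rule emeasure_eq_ennreal_measure) (simp add: emeasure_lborel_cbox_eq)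
  then show ?thesis using content_cbox_cart[OF ne] by simp
qed

lemma prod_except_one:
  fixes i :: "'n::finite" and c :: "'a::comm_monoid_mult"
  shows "(\<Prod>j\<in>UNIV. if j = i then 1 else c) = c ^ (CARD('n) - 1)"
proof -
  have "(\<Prod>j\<in>UNIV. if j = i then 1 else c) = (\<Prod>j\<in>UNIV - {i}. if j = i then 1 else c)"
    by (subst prod.remove[of UNIV i]) auto
  also have "\<dots> = (\<Prod>j\<in>UNIV - {i}. c)" by (rule prod.cong) auto
  finally show ?thesis by (simp add: card_Diff_singleton)
qed

text \<open>Each covering set of the facet, thickened to a box of side \<open>2 * diameter\<close> along the facet and of
  height \<open>1\<close> across it, gives a cover of the cube, which has volume \<open>1\<close>.\<close>

lemma hausdorff_facet_pos:
  fixes i :: "'n::finite"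
  assumes e: "0 \<le> e" "e \<le> 1"
  shows "0 < hausdorff_outer (CARD('n) - 1) (facet i e)"
proof -
  let ?d = "CARD('n) - 1"
  have "ennreal (1 / 2 ^ ?d) \<le> hausdorff_pre ?d 1 (facet i e)"
  proof (rule hausdorff_pre_geI)
    fix C assume C: "small_cover 1 (facet i e) C"
    have "\<exists>T. T \<in> sets borel \<and> emeasure lborel T \<le> ennreal (2 ^ ?d) * cover_cost ?d (C k)
        \<and> {x \<in> cbox 0 1. slice i e x \<in> C k} \<subseteq> T" for k
    proof (cases "C k = {}")
      case True
      then show ?thesis by (intro exI[of _ "{}"]) auto
    next
      case False
      then obtain c where c: "c \<in> C k" by auto
      let ?r = "diameter (C k)"
      have bd: "bounded (C k)" using C by (auto simp: small_cover_def)
      have r: "0 \<le> ?r" by (rule diameter_ge_0[OF bd])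
      define a where "a = (\<chi> j. if j = i then 0 else c $ j - ?r)"
      define b where "b = (\<chi> j. if j = i then 1 else c $ j + ?r)"
      have "emeasure lborel (cbox a b) = ennreal (\<Prod>j\<in>UNIV. b $ j - a $ j)"
        using r by (intro emeasure_lborel_cbox_vec) (auto simp: a_def b_def)
      also have "(\<Prod>j\<in>UNIV. b $ j - a $ j) = (\<Prod>j\<in>UNIV. if j = i then 1 else 2 * ?r)"
        by (rule prod.cong) (auto simp: a_def b_def)
      also have "\<dots> = 2 ^ ?d * ?r ^ ?d" by (simp add: prod_except_one power_mult_distrib)
      finally have vol: "emeasure lborel (cbox a b) = ennreal (2 ^ ?d) * cover_cost ?d (C k)"
        using False r by (simp add: cover_cost_def ennreal_mult)
      have sub: "{x \<in> cbox 0 1. slice i e x \<in> C k} \<subseteq> cbox a b"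
      proof
        fix x assume "x \<in> {x \<in> cbox 0 1. slice i e x \<in> C k}"
        then have x: "x \<in> cbox 0 1" "slice i e x \<in> C k" by auto
        have "\<bar>slice i e x $ j - c $ j\<bar> \<le> ?r" for j
        proof -
          have "\<bar>slice i e x $ j - c $ j\<bar> \<le> dist (slice i e x) c"
            using dist_vec_nth_le[of "slice i e x" j c] by (simp add: dist_real_def)
          also have "\<dots> \<le> ?r" by (rule diameter_bounded_bound[OF bd x(2) c])
          finally show ?thesis .
        qed
        then have "a $ j \<le> x $ j \<and> x $ j \<le> b $ j" for j
        proof (cases "j = i")
          case False
          then show ?thesis
            using \<open>\<And>j. \<bar>slice i e x $ j - c $ j\<bar> \<le> ?r\<close>[of j] by (simp add: a_def b_def abs_le_iff)
        qed (use x(1) in \<open>auto simp: mem_cbox_01 a_def b_def\<close>)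
        then show "x \<in> cbox a b" by (simp add: mem_box_cart)
      qed
      show ?thesis
        by (rule exI[of _ "cbox a b"], intro conjI borel_closed closed_cbox sub) (simp only: vol order.refl)
    qed
    then have "\<forall>k. \<exists>T. T \<in> sets borel \<and> emeasure lborel T \<le> ennreal (2 ^ ?d) * cover_cost ?d (C k)
        \<and> {x \<in> cbox 0 1. slice i e x \<in> C k} \<subseteq> T" by blast
    from choice[OF this] obtain T where T: "\<And>k. T k \<in> sets borel"
      "\<And>k. emeasure lborel (T k) \<le> ennreal (2 ^ ?d) * cover_cost ?d (C k)"
      "\<And>k. {x \<in> cbox 0 1. slice i e x \<in> C k} \<subseteq> T k" by blast
    have "cbox 0 1 \<subseteq> (\<Union>k. T k)"
    proof
      fix x :: "real ^ 'n" assume x: "x \<in> cbox 0 1"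
      then have "slice i e x \<in> facet i e" using e by (auto simp: facet_def mem_cbox_01)
      then obtain k where "slice i e x \<in> C k" using C by (auto simp: small_cover_def)
      then show "x \<in> (\<Union>k. T k)" using T(3) x by blast
    qed
    then have "emeasure lborel (cbox 0 (1 :: real ^ 'n)) \<le> emeasure lborel (\<Union>k. T k)"
      using T(1) by (intro emeasure_mono) auto
    also have "\<dots> \<le> (\<Sum>k. emeasure lborel (T k))"
      using T(1) by (intro emeasure_subadditive_countably) auto
    also have "\<dots> \<le> (\<Sum>k. ennreal (2 ^ ?d) * cover_cost ?d (C k))"
      using T(2) by (intro suminf_le) auto
    also have "\<dots> = ennreal (2 ^ ?d) * (\<Sum>k. cover_cost ?d (C k))" by (rule ennreal_suminf_cmult)
    also have "emeasure lborel (cbox 0 (1 :: real ^ 'n)) = 1" by (subst emeasure_lborel_cbox_vec) auto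
    finally have *: "1 \<le> ennreal (2 ^ ?d) * (\<Sum>k. cover_cost ?d (C k))" .
    have "ennreal (1 / 2 ^ ?d) * 1 \<le> ennreal (1 / 2 ^ ?d) * (ennreal (2 ^ ?d) * (\<Sum>k. cover_cost ?d (C k)))"
      by (intro mult_left_mono *) simp
    also have "\<dots> = (\<Sum>k. cover_cost ?d (C k))"
      by (simp add: mult.assoc[symmetric] ennreal_mult[symmetric])
    finally show "ennreal (1 / 2 ^ ?d) \<le> (\<Sum>k. cover_cost ?d (C k))" by simp
  qed
  also have "\<dots> \<le> hausdorff_outer ?d (facet i e)" by (rule hausdorff_pre_le_outer) simp
  finally show ?thesis by (rule less_le_trans[rotated]) simp
qed

lemma hausdorff_pre_finite_Union:
  assumes "finite I" "0 \<le> \<delta>"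
  shows "hausdorff_pre d \<delta> (\<Union>k\<in>I. A k) \<le> (\<Sum>k\<in>I. hausdorff_pre d \<delta> (A k))"
  using assms(1)
proof (induction I rule: finite_induct)
  case empty
  then show ?case using assms(2) by (simp add: hausdorff_pre_empty)
next
  case (insert k I)
  let ?B = "\<Union>k\<in>I. A k"
  have "hausdorff_pre d \<delta> (\<Union>n. binaryset (A k) ?B n) \<le> (\<Sum>n. hausdorff_pre d \<delta> (binaryset (A k) ?B n))"
    by (rule hausdorff_pre_countably_subadditive)
  then have "hausdorff_pre d \<delta> (A k \<union> ?B) \<le> hausdorff_pre d \<delta> (A k) + hausdorff_pre d \<delta> ?B"
    using assms(2) by (simp add: UN_binaryset_eq suminf_binaryset_eq hausdorff_pre_empty)
  also have "\<dots> \<le> hausdorff_pre d \<delta> (A k) + (\<Sum>k\<in>I. hausdorff_pre d \<delta> (A k))"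
    by (intro add_left_mono insert.IH)
  finally show ?case using insert by simp
qed

text \<open>The facet is the union of \<open>2 ^ (CARD('n) - 1)\<close> copies of itself of half the size, indexed by the
  coordinates in which the copy lies in the upper half.\<close>

lemma hausdorff_pre_facet_halve:
  fixes i :: "'n::finite"
  assumes \<delta>: "0 < \<delta>"
  shows "hausdorff_pre (CARD('n) - 1) (\<delta> / 2) (facet i e) \<le> hausdorff_pre (CARD('n) - 1) \<delta> (facet i e)"
proof -
  let ?d = "CARD('n) - 1"
  define f where "f S x = (\<chi> j. if j = i then e else (x $ j + (if j \<in> S then 1 else 0)) / 2)" for S :: "'n set" and x :: "real ^ 'n"
  let ?I = "Pow (UNIV - {i})"
  have "facet i e \<subseteq> (\<Union>S\<in>?I. f S ` facet i e)"
  proof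
    fix x assume x: "x \<in> facet i e"
    define S where "S = {j. j \<noteq> i \<and> 1 / 2 \<le> x $ j}"
    define y where "y = (\<chi> j. if j = i then e else 2 * x $ j - (if j \<in> S then 1 else 0))"
    have "y \<in> facet i e" using x by (auto simp: facet_def mem_cbox_01 y_def S_def)
    moreover have "x = f S y" using x by (auto simp: vec_eq_iff f_def y_def facet_def)
    moreover have "S \<in> ?I" by (auto simp: S_def)
    ultimately show "x \<in> (\<Union>S\<in>?I. f S ` facet i e)" by blast
  qed
  then have "hausdorff_pre ?d (\<delta> / 2) (facet i e) \<le> hausdorff_pre ?d (\<delta> / 2) (\<Union>S\<in>?I. f S ` facet i e)"
    by (rule hausdorff_pre_mono)
  also have "\<dots> \<le> (\<Sum>S\<in>?I. hausdorff_pre ?d (\<delta> / 2) (f S ` facet i e))"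
    using \<delta> by (intro hausdorff_pre_finite_Union) auto
  also have "\<dots> \<le> (\<Sum>S\<in>?I. ennreal ((1 / 2) ^ ?d) * hausdorff_pre ?d ((\<delta> / 2) / (1 / 2)) (facet i e))"
  proof (intro sum_mono hausdorff_pre_lipschitz_image)
    fix S x y
    show "dist (f S x) (f S y) \<le> 1 / 2 * dist x y"
      by (rule dist_vec_le) (auto simp: f_def diff_divide_distrib[symmetric] abs_if)
  qed simp
  also have "\<dots> = of_nat (card ?I) * ennreal ((1 / 2) ^ ?d) * hausdorff_pre ?d \<delta> (facet i e)"
    by (simp add: mult.assoc)
  also have "of_nat (card ?I) * ennreal ((1 / 2) ^ ?d) = 1"
    by (simp add: card_Pow card_Diff_singleton ennreal_of_nat_eq_real_of_nat ennreal_mult[symmetric]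
        power_one_over del: Pow_UNIV)
  finally show ?thesis by simp
qed

text \<open>Halving repeatedly bounds the premeasure at all scales by the cost of covering the facet by itself.\<close>

lemma hausdorff_facet_finite:
  fixes i :: "'n::finite"
  shows "hausdorff_outer (CARD('n) - 1) (facet i e) < top"
proof -
  let ?d = "CARD('n) - 1"
  have bd: "bounded (facet i e)" unfolding facet_def by (rule bounded_subset[OF bounded_cbox]) auto
  define r where "r = diameter (facet i e) + 1"
  have r: "0 < r" using diameter_ge_0[OF bd] by (simp add: r_def)
  have "hausdorff_pre ?d r (facet i e) \<le> (\<Sum>k. cover_cost ?d (if k = 0 then facet i e else {}))"
    using bd r by (intro hausdorff_pre_le) (auto simp: small_cover_def r_def)
  also have "\<dots> = cover_cost ?d (facet i e)"
    by (subst suminf_finite[of "{0}"]) auto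
  finally have start: "hausdorff_pre ?d r (facet i e) \<le> cover_cost ?d (facet i e)" .
  have all: "hausdorff_pre ?d (r / 2 ^ k) (facet i e) \<le> cover_cost ?d (facet i e)" for k
  proof (induction k)
    case (Suc k)
    have "hausdorff_pre ?d (r / 2 ^ Suc k) (facet i e) \<le> hausdorff_pre ?d (r / 2 ^ k) (facet i e)"
      using hausdorff_pre_facet_halve[of "r / 2 ^ k" i e] r by (simp add: mult.commute)
    then show ?case using Suc by (rule order.trans)
  qed (use start in simp)
  have "hausdorff_outer ?d (facet i e) \<le> cover_cost ?d (facet i e)"
  proof (rule hausdorff_outer_leI)
    fix \<delta> :: real assume \<delta>: "0 < \<delta>"
    obtain k where "r / \<delta> < 2 ^ k" using real_arch_pow[of 2] by auto
    then have "r / 2 ^ k \<le> \<delta>" using \<delta> by (simp add: field_simps)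
    then show "hausdorff_pre ?d \<delta> (facet i e) \<le> cover_cost ?d (facet i e)"
      using all[of k] hausdorff_pre_antimono order.trans by blast
  qed
  also have "\<dots> < top" by (simp add: cover_cost_def)
  finally show ?thesis .
qed

lemma surj_of_inverse: "(\<And>x. f (g x) = x) \<Longrightarrow> surj f"
  by (metis surjI)

text \<open>Exchanging two coordinates and translating is an isometry between the facets.\<close>

lemma hausdorff_facet_eq:
  fixes i i' :: "'n::finite"
  assumes e: "0 \<le> e" "e \<le> 1"
  shows "hausdorff_outer d (facet i e) = hausdorff_outer d (facet i' 0)"
proof -
  define \<pi> where "\<pi> j = (if j = i then i' else if j = i' then i else j)" for j
  have \<pi>\<pi>: "\<pi> (\<pi> j) = j" for j by (auto simp: \<pi>_def)
  have bij: "bij \<pi>" by (rule bij_betw_byWitness[where f' = \<pi>]) (auto simp: \<pi>\<pi>)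
  define T where "T x = (\<chi> j. x $ \<pi> j + (if j = i then e else 0))" for x :: "real ^ 'n"
  have "dist (T x) (T y) = dist x y" for x y
  proof -
    have "(\<Sum>j\<in>UNIV. (dist (T x $ j) (T y $ j))\<^sup>2) = (\<Sum>j\<in>UNIV. (dist (x $ \<pi> j) (y $ \<pi> j))\<^sup>2)"
      by (rule sum.cong) (auto simp: T_def dist_real_def)
    also have "\<dots> = (\<Sum>j\<in>UNIV. (dist (x $ j) (y $ j))\<^sup>2)"
      using sum.reindex_bij_betw[OF bij, of "\<lambda>j. (dist (x $ j) (y $ j))\<^sup>2"] by simp
    finally show ?thesis by (simp add: dist_vec_def L2_set_def)
  qed
  then have "hausdorff_outer d (T ` facet i' 0) = hausdorff_outer d (facet i' 0)"
    by (rule hausdorff_outer_isometry_image)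
  moreover have "T ` facet i' 0 = facet i e"
  proof (intro equalityI subsetI)
    fix y assume y: "y \<in> facet i e"
    define x where "x = (\<chi> j. if j = i' then 0 else y $ \<pi> j)"
    have "x \<in> facet i' 0" using y by (auto simp: facet_def mem_cbox_01 x_def)
    moreover have "y = T x"
      unfolding vec_eq_iff
    proof
      fix j
      show "y $ j = T x $ j"
      proof (cases "j = i")
        case True
        then show ?thesis using y by (simp add: T_def x_def \<pi>_def facet_def)
      next
        case False
        then have "\<pi> j \<noteq> i'" by (auto simp: \<pi>_def)
        then show ?thesis using False by (simp add: T_def x_def \<pi>\<pi>)
      qed
    qed
    ultimately show "y \<in> T ` facet i' 0" by blast
  next
    fix y assume "y \<in> T ` facet i' 0"
    then obtain x where x: "x \<in> facet i' 0" "y = T x" by auto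
    then show "y \<in> facet i e" using e by (auto simp: facet_def mem_cbox_01 T_def \<pi>_def)
  qed
  ultimately show ?thesis by simp
qed

lemma nn_integral_lborel_translate:
  fixes f :: "'a::euclidean_space \<Rightarrow> ennreal"
  assumes [measurable]: "f \<in> borel_measurable borel"
  shows "(\<integral>\<^sup>+x. f (x + c) \<partial>lborel) = (\<integral>\<^sup>+x. f x \<partial>lborel)"
proof -
  have "(\<integral>\<^sup>+x. f x \<partial>distr lborel borel ((+) c)) = (\<integral>\<^sup>+x. f (c + x) \<partial>lborel)"
    by (intro nn_integral_distr) simp_all
  then show ?thesis by (simp add: lborel_distr_plus add.commute)
qed

lemma hausdorff_hyperplane_cube_finite:
  fixes i :: "'n::finite"
  assumes "0 < (r :: real)"
  shows "hausdorff_outer (CARD('n) - 1) {y \<in> cbox (\<chi> j. - r) (\<chi> j. r). y $ i = 0} < top"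
    (is "hausdorff_outer ?d ?Q < top")
proof -
  define f where "f x = slice i 0 (\<chi> j. 2 * r * x $ j - r)" for x :: "real ^ 'n"
  have "?Q \<subseteq> f ` facet i 0"
  proof
    fix y assume y: "y \<in> ?Q"
    define x where "x = slice i 0 (\<chi> j. (y $ j + r) / (2 * r))"
    have b: "- r \<le> y $ j" "y $ j \<le> r" for j using y by (auto simp: mem_box_cart)
    have "0 \<le> (y $ j + r) / (2 * r)" "(y $ j + r) / (2 * r) \<le> 1" for j
      using b[of j] assms by (auto simp: divide_simps)
    then have "x \<in> facet i 0" by (auto simp: facet_def mem_cbox_01 x_def)
    moreover have "y = f x" using y assms by (auto simp: vec_eq_iff f_def x_def)
    ultimately show "y \<in> f ` facet i 0" by blast
  qed
  then have "hausdorff_outer ?d ?Q \<le> hausdorff_outer ?d (f ` facet i 0)" by (rule hausdorff_outer_mono)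
  also have "\<dots> \<le> ennreal ((2 * r) ^ ?d) * hausdorff_outer ?d (facet i 0)"
  proof (rule hausdorff_outer_lipschitz_image)
    show "dist (f x) (f y) \<le> 2 * r * dist x y" for x y
      using assms by (intro dist_vec_le) (auto simp: f_def abs_mult right_diff_distrib[symmetric])
  qed (use assms in simp)
  also have "\<dots> < top" using hausdorff_facet_finite[of i 0] by (simp add: ennreal_mult_less_top)
  finally show ?thesis .
qed

definition hyperplane_surface :: "'n \<Rightarrow> (real ^ 'n::finite) measure" where
  "hyperplane_surface i = density surface (indicator {y. y $ i = 0})"

lemma sets_hyperplane_surface [simp, measurable_cong]: "sets (hyperplane_surface i) = sets borel"
  by (simp add: hyperplane_surface_def)

lemma space_hyperplane_surface [simp]: "space (hyperplane_surface i) = UNIV"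
  by (simp add: hyperplane_surface_def)

lemma hyperplane_borel [measurable]: "{y :: real ^ 'n. y $ i = e} \<in> sets borel"
  by (intro borel_closed closed_Collect_eq continuous_intros)

lemma nn_integral_hyperplane_surface:
  assumes [measurable]: "f \<in> borel_measurable borel"
  shows "(\<integral>\<^sup>+y. f y \<partial>hyperplane_surface i) = (\<integral>\<^sup>+y. indicator {y. y $ i = 0} y * f y \<partial>surface)"
  unfolding hyperplane_surface_def by (rule nn_integral_density) simp_all

lemma sigma_finite_hyperplane_surface: "sigma_finite_measure (hyperplane_surface (i :: 'n::finite))"
proof
  let ?B = "\<lambda>k. cbox (\<chi> j. - real (Suc k)) (\<chi> j. real (Suc k)) :: (real ^ 'n) set"
  show "\<exists>A. countable A \<and> A \<subseteq> sets (hyperplane_surface i) \<and> \<Union> A = space (hyperplane_surface i) \<and>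
      (\<forall>a\<in>A. emeasure (hyperplane_surface i) a \<noteq> \<infinity>)"
  proof (intro exI[of _ "range ?B"] conjI ballI)
    show "\<Union> (range ?B) = space (hyperplane_surface i)"
    proof -
      have "\<exists>k. x \<in> ?B k" for x :: "real ^ 'n"
      proof -
        obtain k where k: "norm x \<le> real k" using real_arch_simple by blast
        have "\<bar>x $ j\<bar> \<le> real (Suc k)" for j using component_le_norm_cart[of x j] k by simp
        then have "x \<in> ?B k" unfolding mem_box_cart by (simp add: abs_le_iff) (smt (verit))
        then show ?thesis ..
      qed
      then show ?thesis by auto
    qed
    fix a assume "a \<in> range ?B"
    then obtain k where a: "a = ?B k" by auto
    have "emeasure (hyperplane_surface i) a = (\<integral>\<^sup>+y. indicator {y. y $ i = 0} y * indicator a y \<partial>surface)"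
      unfolding hyperplane_surface_def by (rule emeasure_density) (simp_all add: a)
    also have "\<dots> = (\<integral>\<^sup>+y. indicator {y \<in> ?B k. y $ i = 0} y \<partial>surface)"
      unfolding a by (rule nn_integral_cong) (simp only: indicator_def mem_Collect_eq of_bool_conj mult.commute)
    also have "\<dots> = hausdorff_outer (CARD('n) - 1) {y \<in> ?B k. y $ i = 0}"
    proof -
      have "{y \<in> ?B k. y $ i = 0} \<in> sets borel"
      proof -
        have "{y \<in> ?B k. y $ i = 0} = ?B k \<inter> {y. y $ i = 0}" by auto
        then show ?thesis by (simp only:) (intro sets.Int hyperplane_borel borel_closed closed_cbox)
      qed
      then show ?thesis by (simp add: emeasure_hausdorff)
    qed
    finally show "emeasure (hyperplane_surface i) a \<noteq> \<infinity>"
      using hausdorff_hyperplane_cube_finite[of "real (Suc k)" i] by simp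
  qed auto
qed

text \<open>The Tonelli argument for uniqueness of Haar measure. Smear \<open>f\<close> with the indicator \<open>G\<close> of the cube,
  whose Lebesgue integral is \<open>1\<close>, exchange the integrals, and use that the surface measure is invariant
  under the point reflection \<open>y \<mapsto> slice i 0 x - y\<close> of the hyperplane while Lebesgue measure is invariant under
  translations. In the end \<open>f\<close> depends only on the Lebesgue variable and \<open>G\<close> contributes the area of
  the facet.\<close>

lemma hyperplane_nn_integral:
  fixes i :: "'n::finite" and f :: "real ^ 'n \<Rightarrow> ennreal"
  assumes f [measurable]: "f \<in> borel_measurable borel"
  shows "(\<integral>\<^sup>+y. f y \<partial>hyperplane_surface i)
    = hausdorff_outer (CARD('n) - 1) (facet i 0) * (\<integral>\<^sup>+x. indicator {x. 0 \<le> x $ i \<and> x $ i \<le> 1} x * f (slice i 0 x) \<partial>lborel)"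
proof -
  let ?\<mu> = "hyperplane_surface i" and ?\<pi> = "slice i 0"
  interpret \<mu>: sigma_finite_measure ?\<mu> by (rule sigma_finite_hyperplane_surface)
  interpret pair_sigma_finite "lborel :: (real ^ 'n) measure" ?\<mu> ..
  define G where "G = (indicator (cbox 0 1) :: real ^ 'n \<Rightarrow> ennreal)"
  have G [measurable]: "G \<in> borel_measurable borel" unfolding G_def by simp
  have AE: "AE y in ?\<mu>. y $ i = 0"
    unfolding hyperplane_surface_def by (subst AE_density) (auto simp: indicator_def)
  have "(\<integral>\<^sup>+y. f y \<partial>?\<mu>) = (\<integral>\<^sup>+y. \<integral>\<^sup>+x. f y * G (x - y) \<partial>lborel \<partial>?\<mu>)"
  proof (rule nn_integral_cong)
    fix y
    have "(\<integral>\<^sup>+x. f y * G (x - y) \<partial>lborel) = f y * (\<integral>\<^sup>+x. G (x + (- y)) \<partial>lborel)"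
      by (subst nn_integral_cmult) simp_all
    also have "(\<integral>\<^sup>+x. G (x + (- y)) \<partial>lborel) = (\<integral>\<^sup>+x. G x \<partial>lborel)"
      by (rule nn_integral_lborel_translate[OF G])
    also have "\<dots> = 1" unfolding G_def by (simp add: emeasure_lborel_cbox_vec)
    finally show "f y = (\<integral>\<^sup>+x. f y * G (x - y) \<partial>lborel)" by simp
  qed
  also have "\<dots> = (\<integral>\<^sup>+x. \<integral>\<^sup>+y. f y * G (x - y) \<partial>?\<mu> \<partial>lborel)"
    by (rule Fubini') measurable
  also have "\<dots> = (\<integral>\<^sup>+x. \<integral>\<^sup>+y. f (?\<pi> x - y) * G (x - ?\<pi> x + y) \<partial>?\<mu> \<partial>lborel)"
  proof (rule nn_integral_cong)
    fix x :: "real ^ 'n"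
    let ?g = "\<lambda>y. indicator {y. y $ i = 0} y * (f y * G (x - y))"
    have "(\<integral>\<^sup>+y. ?g (?\<pi> x - y) \<partial>surface) = (\<integral>\<^sup>+y. ?g y \<partial>surface)"
    proof (rule nn_integral_hausdorff_isometry)
      show "dist (?\<pi> x - a) (?\<pi> x - b) = dist a b" for a b
        by (simp add: dist_norm norm_minus_commute)
      show "surj ((-) (?\<pi> x))" by (rule surj_of_inverse[where g = "(-) (?\<pi> x)"]) simp
    qed measurable
    moreover have "?g (?\<pi> x - y) = indicator {y. y $ i = 0} y * (f (?\<pi> x - y) * G (x - ?\<pi> x + y))" for y
      by (simp add: indicator_def algebra_simps)
    ultimately show "(\<integral>\<^sup>+y. f y * G (x - y) \<partial>?\<mu>) = (\<integral>\<^sup>+y. f (?\<pi> x - y) * G (x - ?\<pi> x + y) \<partial>?\<mu>)"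
      by (subst (1 2) nn_integral_hyperplane_surface) simp_all
  qed
  also have "\<dots> = (\<integral>\<^sup>+y. \<integral>\<^sup>+x. f (?\<pi> x - y) * G (x - ?\<pi> x + y) \<partial>lborel \<partial>?\<mu>)"
    by (rule Fubini'[symmetric]) measurable
  also have "\<dots> = (\<integral>\<^sup>+y. \<integral>\<^sup>+x. f (?\<pi> x) * G (x - ?\<pi> x + y) \<partial>lborel \<partial>?\<mu>)"
  proof (rule nn_integral_cong_AE, use AE in eventually_elim)
    fix y :: "real ^ 'n" assume "y $ i = 0"
    then have p: "?\<pi> (x + y) = ?\<pi> x + y" for x by (simp add: vec_eq_iff)
    have "(\<integral>\<^sup>+x. f (?\<pi> (x + y) - y) * G (x + y - ?\<pi> (x + y) + y) \<partial>lborel)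
        = (\<integral>\<^sup>+x. f (?\<pi> x - y) * G (x - ?\<pi> x + y) \<partial>lborel)"
      by (rule nn_integral_lborel_translate) measurable
    then show "(\<integral>\<^sup>+x. f (?\<pi> x - y) * G (x - ?\<pi> x + y) \<partial>lborel)
        = (\<integral>\<^sup>+x. f (?\<pi> x) * G (x - ?\<pi> x + y) \<partial>lborel)"
      by (simp add: p)
  qed
  also have "\<dots> = (\<integral>\<^sup>+x. \<integral>\<^sup>+y. f (?\<pi> x) * G (x - ?\<pi> x + y) \<partial>?\<mu> \<partial>lborel)"
    by (rule Fubini') measurable
  also have "\<dots> = (\<integral>\<^sup>+x. hausdorff_outer (CARD('n) - 1) (facet i 0)
      * (indicator {x. 0 \<le> x $ i \<and> x $ i \<le> 1} x * f (?\<pi> x)) \<partial>lborel)"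
  proof (rule nn_integral_cong)
    fix x :: "real ^ 'n"
    \<comment> \<open>The argument of \<open>G\<close> has \<open>i\<close>-th coordinate \<open>x $ i\<close> and all others from \<open>y\<close>.\<close>
    have ind: "indicator {y. y $ i = 0} y * G (x - ?\<pi> x + y)
        = indicator {x. 0 \<le> x $ i \<and> x $ i \<le> 1} x * indicator (facet i 0) y" for y
    proof (cases "y $ i = 0")
      case True
      have comp: "(x - ?\<pi> x + y) $ j = (if j = i then x $ i else y $ j)" for j using True by simp
      have "x - ?\<pi> x + y \<in> cbox 0 1 \<longleftrightarrow> (0 \<le> x $ i \<and> x $ i \<le> 1) \<and> y \<in> facet i 0"
      proof
        assume "x - ?\<pi> x + y \<in> cbox 0 1"
        then have c: "0 \<le> (if j = i then x $ i else y $ j) \<and> (if j = i then x $ i else y $ j) \<le> 1" for j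
          unfolding mem_cbox_01 comp by blast
        have "0 \<le> y $ j \<and> y $ j \<le> 1" for j using c[of j] True by (cases "j = i") auto
        then show "(0 \<le> x $ i \<and> x $ i \<le> 1) \<and> y \<in> facet i 0"
          using c[of i] True by (simp add: facet_def mem_cbox_01)
      next
        assume "(0 \<le> x $ i \<and> x $ i \<le> 1) \<and> y \<in> facet i 0"
        then show "x - ?\<pi> x + y \<in> cbox 0 1"
          unfolding mem_cbox_01 comp by (simp add: facet_def mem_cbox_01)
      qed
      then show ?thesis using True by (simp add: G_def indicator_def of_bool_conj del: mem_box)
    qed (auto simp: facet_def)
    have "(\<integral>\<^sup>+y. f (?\<pi> x) * G (x - ?\<pi> x + y) \<partial>?\<mu>)
        = (\<integral>\<^sup>+y. f (?\<pi> x) * indicator {x. 0 \<le> x $ i \<and> x $ i \<le> 1} x * indicator (facet i 0) y \<partial>surface)"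
      by (subst nn_integral_hyperplane_surface, measurable)
         (simp add: mult.left_commute[of "indicator {y. y $ i = 0} _"] ind mult.assoc)
    also have "\<dots> = f (?\<pi> x) * indicator {x. 0 \<le> x $ i \<and> x $ i \<le> 1} x * hausdorff_outer (CARD('n) - 1) (facet i 0)"
      by (subst nn_integral_cmult_indicator) (simp_all add: emeasure_hausdorff)
    finally show "(\<integral>\<^sup>+y. f (?\<pi> x) * G (x - ?\<pi> x + y) \<partial>?\<mu>)
        = hausdorff_outer (CARD('n) - 1) (facet i 0) * (indicator {x. 0 \<le> x $ i \<and> x $ i \<le> 1} x * f (?\<pi> x))"
      by (simp add: mult_ac)
  qed
  also have "\<dots> = hausdorff_outer (CARD('n) - 1) (facet i 0)
      * (\<integral>\<^sup>+x. indicator {x. 0 \<le> x $ i \<and> x $ i \<le> 1} x * f (?\<pi> x) \<partial>lborel)"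
  proof (rule nn_integral_cmult)
    have "{x :: real ^ 'n. 0 \<le> x $ i \<and> x $ i \<le> 1} \<in> sets borel"
      by (intro borel_closed closed_Collect_conj closed_Collect_le continuous_intros)
    then show "(\<lambda>x. indicator {x. 0 \<le> x $ i \<and> x $ i \<le> 1} x * f (?\<pi> x)) \<in> borel_measurable lborel"
      by simp
  qed
  finally show ?thesis .
qed

lemma facet_borel [measurable, simp]: "facet i e \<in> sets borel"
  by (simp add: borel_closed)

lemma facet_nn_integral:
  fixes i :: "'n::finite" and f :: "real ^ 'n \<Rightarrow> ennreal"
  assumes f [measurable]: "f \<in> borel_measurable borel" and e: "0 \<le> e" "e \<le> 1"
  shows "(\<integral>\<^sup>+y. indicator (facet i e) y * f y \<partial>surface)
    = hausdorff_outer (CARD('n) - 1) (facet i 0) * (\<integral>\<^sup>+x. indicator (cbox 0 1) x * f (slice i e x) \<partial>lborel)"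
proof -
  define T where "T y = y + e *\<^sub>R axis i 1" for y :: "real ^ 'n"
  have T_nth: "T y $ j = y $ j + (if j = i then e else 0)" for y j
    by (simp add: T_def axis_def)
  have T_facet: "y \<in> facet i 0 \<longleftrightarrow> T y \<in> facet i e" for y
    using e unfolding facet_def mem_Collect_eq mem_cbox_01 T_nth by (smt (verit))
  have cT: "continuous_on UNIV T" unfolding T_def by (intro continuous_intros)
  have [measurable]: "T \<in> borel_measurable borel" by (rule borel_measurable_continuous_onI[OF cT])
  have "(\<integral>\<^sup>+y. indicator (facet i e) y * f y \<partial>surface) = (\<integral>\<^sup>+y. indicator (facet i e) (T y) * f (T y) \<partial>surface)"
  proof (rule nn_integral_hausdorff_isometry[symmetric])
    show "dist (T x) (T y) = dist x y" for x y by (simp add: T_def dist_norm)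
    show "surj T" by (rule surj_of_inverse[where g = "\<lambda>y. y - e *\<^sub>R axis i 1"]) (simp add: T_def)
  qed measurable
  also have "\<dots> = (\<integral>\<^sup>+y. indicator {y. y $ i = 0} y * (indicator (facet i 0) y * f (T y)) \<partial>surface)"
    by (rule nn_integral_cong) (auto simp: indicator_def T_facet[symmetric], simp add: facet_def)
  also have "\<dots> = (\<integral>\<^sup>+y. indicator (facet i 0) y * f (T y) \<partial>hyperplane_surface i)"
    by (rule nn_integral_hyperplane_surface[symmetric]) measurable
  also have "\<dots> = hausdorff_outer (CARD('n) - 1) (facet i 0) *
      (\<integral>\<^sup>+x. indicator {x. 0 \<le> x $ i \<and> x $ i \<le> 1} x * (indicator (facet i 0) (slice i 0 x) * f (T (slice i 0 x))) \<partial>lborel)"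
    by (rule hyperplane_nn_integral) measurable
  also have "(\<integral>\<^sup>+x. indicator {x. 0 \<le> x $ i \<and> x $ i \<le> 1} x * (indicator (facet i 0) (slice i 0 x) * f (T (slice i 0 x))) \<partial>lborel)
      = (\<integral>\<^sup>+x. indicator (cbox 0 1) x * f (slice i e x) \<partial>lborel)"
  proof (rule nn_integral_cong)
    fix x :: "real ^ 'n"
    have 1: "T (slice i 0 x) = slice i e x" by (simp add: vec_eq_iff T_nth)
    have 2: "x \<in> cbox 0 1 \<longleftrightarrow> (0 \<le> x $ i \<and> x $ i \<le> 1) \<and> slice i 0 x \<in> facet i 0"
      unfolding facet_def mem_Collect_eq mem_cbox_01 slice_nth by (smt (verit))
    show "indicator {x. 0 \<le> x $ i \<and> x $ i \<le> 1} x * (indicator (facet i 0) (slice i 0 x) * f (T (slice i 0 x)))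
      = indicator (cbox 0 1) x * f (slice i e x)"
      unfolding 1 by (simp only: indicator_def 2 mem_Collect_eq of_bool_conj mult.assoc)
  qed
  finally show ?thesis .
qed

text \<open>The surface measure on the facet is, up to a factor, the image of Lebesgue measure on the cube under
  orthogonal projection. The factor does not depend on the facet, so that it can be expressed through
  an arbitrary one, \<open>i'\<close>.\<close>

lemma facet_integral:
  fixes i i' :: "'n::finite" and U :: "real ^ 'n \<Rightarrow> real"
  assumes U [measurable]: "U \<in> borel_measurable borel" and e: "0 \<le> e" "e \<le> 1"
  shows "(LINT y:facet i e|surface. U y)
    = measure surface (facet i' 0) * (LINT x:cbox 0 1|lborel. U (slice i e x))"
proof -
  define h where "h = measure surface (facet i' 0)"
  have fin: "emeasure surface (facet i' 0) < top"
    using hausdorff_facet_finite[of i' 0] by (simp add: emeasure_hausdorff)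
  have h: "hausdorff_outer (CARD('n) - 1) (facet i 0) = ennreal h"
    using hausdorff_facet_eq[of 0 "CARD('n) - 1" i i'] fin
    by (simp add: h_def emeasure_hausdorff[symmetric] emeasure_eq_ennreal_measure)
  have h0: "h \<ge> 0" by (simp add: h_def)
  have eq: "density surface (\<lambda>x. ennreal (indicator (facet i e) x))
      = distr (density lborel (\<lambda>x. ennreal (h * indicator (cbox 0 1) x))) borel (slice i e)" (is "?M = ?N")
  proof (rule measure_eqI)
    fix A assume "A \<in> sets ?M"
    then have [measurable]: "A \<in> sets borel" by simp
    have "emeasure ?M A = (\<integral>\<^sup>+y. indicator (facet i e) y * indicator A y \<partial>surface)"
      by (subst emeasure_density) (auto simp: ennreal_indicator)
    also have "\<dots> = ennreal h * (\<integral>\<^sup>+x. indicator (cbox 0 1) x * indicator A (slice i e x) \<partial>lborel)"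
      unfolding h[symmetric] by (rule facet_nn_integral[OF _ e]) simp
    also have "\<dots> = (\<integral>\<^sup>+x. ennreal h * (indicator (cbox 0 1) x * indicator A (slice i e x)) \<partial>lborel)"
      by (rule nn_integral_cmult[symmetric]) measurable
    also have "\<dots> = (\<integral>\<^sup>+x. ennreal (h * indicator (cbox 0 1) x) * indicator (slice i e -` A) x \<partial>lborel)"
      by (rule nn_integral_cong) (simp add: ennreal_mult h0 ennreal_indicator mult.assoc indicator_vimage)
    also have "\<dots> = emeasure (density lborel (\<lambda>x. ennreal (h * indicator (cbox 0 1) x))) (slice i e -` A)"
      using measurable_sets[OF slice_measurable, of A i e] by (subst emeasure_density) auto
    also have "\<dots> = emeasure ?N A" by (subst emeasure_distr) auto
    finally show "emeasure ?M A = emeasure ?N A" .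
  qed simp
  have "(LINT y:facet i e|surface. U y) = (LINT y|?M. U y)"
    unfolding set_lebesgue_integral_def by (subst integral_density) (auto simp: indicator_def)
  also have "\<dots> = (LINT x|density lborel (\<lambda>x. ennreal (h * indicator (cbox 0 1) x)). U (slice i e x))"
    unfolding eq by (rule integral_distr) simp_all
  also have "\<dots> = (LINT x|lborel. (h * indicator (cbox 0 1) x) *\<^sub>R U (slice i e x))"
    by (rule integral_density) (use h0 in \<open>auto intro!: AE_I2 mult_nonneg_nonneg\<close>)
  also have "\<dots> = h * (LINT x:cbox 0 1|lborel. U (slice i e x))"
    unfolding set_lebesgue_integral_def by (simp add: mult.assoc)
  finally show ?thesis by (simp add: h_def)
qed

lemma set_integrable_compact:
  fixes f :: "'a::metric_space \<Rightarrow> real"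
  assumes "sets M = sets borel" "compact S" "emeasure M S < \<infinity>" "continuous_on UNIV f"
  shows "set_integrable M S f"
proof -
  have S: "S \<in> sets M" using assms(1,2) by (simp add: borel_compact)
  have f: "f \<in> borel_measurable M"
    using borel_measurable_continuous_onI[OF assms(4)] assms(1) by (simp cong: measurable_cong_sets)
  obtain B where B: "\<And>x. x \<in> S \<Longrightarrow> norm (f x) \<le> B"
    using compact_imp_bounded[OF compact_continuous_image[OF continuous_on_subset[OF assms(4) subset_UNIV] assms(2)]]
    unfolding bounded_iff by blast
  show ?thesis unfolding set_integrable_def
  proof (rule integrableI_bounded_set[OF S])
    show "(\<lambda>x. indicator S x *\<^sub>R f x) \<in> borel_measurable M" using S f by simp
    show "AE x in M. x \<in> S \<longrightarrow> norm (indicator S x *\<^sub>R f x) \<le> B" using B by auto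
  qed (use assms in auto)
qed

section \<open>Integrals over the boundary of the cube\<close>

lemma frontier_cube: "frontier (cbox 0 1 :: (real ^ 'n::finite) set) = (\<Union>i. facet i 0 \<union> facet i 1)"
proof -
  have "x \<in> cbox 0 1 - box 0 (1 :: real ^ 'n) \<longleftrightarrow> (\<exists>i. x \<in> facet i 0 \<union> facet i 1)" for x
  proof -
    have "x \<in> box 0 1 \<longleftrightarrow> (\<forall>i. 0 < x $ i \<and> x $ i < 1)" by (simp add: mem_box_cart)
    moreover have "x $ i = 0 \<or> x $ i = 1 \<longleftrightarrow> \<not> (0 < x $ i \<and> x $ i < 1)" if "x \<in> cbox 0 1" for i
      using that by (auto simp: mem_cbox_01 not_less intro: antisym)
    ultimately show ?thesis unfolding facet_def by blast
  qed
  then show ?thesis by (auto simp: frontier_cbox)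
qed

text \<open>The projection formula turns the intersection of the facet with another coordinate hyperplane into a
  hyperplane section of the cube, which is a null set.\<close>

lemma AE_facet_disjoint:
  fixes i j :: "'n::finite"
  assumes "i \<noteq> j" and e: "0 \<le> e" "e \<le> 1"
  shows "AE y in surface. \<not> (y \<in> facet i e \<and> y $ j = e')"
proof -
  have "negligible {x :: real ^ 'n. x \<bullet> axis j 1 = e'}"
    by (rule negligible_standard_hyperplane) (auto simp: Basis_vec_def)
  then have "negligible {x :: real ^ 'n. x $ j = e'}" by (simp add: inner_axis)
  then have "{x :: real ^ 'n. x $ j = e'} \<in> null_sets lborel"
    by (simp add: negligible_iff_null_sets null_sets_completion_iff)
  then have "AE x in lborel. x \<notin> {x :: real ^ 'n. x $ j = e'}" by (rule AE_not_in)
  then have "(\<integral>\<^sup>+x. indicator (cbox 0 1) x * indicator {y. y $ j = e'} (slice i e x) \<partial>lborel) = (\<integral>\<^sup>+x. 0 \<partial>(lborel :: (real ^ 'n) measure))"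
    using assms(1) by (intro nn_integral_cong_AE) (auto elim!: eventually_mono simp: indicator_def)
  then have "(\<integral>\<^sup>+y. indicator (facet i e) y * indicator {y. y $ j = e'} y \<partial>surface) = 0"
    by (subst facet_nn_integral[OF _ e]) auto
  then have "AE y in surface. indicator (facet i e) y * indicator {y :: real ^ 'n. y $ j = e'} y = (0 :: ennreal)"
    by (subst (asm) nn_integral_0_iff_AE) auto
  then show ?thesis by eventually_elim (auto simp: indicator_def)
qed

lemma AE_frontier_cube:
  "AE y in (surface :: (real ^ 'n::finite) measure). indicator (frontier (cbox 0 1)) y
    = (\<Sum>i\<in>UNIV. indicator (facet i 0) y + indicator (facet i 1) y :: real)"
proof -
  have "AE y in (surface :: (real ^ 'n) measure). i \<noteq> j \<longrightarrow> \<not> (y \<in> facet i e \<and> y $ j = e')"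
    if "e \<in> {0, 1}" for i j e e'
    using AE_facet_disjoint[of i j e e'] that by (cases "i = j") auto
  then have "AE y in (surface :: (real ^ 'n) measure). \<forall>e\<in>{0, 1}. \<forall>e'\<in>{0, 1}. \<forall>i\<in>UNIV. \<forall>j\<in>UNIV. i \<noteq> j \<longrightarrow> \<not> (y \<in> facet i e \<and> y $ j = e')"
    by (intro eventually_ball_finite ballI) auto
  then show ?thesis
  proof eventually_elim
    fix y :: "real ^ 'n"
    assume *: "\<forall>e\<in>{0, 1}. \<forall>e'\<in>{0, 1}. \<forall>i\<in>UNIV. \<forall>j\<in>UNIV. i \<noteq> j \<longrightarrow> \<not> (y \<in> facet i e \<and> y $ j = e')"
    show "indicator (frontier (cbox 0 1)) y = (\<Sum>i\<in>UNIV. indicator (facet i 0) y + indicator (facet i 1) y :: real)"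
    proof (cases "y \<in> frontier (cbox 0 1)")
      case False
      then show ?thesis unfolding frontier_cube by simp
    next
      case True
      then obtain i e where ie: "y \<in> facet i e" "e \<in> {0, 1}" unfolding frontier_cube by blast
      have "indicator (facet j 0) y + indicator (facet j 1) y = (if j = i then 1 else 0 :: real)" for j
      proof (cases "j = i")
        case True
        then show ?thesis using ie by (auto simp: facet_def indicator_def)
      next
        case False
        then have "y $ j \<noteq> 0" "y $ j \<noteq> 1"
          using *[rule_format, of e 0 i j] *[rule_format, of e 1 i j] ie by auto
        then show ?thesis using False by (simp add: facet_def)
      qed
      then have "(\<Sum>j\<in>UNIV. indicator (facet j 0) y + indicator (facet j 1) y :: real) = 1" by simp
      then show ?thesis using True by simp
    qed
  qed
qed

lemma frontier_cube_integral:
  fixes U :: "real ^ 'n::finite \<Rightarrow> real" and i' :: 'n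
  assumes U: "continuous_on UNIV U"
  shows "(LINT y:frontier (cbox 0 1)|surface. U y) = measure surface (facet i' 0) *
    (\<Sum>i\<in>UNIV. (LINT x:cbox 0 1|lborel. U (slice i 0 x)) + (LINT x:cbox 0 1|lborel. U (slice i 1 x)))"
proof -
  have m [measurable]: "U \<in> borel_measurable borel" by (rule borel_measurable_continuous_onI[OF U])
  have int: "integrable surface (\<lambda>y. indicator (facet i e) y * U y)" for i e
  proof -
    have "set_integrable surface (facet i e) U"
    proof (rule set_integrable_compact[OF sets_hausdorff _ _ U])
      show "compact (facet i e)"
        unfolding compact_eq_bounded_closed
        by (rule conjI[OF bounded_subset[OF bounded_cbox[of 0 1]] closed_facet]) (auto simp: facet_def)
      show "emeasure surface (facet i e) < \<infinity>"
        using hausdorff_facet_finite[of i e] by (simp add: emeasure_hausdorff)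
    qed
    then show ?thesis by (simp add: set_integrable_def)
  qed
  have "(LINT y:frontier (cbox 0 1)|surface. U y)
      = (LINT y|surface. (\<Sum>i\<in>UNIV. indicator (facet i 0) y * U y + indicator (facet i 1) y * U y))"
    unfolding set_lebesgue_integral_def
  proof (rule integral_cong_AE)
    show "AE y in surface. indicator (frontier (cbox 0 1)) y *\<^sub>R U y
        = (\<Sum>i\<in>UNIV. indicator (facet i 0) y * U y + indicator (facet i 1) y * U y)"
      using AE_frontier_cube by eventually_elim (simp add: sum_distrib_right distrib_right)
    have "frontier (cbox 0 1 :: (real ^ 'n) set) \<in> sets borel" by (intro borel_closed frontier_closed)
    then show "(\<lambda>y. indicator (frontier (cbox 0 1)) y *\<^sub>R U y) \<in> borel_measurable surface" by simp
  qed simp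
  also have "\<dots> = (\<Sum>i\<in>UNIV. (LINT y:facet i 0|surface. U y) + (LINT y:facet i 1|surface. U y))"
    using int by (simp add: set_lebesgue_integral_def)
  also have "\<dots> = (\<Sum>i\<in>UNIV. measure surface (facet i' 0) * (LINT x:cbox 0 1|lborel. U (slice i 0 x))
      + measure surface (facet i' 0) * (LINT x:cbox 0 1|lborel. U (slice i 1 x)))"
    by (intro sum.cong refl arg_cong2[where f = "(+)"] facet_integral m) auto
  finally show ?thesis by (simp add: sum_distrib_left distrib_left)
qed

lemma facet_area_pos:
  fixes i :: "'n::finite"
  shows "0 < measure surface (facet i 0)"
  using hausdorff_facet_pos[of 0 i] hausdorff_facet_finite[of i 0]
  by (simp add: measure_def emeasure_hausdorff enn2real_positive_iff)

section \<open>Moments of the cube\<close>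

definition monomial :: "('n \<Rightarrow> nat) \<Rightarrow> real ^ 'n::finite \<Rightarrow> real" where
  "monomial \<alpha> x = (\<Prod>i\<in>UNIV. (x $ i) ^ \<alpha> i)"

lemma continuous_on_monomial [continuous_intros]: "continuous_on S f \<Longrightarrow> continuous_on S (\<lambda>x. monomial \<alpha> (f x))"
  unfolding monomial_def by (intro continuous_intros)

lemma measurable_vec_lambda_PiM:
  "(\<lambda>f. \<chi> i. f i :: real ^ 'n) \<in> borel_measurable (PiM UNIV (\<lambda>_ :: 'n::finite. lborel))"
proof (subst borel_measurable_euclidean_space, rule ballI)
  fix b :: "real ^ 'n" assume "b \<in> Basis"
  then obtain i where "b = axis i 1" by (auto simp: Basis_vec_def)
  then show "(\<lambda>f. (\<chi> i. f i) \<bullet> b) \<in> borel_measurable (PiM UNIV (\<lambda>_ :: 'n. lborel :: real measure))"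
    by (simp add: inner_axis) measurable
qed

text \<open>Lebesgue measure on vectors as a product measure indexed by the coordinates, so that integrals of
  products factorise.\<close>

lemma lborel_vec_eq_PiM:
  "(lborel :: (real ^ 'n::finite) measure) = distr (PiM UNIV (\<lambda>_ :: 'n. lborel)) borel (\<lambda>f. \<chi> i. f i)"
proof (rule lborel_eqI)
  interpret product_sigma_finite "\<lambda>_ :: 'n. lborel :: real measure" ..
  have m [measurable]: "(\<lambda>f. \<chi> i. f i :: real ^ 'n) \<in> measurable (PiM UNIV (\<lambda>_. lborel)) borel"
    by (rule measurable_vec_lambda_PiM)
  fix l u :: "real ^ 'n" assume lu: "\<And>b. b \<in> Basis \<Longrightarrow> l \<bullet> b \<le> u \<bullet> b"
  have le: "l $ i \<le> u $ i" for i using lu[of "axis i 1"] by (simp add: inner_axis)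
  have "emeasure (distr (PiM UNIV (\<lambda>_ :: 'n. lborel)) borel (\<lambda>f. \<chi> i. f i)) (box l u)
      = emeasure (PiM UNIV (\<lambda>_ :: 'n. lborel)) (PiE UNIV (\<lambda>i. {l $ i<..<u $ i}))"
    by (subst emeasure_distr) (auto simp: space_PiM mem_box_cart PiE_def Pi_def intro!: arg_cong2[where f = emeasure])
  also have "\<dots> = (\<Prod>i\<in>UNIV. ennreal (u $ i - l $ i))"
    using le by (subst emeasure_PiM) auto
  also have "\<dots> = ennreal (\<Prod>i\<in>UNIV. u $ i - l $ i)"
    using le by (intro prod_ennreal) auto
  also have "(\<Prod>i\<in>UNIV. u $ i - l $ i) = (\<Prod>b\<in>Basis. (u - l) \<bullet> b)"
  proof -
    have B: "(Basis :: (real ^ 'n) set) = (\<lambda>i. axis i 1) ` UNIV" by (auto simp: Basis_vec_def)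
    have inj: "inj (\<lambda>i :: 'n. axis i (1 :: real))" by (auto simp: inj_on_def axis_eq_axis)
    show ?thesis unfolding B prod.reindex[OF inj] by (simp add: inner_axis)
  qed
  finally show "emeasure (distr (PiM UNIV (\<lambda>_ :: 'n. lborel)) borel (\<lambda>f. \<chi> i. f i)) (box l u)
      = ennreal (\<Prod>b\<in>Basis. (u - l) \<bullet> b)" .
qed simp

lemma cube_integral_prod:
  fixes g :: "'n::finite \<Rightarrow> real \<Rightarrow> real"
  assumes g: "\<And>i. continuous_on UNIV (g i)"
  shows "(LINT x:cbox 0 1|lborel. (\<Prod>i\<in>UNIV. g i (x $ i))) = (\<Prod>i\<in>UNIV. LINT t:{0..1}|lborel. g i t)"
proof -
  interpret product_sigma_finite "\<lambda>_ :: 'n. lborel :: real measure" ..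
  have gm [measurable]: "g i \<in> borel_measurable borel" for i by (rule borel_measurable_continuous_onI[OF g])
  have m [measurable]: "(\<lambda>f. \<chi> i. f i :: real ^ 'n) \<in> measurable (PiM UNIV (\<lambda>_. lborel)) borel"
    by (rule measurable_vec_lambda_PiM)
  have ind: "indicator (cbox 0 1) x * (\<Prod>i\<in>UNIV. g i (x $ i)) = (\<Prod>i\<in>UNIV. indicator {0..1} (x $ i) * g i (x $ i))"
    for x :: "real ^ 'n"
  proof -
    have "indicator (cbox 0 1) x = (\<Prod>i\<in>UNIV. indicator {0..1} (x $ i) :: real)"
    proof (cases "x \<in> cbox 0 1")
      case True
      then have "\<And>i. x $ i \<in> {0..1}" by (simp add: mem_cbox_01)
      then show ?thesis using True by simp
    next
      case False
      then obtain i where "x $ i \<notin> {0..1}" by (auto simp: mem_cbox_01)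
      then have "(\<Prod>i\<in>UNIV. indicator {0..1} (x $ i) :: real) = 0"
        by (intro prod_zero) (auto intro!: bexI[of _ i] simp: indicator_def)
      then show ?thesis using False by simp
    qed
    then show ?thesis by (simp add: prod.distrib)
  qed
  have "(LINT x:cbox 0 1|lborel. (\<Prod>i\<in>UNIV. g i (x $ i)))
      = (LINT x|lborel. (\<Prod>i\<in>UNIV. indicator {0..1} (x $ i) * g i (x $ i)) :: real)"
    unfolding set_lebesgue_integral_def real_scaleR_def ind ..
  also have "\<dots> = (LINT f|PiM UNIV (\<lambda>_ :: 'n. lborel). (\<Prod>i\<in>UNIV. indicator {0..1} (f i) * g i (f i)))"
    unfolding lborel_vec_eq_PiM by (subst integral_distr[OF m]) simp_all
  also have "\<dots> = (\<Prod>i\<in>UNIV. LINT t|lborel. indicator {0..1} t * g i t)"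
  proof (rule product_integral_prod)
    fix i
    have "set_integrable lborel {0..1} (g i)"
      by (rule set_integrable_compact) (auto intro: g)
    then show "integrable lborel (\<lambda>t. indicator {0..1} t * g i t)" by (simp add: set_integrable_def)
  qed simp
  finally show ?thesis by (simp add: set_lebesgue_integral_def)
qed

definition interval_moment :: "nat \<Rightarrow> real" where
  "interval_moment j = (LINT t:{0..1}|lborel. (t - 1 / 2) ^ j)"

lemma interval_moment_eq: "(real j + 1) * interval_moment j = (1 / 2) ^ (j + 1) - (- (1 / 2)) ^ (j + 1)"
proof -
  have "interval_moment j = (1 - 1 / 2) ^ (j + 1) / real (j + 1) - (0 - 1 / 2) ^ (j + 1) / real (j + 1)"
    unfolding interval_moment_def set_lebesgue_integral_def
  proof (rule integral_FTC_atLeastAtMost[where F = "\<lambda>t. (t - 1 / 2) ^ (j + 1) / real (j + 1)"])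
    show "((\<lambda>t. (t - 1 / 2) ^ (j + 1) / real (j + 1)) has_vector_derivative (x - 1 / 2) ^ j) (at x within {0..1})" for x :: real
      unfolding has_real_derivative_iff_has_vector_derivative[symmetric]
      by (rule derivative_eq_intros refl | simp)+
  qed (auto intro!: continuous_intros)
  then have "interval_moment j = ((1 - 1 / 2) ^ (j + 1) - (0 - 1 / 2) ^ (j + 1)) / (real j + 1)"
    by (simp only: diff_divide_distrib of_nat_add of_nat_1)
  moreover have "real j + 1 \<noteq> 0" by linarith
  ultimately have "(real j + 1) * interval_moment j = (1 - 1 / 2) ^ (j + 1) - (0 - 1 / 2) ^ (j + 1)"
    by (metis nonzero_mult_div_cancel_left times_divide_eq_right)
  then show ?thesis by simp
qed

lemma interval_moment_odd: "odd j \<Longrightarrow> interval_moment j = 0"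
  using interval_moment_eq[of j] by simp

text \<open>The one-dimensional case of the cone identity, from which the cube inherits it.\<close>

lemma interval_moment_endpoints: "(0 - 1 / 2) ^ j + (1 - 1 / 2) ^ j = 2 * (real j + 1) * interval_moment j"
  unfolding mult.assoc interval_moment_eq by simp

lemma cube_moment:
  "(LINT x:cbox 0 1|lborel. monomial \<alpha> (x - (\<chi> i. 1 / 2))) = (\<Prod>i\<in>UNIV. interval_moment (\<alpha> i))"
proof -
  have "(LINT x:cbox 0 1|lborel. monomial \<alpha> (x - (\<chi> i. 1 / 2)))
      = (LINT x:cbox 0 1|lborel. (\<Prod>i\<in>UNIV. (x $ i - 1 / 2) ^ \<alpha> i))"
    by (simp add: monomial_def)
  also have "\<dots> = (\<Prod>i\<in>UNIV. interval_moment (\<alpha> i))"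
    unfolding interval_moment_def by (rule cube_integral_prod) (intro continuous_intros)
  finally show ?thesis .
qed

lemma cube_slice_moment:
  "(LINT x:cbox 0 1|lborel. monomial \<alpha> (slice i e x - (\<chi> i. 1 / 2)))
    = (e - 1 / 2) ^ \<alpha> i * (\<Prod>j\<in>UNIV - {i}. interval_moment (\<alpha> j))"
proof -
  let ?g = "\<lambda>j t. if j = i then (e - 1 / 2) ^ \<alpha> i else (t - 1 / 2) ^ \<alpha> j"
  have "(LINT x:cbox 0 1|lborel. monomial \<alpha> (slice i e x - (\<chi> i. 1 / 2)))
      = (LINT x:cbox 0 1|lborel. (\<Prod>j\<in>UNIV. ?g j (x $ j)))"
    unfolding monomial_def by (intro set_lebesgue_integral_cong allI impI prod.cong) auto
  also have "\<dots> = (\<Prod>j\<in>UNIV. LINT t:{0..1}|lborel. ?g j t)"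
  proof (rule cube_integral_prod)
    show "continuous_on UNIV (?g j)" for j by (cases "j = i") (auto intro!: continuous_intros)
  qed
  also have "\<dots> = (LINT t:{0..1 :: real}|lborel. (e - 1 / 2) ^ \<alpha> i) * (\<Prod>j\<in>UNIV - {i}. LINT t:{0..1}|lborel. ?g j t)"
    by (subst prod.remove[of UNIV i]) auto
  also have "(LINT t:{0..1 :: real}|lborel. (e - 1 / 2) ^ \<alpha> i) = (e - 1 / 2) ^ \<alpha> i"
    by (simp add: set_lebesgue_integral_def)
  also have "(\<Prod>j\<in>UNIV - {i}. LINT t:{0..1}|lborel. ?g j t) = (\<Prod>j\<in>UNIV - {i}. interval_moment (\<alpha> j))"
    by (rule prod.cong) (auto simp: interval_moment_def)
  finally show ?thesis .
qed

text \<open>Replacing the factor of coordinate \<open>i\<close> by its endpoint values multiplies the product of moments by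
  \<open>2 * (\<alpha> i + 1)\<close>; summation over \<open>i\<close> gives the factor \<open>CARD('n) + sum \<alpha> UNIV\<close>.\<close>

lemma frontier_cube_moment:
  fixes \<alpha> :: "'n::finite \<Rightarrow> nat" and i' :: 'n
  shows "(LINT y:frontier (cbox 0 1)|surface. monomial \<alpha> (y - (\<chi> i. 1 / 2)))
    = 2 * measure surface (facet i' 0) * real (CARD('n) + (sum \<alpha> UNIV)) * (\<Prod>i\<in>UNIV. interval_moment (\<alpha> i))"
proof -
  have "(LINT y:frontier (cbox 0 1)|surface. monomial \<alpha> (y - (\<chi> i. 1 / 2)))
    = measure surface (facet i' 0) * (\<Sum>i\<in>UNIV. (0 - 1 / 2) ^ \<alpha> i * (\<Prod>j\<in>UNIV - {i}. interval_moment (\<alpha> j))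
      + (1 - 1 / 2) ^ \<alpha> i * (\<Prod>j\<in>UNIV - {i}. interval_moment (\<alpha> j)))"
    unfolding cube_slice_moment[symmetric] by (rule frontier_cube_integral) (intro continuous_intros)
  also have "(\<Sum>i\<in>UNIV. (0 - 1 / 2) ^ \<alpha> i * (\<Prod>j\<in>UNIV - {i}. interval_moment (\<alpha> j))
      + (1 - 1 / 2) ^ \<alpha> i * (\<Prod>j\<in>UNIV - {i}. interval_moment (\<alpha> j)))
    = (\<Sum>i\<in>UNIV. 2 * (real (\<alpha> i) + 1) * (\<Prod>j\<in>UNIV. interval_moment (\<alpha> j)))"
  proof (rule sum.cong[OF refl])
    fix i
    have "(\<Prod>j\<in>UNIV. interval_moment (\<alpha> j)) = interval_moment (\<alpha> i) * (\<Prod>j\<in>UNIV - {i}. interval_moment (\<alpha> j))"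
      by (rule prod.remove) auto
    then show "(0 - 1 / 2) ^ \<alpha> i * (\<Prod>j\<in>UNIV - {i}. interval_moment (\<alpha> j))
      + (1 - 1 / 2) ^ \<alpha> i * (\<Prod>j\<in>UNIV - {i}. interval_moment (\<alpha> j)) = 2 * (real (\<alpha> i) + 1) * (\<Prod>j\<in>UNIV. interval_moment (\<alpha> j))"
      unfolding distrib_right[symmetric] interval_moment_endpoints by simp
  qed
  also have "\<dots> = 2 * real (CARD('n) + (sum \<alpha> UNIV)) * (\<Prod>j\<in>UNIV. interval_moment (\<alpha> j))"
    unfolding sum_distrib_right[symmetric] sum_distrib_left[symmetric] by (simp add: sum.distrib add.commute)
  finally show ?thesis by (simp add: mult_ac)
qed

section \<open>Reflections\<close>

text \<open>For \<open>w = 0\<close> division by zero makes this the identity, so that \<open>reflect (a - b)\<close> maps \<open>a\<close> to \<open>b\<close>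
  for all \<open>a\<close> and \<open>b\<close> of equal norm.\<close>

definition reflect :: "'a::real_inner \<Rightarrow> 'a \<Rightarrow> 'a" where
  "reflect w x = x - (2 * (x \<bullet> w) / (w \<bullet> w)) *\<^sub>R w"

lemma reflect_inner: "reflect w x \<bullet> reflect w y = x \<bullet> y"
  by (cases "w = 0") (auto simp: reflect_def inner_diff algebra_simps inner_commute)

lemma reflect_adjoint: "reflect w x \<bullet> y = x \<bullet> reflect w y"
  by (simp add: reflect_def inner_diff algebra_simps inner_commute)

lemma reflect_diff: "reflect w x - reflect w y = reflect w (x - y)"
  by (simp add: reflect_def inner_diff diff_divide_distrib algebra_simps)

lemma reflect_reflect [simp]: "reflect w (reflect w x) = x"
  by (cases "w = 0") (auto simp: reflect_def inner_diff algebra_simps scaleR_add_left[symmetric])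

lemma norm_reflect [simp]: "norm (reflect w x) = norm x"
  by (simp add: norm_eq_sqrt_inner reflect_inner)

lemma dist_reflect: "dist (reflect w x) (reflect w y) = dist x y"
  by (simp add: dist_norm reflect_diff)

lemma surj_reflect: "surj (reflect w)"
  by (rule surj_of_inverse[where g = "reflect w"]) simp

lemma reflect_swap:
  assumes "norm a = norm b"
  shows "reflect (a - b) a = b"
proof (cases "a = b")
  case False
  have "a \<bullet> a = b \<bullet> b" using assms by (simp add: norm_eq)
  then have eq: "2 * (a \<bullet> (a - b)) = (a - b) \<bullet> (a - b)"
    by (simp add: inner_diff inner_commute)
  have "(a - b) \<bullet> (a - b) \<noteq> 0" using False by simp
  then have "2 * (a \<bullet> (a - b)) / ((a - b) \<bullet> (a - b)) = 1" unfolding eq by (rule divide_self)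
  then show ?thesis unfolding reflect_def by (simp only: scaleR_one) simp
qed (simp add: reflect_def)

lemma continuous_reflect [continuous_intros]: "continuous_on S (reflect w)"
proof -
  have "reflect w = (\<lambda>x. x - (2 * (x \<bullet> w) * inverse (w \<bullet> w)) *\<^sub>R w)"
    by (simp add: fun_eq_iff reflect_def divide_inverse)
  then show ?thesis by (simp only:) (intro continuous_intros)
qed

lemma reflect_measurable [measurable]: "reflect w \<in> borel_measurable borel"
  by (intro borel_measurable_continuous_onI continuous_reflect)

lemma nn_integral_lborel_affine:
  fixes f :: "'a::euclidean_space \<Rightarrow> ennreal"
  assumes [measurable]: "f \<in> borel_measurable borel" and "c \<noteq> 0"
  shows "(\<integral>\<^sup>+x. f x \<partial>lborel) = ennreal (\<bar>c\<bar> ^ DIM('a)) * (\<integral>\<^sup>+x. f (t + c *\<^sub>R x) \<partial>lborel)"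
  by (subst lborel_affine[OF assms(2), of t], subst nn_integral_density)
     (simp_all add: nn_integral_distr nn_integral_cmult)

lemma nn_integral_lborel_flip:
  fixes f :: "'a::euclidean_space \<Rightarrow> ennreal"
  assumes "f \<in> borel_measurable borel"
  shows "(\<integral>\<^sup>+x. f (a - x) \<partial>lborel) = (\<integral>\<^sup>+x. f x \<partial>lborel)"
  using nn_integral_lborel_affine[OF assms, of "- 1" a] by simp

text \<open>The same Tonelli argument as for hyperplanes: the image of Lebesgue measure under the reflection is
  again invariant under \<open>y \<mapsto> a - y\<close>, hence proportional to Lebesgue measure, and both agree on the unit
  ball \<open>G\<close>, which the reflection preserves.\<close>

lemma nn_integral_lborel_reflect:
  fixes f :: "'a::euclidean_space \<Rightarrow> ennreal"
  assumes f [measurable]: "f \<in> borel_measurable borel"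
  shows "(\<integral>\<^sup>+x. f (reflect w x) \<partial>lborel) = (\<integral>\<^sup>+x. f x \<partial>lborel)"
proof -
  let ?T = "reflect w :: 'a \<Rightarrow> 'a"
  define G where "G = (indicator (cball 0 1) :: 'a \<Rightarrow> ennreal)"
  have G [measurable]: "G \<in> borel_measurable borel"
    unfolding G_def by (intro borel_measurable_indicator borel_closed closed_cball)
  have GT: "G (?T x) = G x" for x by (simp add: G_def indicator_def)
  let ?v = "\<integral>\<^sup>+x. G x \<partial>lborel"
  have v: "?v = emeasure lborel (cball 0 1 :: 'a set)"
    unfolding G_def by (rule nn_integral_indicator) (simp add: borel_closed)
  have v0: "?v \<noteq> 0"
  proof -
    have "0 < emeasure lborel (ball 0 1 :: 'a set)"
      using content_ball_pos[of 1 "0 :: 'a"] emeasure_lborel_ball_finite[of "0 :: 'a" 1]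
      by (simp add: emeasure_eq_ennreal_measure)
    also have "\<dots> \<le> emeasure lborel (cball 0 1 :: 'a set)" by (rule emeasure_mono) auto
    finally show ?thesis by (simp add: v)
  qed
  have vfin: "?v \<noteq> top" using emeasure_lborel_cball_finite[of "0 :: 'a" 1] by (simp add: v)
  have "(\<integral>\<^sup>+y. f (?T y) \<partial>lborel) * ?v = (\<integral>\<^sup>+y. f (?T y) * (\<integral>\<^sup>+x. G x \<partial>lborel) \<partial>lborel)"
    by (rule nn_integral_multc[symmetric]) simp
  also have "\<dots> = (\<integral>\<^sup>+y. \<integral>\<^sup>+x. f (?T y) * G (x - ?T y) \<partial>lborel \<partial>lborel)"
  proof (rule nn_integral_cong)
    fix y
    have "(\<integral>\<^sup>+x. f (?T y) * G (x - ?T y) \<partial>lborel) = f (?T y) * (\<integral>\<^sup>+x. G (x + (- ?T y)) \<partial>lborel)"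
      by (subst nn_integral_cmult) simp_all
    then show "f (?T y) * ?v = (\<integral>\<^sup>+x. f (?T y) * G (x - ?T y) \<partial>lborel)"
      by (simp only: nn_integral_lborel_translate[OF G])
  qed
  also have "\<dots> = (\<integral>\<^sup>+x. \<integral>\<^sup>+y. f (?T y) * G (x - ?T y) \<partial>lborel \<partial>lborel)"
    by (rule lborel_pair.Fubini') measurable
  also have "\<dots> = (\<integral>\<^sup>+x. \<integral>\<^sup>+y. f (x - ?T y) * G y \<partial>lborel \<partial>lborel)"
  proof (rule nn_integral_cong)
    fix x
    have "(\<integral>\<^sup>+y. f (?T (?T x - y)) * G (x - ?T (?T x - y)) \<partial>lborel) = (\<integral>\<^sup>+y. f (?T y) * G (x - ?T y) \<partial>lborel)"
      by (rule nn_integral_lborel_flip) measurable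
    moreover have "?T (?T x - y) = x - ?T y" for y
      using reflect_diff[of w "?T x" y] by simp
    ultimately show "(\<integral>\<^sup>+y. f (?T y) * G (x - ?T y) \<partial>lborel) = (\<integral>\<^sup>+y. f (x - ?T y) * G y \<partial>lborel)"
      by (simp add: GT)
  qed
  also have "\<dots> = (\<integral>\<^sup>+y. \<integral>\<^sup>+x. f (x - ?T y) * G y \<partial>lborel \<partial>lborel)"
    by (rule lborel_pair.Fubini'[symmetric]) measurable
  also have "\<dots> = (\<integral>\<^sup>+y. (\<integral>\<^sup>+x. f x \<partial>lborel) * G y \<partial>lborel)"
  proof (rule nn_integral_cong)
    fix y
    have "(\<integral>\<^sup>+x. f (x - ?T y) * G y \<partial>lborel) = (\<integral>\<^sup>+x. f (x + (- ?T y)) \<partial>lborel) * G y"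
      by (subst nn_integral_multc) simp_all
    then show "(\<integral>\<^sup>+x. f (x - ?T y) * G y \<partial>lborel) = (\<integral>\<^sup>+x. f x \<partial>lborel) * G y"
      by (simp only: nn_integral_lborel_translate[OF f])
  qed
  also have "\<dots> = (\<integral>\<^sup>+x. f x \<partial>lborel) * ?v" by (rule nn_integral_cmult) simp
  finally have e: "(\<integral>\<^sup>+y. f (?T y) \<partial>lborel) * ?v = (\<integral>\<^sup>+x. f x \<partial>lborel) * ?v" .
  have "(\<integral>\<^sup>+y. f (?T y) \<partial>lborel) = (\<integral>\<^sup>+y. f (?T y) \<partial>lborel) * ?v / ?v"
    by (rule ennreal_mult_divide_eq[OF v0 vfin, symmetric])
  also have "\<dots> = (\<integral>\<^sup>+x. f x \<partial>lborel)" unfolding e by (rule ennreal_mult_divide_eq[OF v0 vfin])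
  finally show ?thesis .
qed

lemma distr_lborel_reflect: "distr lborel borel (reflect w) = (lborel :: 'a::euclidean_space measure)"
proof (rule measure_eqI)
  fix A assume "A \<in> sets (distr lborel borel (reflect w :: 'a \<Rightarrow> 'a))"
  then have A [measurable]: "A \<in> sets borel" by simp
  have "emeasure (distr lborel borel (reflect w)) A = (\<integral>\<^sup>+x. indicator A x \<partial>distr lborel borel (reflect w))"
    by simp
  also have "\<dots> = (\<integral>\<^sup>+x. indicator A (reflect w x) \<partial>lborel)" by (rule nn_integral_distr) simp_all
  also have "\<dots> = (\<integral>\<^sup>+x. indicator A x \<partial>lborel)" by (rule nn_integral_lborel_reflect) simp
  finally show "emeasure (distr lborel borel (reflect w)) A = emeasure lborel A" by simp
qed simp

section \<open>Rotation invariant integrals of powers of linear forms\<close>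

text \<open>Reflections act transitively on the vectors of a given norm, so they suffice where rotation
  invariance is needed.\<close>

definition reflection_invariant :: "(real ^ 'n::finite) measure \<Rightarrow> bool" where
  "reflection_invariant M \<longleftrightarrow> sets M = sets borel \<and> (\<forall>w. distr M borel (reflect w) = M)"

lemma reflection_invariant_surface: "reflection_invariant surface"
  unfolding reflection_invariant_def
  by (auto intro!: distr_hausdorff_isometry dist_reflect surj_reflect)

lemma reflection_invariant_lborel: "reflection_invariant lborel"
  unfolding reflection_invariant_def by (simp add: distr_lborel_reflect)

lemma reflection_invariant_integral:
  fixes f :: "real ^ 'n::finite \<Rightarrow> real"
  assumes M: "reflection_invariant M" and S: "S \<in> sets borel" "\<And>x. reflect w x \<in> S \<longleftrightarrow> x \<in> S"
    and f: "f \<in> borel_measurable borel"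
  shows "(LINT x:S|M. f (reflect w x)) = (LINT x:S|M. f x)"
proof -
  have sM: "sets M = sets borel" and d: "distr M borel (reflect w) = M"
    using M by (auto simp: reflection_invariant_def)
  have T: "reflect w \<in> measurable M borel"
    using reflect_measurable[of w] sM by (simp cong: measurable_cong_sets)
  have "(LINT x:S|M. f x) = (LINT x|distr M borel (reflect w). indicator S x *\<^sub>R f x)"
    by (simp add: d set_lebesgue_integral_def)
  also have "\<dots> = (LINT x|M. indicator S (reflect w x) *\<^sub>R f (reflect w x))"
    by (rule integral_distr[OF T]) (use S f in simp)
  also have "\<dots> = (LINT x:S|M. f (reflect w x))"
    unfolding set_lebesgue_integral_def by (rule Bochner_Integration.integral_cong) (auto simp: indicator_def S(2))
  finally show ?thesis by simp
qed

text \<open>A reflection moves \<open>a\<close> to the multiple of \<open>e\<close> with the same norm.\<close>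

lemma linear_power_integral:
  fixes a :: "real ^ 'n::finite" and e :: "real ^ 'n"
  assumes M: "reflection_invariant M" and S: "S \<in> sets borel" "\<And>w x. reflect w x \<in> S \<longleftrightarrow> x \<in> S"
    and e: "norm e = 1"
  shows "(LINT x:S|M. (a \<bullet> x) ^ j) = norm a ^ j * (LINT x:S|M. (e \<bullet> x) ^ j)"
proof -
  have b: "norm a = norm (norm a *\<^sub>R e)" by (simp add: e)
  have [measurable]: "(\<lambda>x. (c \<bullet> x) ^ j) \<in> borel_measurable borel" for c :: "real ^ 'n"
    by (intro borel_measurable_continuous_onI continuous_intros)
  let ?w = "norm a *\<^sub>R e - a"
  have "(LINT x:S|M. (a \<bullet> x) ^ j) = (LINT x:S|M. ((norm a *\<^sub>R e) \<bullet> reflect ?w x) ^ j)"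
    using reflect_swap[OF b[symmetric]] by (simp add: reflect_adjoint[symmetric])
  also have "\<dots> = (LINT x:S|M. ((norm a *\<^sub>R e) \<bullet> x) ^ j)"
    by (rule reflection_invariant_integral[OF M S]) measurable
  also have "\<dots> = (LINT x:S|M. norm a ^ j * (e \<bullet> x) ^ j)" by (simp add: power_mult_distrib)
  finally show ?thesis by simp
qed

section \<open>From powers of linear forms to monomials\<close>

text \<open>Polarisation: apply the statement to \<open>a + t *\<^sub>R b\<close> with exponent \<open>j + 1\<close> and compare the coefficients
  of \<open>t\<close>, which contain \<open>(a \<bullet> x) ^ j * (b \<bullet> x)\<close>.\<close>

lemma linear_product_from_powers:
  fixes L L' :: "(real ^ 'n::finite \<Rightarrow> real) \<Rightarrow> real"
  assumes lin: "\<And>f c n. (\<And>i. continuous_on UNIV (f i)) \<Longrightarrow> L (\<lambda>x. \<Sum>i\<le>n. c i * f i x) = (\<Sum>i\<le>(n::nat). c i * L (f i))"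
    and lin': "\<And>f c n. (\<And>i. continuous_on UNIV (f i)) \<Longrightarrow> L' (\<lambda>x. \<Sum>i\<le>n. c i * f i x) = (\<Sum>i\<le>(n::nat). c i * L' (f i))"
    and pow: "\<And>a j. L (\<lambda>x. (a \<bullet> x) ^ j) = K j * L' (\<lambda>x. (a \<bullet> x) ^ j)"
  shows "L (\<lambda>x. (a \<bullet> x) ^ j * (\<Prod>b\<leftarrow>bs. b \<bullet> x)) = K (j + length bs) * L' (\<lambda>x. (a \<bullet> x) ^ j * (\<Prod>b\<leftarrow>bs. b \<bullet> x))"
proof (induction bs arbitrary: a j)
  case Nil
  then show ?case using pow by simp
next
  case (Cons b bs)
  let ?P = "\<lambda>x. \<Prod>b\<leftarrow>bs. b \<bullet> x"
  let ?f = "\<lambda>i x. (a \<bullet> x) ^ (Suc j - i) * (b \<bullet> x) ^ i * ?P x"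
  have cP: "continuous_on UNIV ?P" by (induction bs) (auto intro!: continuous_intros)
  have cf: "continuous_on UNIV (?f i)" for i by (intro continuous_intros cP)
  have exp: "((a + t *\<^sub>R b) \<bullet> x) ^ Suc j * ?P x = (\<Sum>i\<le>Suc j. (real (Suc j choose i) * t ^ i) * ?f i x)" for t x
  proof -
    have "((a + t *\<^sub>R b) \<bullet> x) ^ Suc j = (t * (b \<bullet> x) + a \<bullet> x) ^ Suc j"
      by (simp add: inner_add_left add.commute)
    also have "\<dots> = (\<Sum>i\<le>Suc j. real (Suc j choose i) * (t * (b \<bullet> x)) ^ i * (a \<bullet> x) ^ (Suc j - i))"
      by (rule binomial_ring)
    finally show ?thesis by (simp only: sum_distrib_right power_mult_distrib) (simp add: mult_ac)
  qed
  have "(\<Sum>i\<le>Suc j. (real (Suc j choose i) * L (?f i)) * t ^ i)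
      = (\<Sum>i\<le>Suc j. (K (Suc j + length bs) * (real (Suc j choose i) * L' (?f i))) * t ^ i)" for t
  proof -
    have "(\<Sum>i\<le>Suc j. (real (Suc j choose i) * L (?f i)) * t ^ i) = L (\<lambda>x. ((a + t *\<^sub>R b) \<bullet> x) ^ Suc j * ?P x)"
      unfolding exp by (subst lin[OF cf]) (simp add: mult_ac)
    also have "\<dots> = K (Suc j + length bs) * L' (\<lambda>x. ((a + t *\<^sub>R b) \<bullet> x) ^ Suc j * ?P x)"
      by (rule Cons.IH)
    also have "\<dots> = (\<Sum>i\<le>Suc j. (K (Suc j + length bs) * (real (Suc j choose i) * L' (?f i))) * t ^ i)"
      unfolding exp by (subst lin'[OF cf]) (simp only: sum_distrib_left mult_ac)
    finally show ?thesis .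
  qed
  then have "\<forall>i\<le>Suc j. real (Suc j choose i) * L (?f i) = K (Suc j + length bs) * (real (Suc j choose i) * L' (?f i))"
    by (intro polyfun_eq_coeffs[THEN iffD1] allI)
  then have "real (Suc j choose 1) * L (?f 1) = K (Suc j + length bs) * (real (Suc j choose 1) * L' (?f 1))"
    by (rule allE[of _ 1]) simp
  then have "L (?f 1) = K (Suc j + length bs) * L' (?f 1)" by (simp del: of_nat_Suc)
  moreover have "?f 1 = (\<lambda>x. (a \<bullet> x) ^ j * (\<Prod>b\<leftarrow>b # bs. b \<bullet> x))" by (simp add: mult.assoc)
  ultimately show ?case by simp
qed

lemma monomial_as_linear_product:
  "\<exists>bs. length bs = (sum \<alpha> UNIV) \<and> (\<forall>x :: real ^ 'n::finite. (\<Prod>b\<leftarrow>bs. b \<bullet> x) = monomial \<alpha> x)"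
proof -
  have "\<exists>bs. length bs = (\<Sum>i\<in>F. \<alpha> i) \<and> (\<forall>x :: real ^ 'n. (\<Prod>b\<leftarrow>bs. b \<bullet> x) = (\<Prod>i\<in>F. (x $ i) ^ \<alpha> i))"
    if "finite F" for F
    using that
  proof (induction F rule: finite_induct)
    case empty
    then show ?case by simp
  next
    case (insert i F)
    then obtain bs where bs: "length bs = (\<Sum>i\<in>F. \<alpha> i)"
      "\<And>x :: real ^ 'n. (\<Prod>b\<leftarrow>bs. b \<bullet> x) = (\<Prod>i\<in>F. (x $ i) ^ \<alpha> i)" by blast
    have "(\<Prod>b\<leftarrow>replicate k (axis i 1). b \<bullet> x) = (x $ i) ^ k" for k and x :: "real ^ 'n"
      by (induction k) (auto simp: inner_axis' )
    then show ?case using insert(1,2) bs by (intro exI[of _ "replicate (\<alpha> i) (axis i 1) @ bs"]) auto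
  qed
  from this[of UNIV] show ?thesis by (simp add: monomial_def)
qed

lemma monomial_from_powers:
  fixes L L' :: "(real ^ 'n::finite \<Rightarrow> real) \<Rightarrow> real"
  assumes lin: "\<And>f c n. (\<And>i. continuous_on UNIV (f i)) \<Longrightarrow> L (\<lambda>x. \<Sum>i\<le>n. c i * f i x) = (\<Sum>i\<le>(n::nat). c i * L (f i))"
    and lin': "\<And>f c n. (\<And>i. continuous_on UNIV (f i)) \<Longrightarrow> L' (\<lambda>x. \<Sum>i\<le>n. c i * f i x) = (\<Sum>i\<le>(n::nat). c i * L' (f i))"
    and pow: "\<And>a j. L (\<lambda>x. (a \<bullet> x) ^ j) = K j * L' (\<lambda>x. (a \<bullet> x) ^ j)"
  shows "L (monomial \<alpha>) = K (sum \<alpha> UNIV) * L' (monomial \<alpha>)"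
proof -
  obtain bs where bs: "length bs = (sum \<alpha> UNIV)" "\<And>x :: real ^ 'n. (\<Prod>b\<leftarrow>bs. b \<bullet> x) = monomial \<alpha> x"
    using monomial_as_linear_product by blast
  then show ?thesis
    using linear_product_from_powers[of L L' K 0 0 bs, OF lin lin' pow] by simp
qed

section \<open>The sphere\<close>

text \<open>The nearest-point map to the ball sends the boundary of the cube \<open>[-1, 1]\<close> onto the sphere and is
  Lipschitz.\<close>

lemma sphere_surface_finite: "emeasure surface (sphere 0 1 :: (real ^ 'n::finite) set) < top"
proof -
  let ?d = "CARD('n) - 1"
  let ?F = "frontier (cbox 0 1) :: (real ^ 'n) set"
  define f where "f x = closest_point (cball 0 1) (2 *\<^sub>R x - 1)" for x :: "real ^ 'n"
  have "sphere 0 1 \<subseteq> f ` ?F"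
  proof
    fix y :: "real ^ 'n" assume y: "y \<in> sphere 0 1"
    define r where "r = Max (range (\<lambda>i. \<bar>y $ i\<bar>))"
    have le: "\<bar>y $ i\<bar> \<le> r" for i unfolding r_def by (rule Max_ge) auto
    have "r \<in> range (\<lambda>i. \<bar>y $ i\<bar>)" unfolding r_def by (rule Max_in) auto
    then obtain k where k: "\<bar>y $ k\<bar> = r" by auto
    have ny: "norm y = 1" using y by simp
    have r1: "r \<le> 1" using component_le_norm_cart[of y k] k ny by simp
    have "r \<noteq> 0"
    proof
      assume "r = 0"
      then have "y = 0" using le by (simp add: vec_eq_iff)
      then show False using ny by simp
    qed
    then have r0: "0 < r" using k by (metis abs_ge_zero less_eq_real_def)
    define z where "z = (\<chi> i. (y $ i / r + 1) / 2)"
    have z2: "2 *\<^sub>R z - 1 = (1 / r) *\<^sub>R y" by (simp add: vec_eq_iff z_def add_divide_distrib)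
    have yr: "- 1 \<le> y $ i / r" "y $ i / r \<le> 1" for i
      using le[of i] r0 by (auto simp: divide_simps abs_le_iff)
    have zn: "z $ i = (y $ i / r + 1) / 2" for i by (simp add: z_def)
    have half: "0 \<le> (q + 1) / 2 \<and> (q + 1) / 2 \<le> 1" if "- 1 \<le> q" "q \<le> 1" for q :: real
      using that by simp
    have zc: "0 \<le> z $ i \<and> z $ i \<le> 1" for i unfolding zn by (rule half[OF yr])
    have "y $ k / r = 1 \<or> y $ k / r = - 1" using k r0 by (auto simp: abs_if divide_simps split: if_splits)
    then have "z $ k = 1 \<or> z $ k = 0" by (auto simp: z_def)
    then have zF: "z \<in> ?F" unfolding frontier_cube facet_def mem_cbox_01 using zc by blast
    have "y = closest_point (cball 0 1) ((1 / r) *\<^sub>R y)"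
    proof (rule closest_point_unique)
      show "\<forall>z\<in>cball 0 1. dist ((1 / r) *\<^sub>R y) y \<le> dist ((1 / r) *\<^sub>R y) z"
      proof
        fix z :: "real ^ 'n" assume "z \<in> cball 0 1"
        have "dist ((1 / r) *\<^sub>R y) y = norm ((1 / r - 1) *\<^sub>R y)"
          by (simp add: dist_norm scaleR_diff_left)
        also have "\<dots> = 1 / r - 1" using r0 r1 ny by simp
        also have "\<dots> \<le> norm ((1 / r) *\<^sub>R y) - norm z" using \<open>z \<in> _\<close> ny r0 by simp
        also have "\<dots> \<le> dist ((1 / r) *\<^sub>R y) z" unfolding dist_norm by (rule norm_triangle_ineq2)
        finally show "dist ((1 / r) *\<^sub>R y) y \<le> dist ((1 / r) *\<^sub>R y) z" .
      qed
    qed (use ny in auto)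
    then have "y = f z" unfolding f_def z2 .
    then show "y \<in> f ` ?F" using zF by blast
  qed
  then have "hausdorff_outer ?d (sphere 0 1 :: (real ^ 'n) set) \<le> hausdorff_outer ?d (f ` ?F)"
    by (rule hausdorff_outer_mono)
  also have "\<dots> \<le> ennreal (2 ^ ?d) * hausdorff_outer ?d ?F"
  proof (rule hausdorff_outer_lipschitz_image)
    fix x y :: "real ^ 'n"
    have "dist (f x) (f y) \<le> dist (2 *\<^sub>R x - 1) (2 *\<^sub>R y - 1)"
      unfolding f_def by (rule closest_point_lipschitz) auto
    also have "\<dots> = 2 * dist x y" by (simp add: dist_norm scaleR_diff_right[symmetric])
    finally show "dist (f x) (f y) \<le> 2 * dist x y" .
  qed simp
  also have "\<dots> < top"
  proof -
    have "emeasure surface ?F \<le> (\<Sum>i\<in>UNIV. emeasure surface (facet i 0 \<union> facet i 1 :: (real ^ 'n) set))"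
      unfolding frontier_cube by (rule emeasure_subadditive_finite) auto
    also have "\<dots> \<le> (\<Sum>i\<in>UNIV. emeasure surface (facet i 0 :: (real ^ 'n) set) + emeasure surface (facet i 1 :: (real ^ 'n) set))"
      by (intro sum_mono emeasure_subadditive) auto
    also have "\<dots> < top"
      using hausdorff_facet_finite[where 'n = 'n] by (simp add: emeasure_hausdorff)
    finally have "hausdorff_outer ?d ?F < top" by (simp add: emeasure_hausdorff borel_closed)
    then show ?thesis by (simp add: ennreal_mult_less_top)
  qed
  finally show ?thesis by (simp add: emeasure_hausdorff borel_closed)
qed

text \<open>Orthogonal projection, scaled by \<open>CARD('n)\<close>, is Lipschitz and maps the sphere onto a set that contains
  a facet.\<close>

lemma sphere_surface_pos: "0 < measure surface (sphere 0 1 :: (real ^ 'n::finite) set)"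
proof -
  let ?d = "CARD('n) - 1"
  let ?N = "real CARD('n)"
  fix i :: 'n
  have N: "1 \<le> ?N" by (simp add: Suc_le_eq)
  define f where "f x = slice i 0 (?N *\<^sub>R x)" for x :: "real ^ 'n"
  have "facet i 0 \<subseteq> f ` sphere 0 1"
  proof
    fix y assume y: "y \<in> facet i 0"
    define s where "s = (\<Sum>j\<in>UNIV. (y $ j / ?N)\<^sup>2)"
    have "s \<le> (\<Sum>j\<in>(UNIV :: 'n set). 1 / ?N)"
      unfolding s_def
    proof (rule sum_mono)
      fix j
      have "0 \<le> y $ j" "y $ j \<le> 1" using y by (auto simp: facet_def mem_cbox_01)
      then have "(y $ j / ?N)\<^sup>2 \<le> (1 / ?N)\<^sup>2" using N by (intro power_mono divide_right_mono) auto
      also have "\<dots> \<le> 1 / ?N" using N by (simp add: power2_eq_square divide_simps)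
      finally show "(y $ j / ?N)\<^sup>2 \<le> 1 / ?N" .
    qed
    then have s1: "s \<le> 1" by simp
    define x where "x = (\<chi> j. if j = i then sqrt (1 - s) else y $ j / ?N)"
    have "(\<Sum>j\<in>UNIV. (x $ j)\<^sup>2) = (x $ i)\<^sup>2 + (\<Sum>j\<in>UNIV - {i}. (x $ j)\<^sup>2)"
      by (rule sum.remove) auto
    also have "(\<Sum>j\<in>UNIV - {i}. (x $ j)\<^sup>2) = (\<Sum>j\<in>UNIV - {i}. (y $ j / ?N)\<^sup>2)"
      by (rule sum.cong) (auto simp: x_def)
    also have "\<dots> = s" unfolding s_def
      using y sum.remove[of UNIV i "\<lambda>j. (y $ j / ?N)\<^sup>2"] by (simp add: facet_def)
    finally have "norm x = 1" using s1 by (simp add: norm_vec_def L2_set_def x_def)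
    moreover have "y = f x" using y by (auto simp: vec_eq_iff f_def x_def facet_def)
    ultimately show "y \<in> f ` sphere 0 1" by auto
  qed
  then have "hausdorff_outer ?d (facet i 0) \<le> hausdorff_outer ?d (f ` sphere 0 1)"
    by (rule hausdorff_outer_mono)
  also have "\<dots> \<le> ennreal (?N ^ ?d) * hausdorff_outer ?d (sphere 0 1 :: (real ^ 'n) set)"
  proof (rule hausdorff_outer_lipschitz_image)
    show "dist (f x) (f y) \<le> ?N * dist x y" for x y
      by (intro dist_vec_le) (auto simp: f_def abs_mult right_diff_distrib[symmetric])
  qed (use N in simp)
  finally have "hausdorff_outer ?d (sphere 0 1 :: (real ^ 'n) set) \<noteq> 0"
    using hausdorff_facet_pos[of 0 i] by auto
  then show ?thesis
    using sphere_surface_finite[where 'n = 'n]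
    by (simp add: measure_def emeasure_hausdorff borel_closed enn2real_positive_iff zero_less_iff_neq_zero)
qed

section \<open>Moments of the ball\<close>

lemma lborel_integral_affine:
  fixes f :: "'a::euclidean_space \<Rightarrow> real"
  assumes [measurable]: "f \<in> borel_measurable borel" and "c \<noteq> 0"
  shows "(LINT x|lborel. f x) = \<bar>c\<bar> ^ DIM('a) * (LINT x|lborel. f (c *\<^sub>R x))"
  by (subst lborel_affine[OF assms(2), of 0], subst integral_density)
     (simp_all add: integral_distr)

text \<open>Scaling gives \<open>(1 - s ^ (D + j)) * R j\<close> for the integral over the shell \<open>s < norm x \<le> 1\<close>. On the shell
  the integrand lies between \<open>s ^ j\<close> and \<open>1\<close>; dividing by \<open>1 - s\<close> and letting \<open>s\<close> tend to \<open>1\<close> determines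
  \<open>R j\<close>.\<close>

lemma ball_norm_moment:
  "(LINT x:cball 0 1|lborel. norm (x :: real ^ 'n::finite) ^ j)
    = measure lborel (cball 0 1 :: (real ^ 'n) set) * (real CARD('n) / real (CARD('n) + j))"
proof -
  let ?D = "CARD('n)" and ?B = "\<lambda>s. cball 0 s :: (real ^ 'n) set"
  define V where "V = measure lborel (?B 1)"
  define R where "R k = (LINT x:?B 1|lborel. norm (x :: real ^ 'n) ^ k)" for k
  have scale: "(LINT x:?B s|lborel. norm x ^ k) = s ^ (?D + k) * R k" if "0 < s" for s k
  proof -
    have "(LINT x:?B s|lborel. norm x ^ k) = \<bar>s\<bar> ^ DIM(real ^ 'n) *
        (LINT x|lborel. indicator (?B s) (s *\<^sub>R x) *\<^sub>R norm (s *\<^sub>R x) ^ k)"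
      unfolding set_lebesgue_integral_def using that
      by (intro lborel_integral_affine borel_measurable_scaleR borel_measurable_indicator borel_closed closed_cball
          borel_measurable_continuous_onI continuous_intros) simp
    also have "(LINT x|lborel. indicator (?B s) (s *\<^sub>R x) *\<^sub>R norm (s *\<^sub>R x) ^ k) = (LINT x|lborel. s ^ k * (indicator (?B 1) x *\<^sub>R norm x ^ k))"
      using that by (intro Bochner_Integration.integral_cong)
        (auto simp: indicator_def power_mult_distrib)
    finally show ?thesis using that
      by (simp add: R_def set_lebesgue_integral_def power_add)
  qed
  have int: "set_integrable lborel S (\<lambda>x. norm x ^ k)" if "S \<subseteq> ?B 1" "S \<in> sets borel" for S k
  proof -
    have "set_integrable lborel (?B 1) (\<lambda>x. norm x ^ k)"
      by (rule set_integrable_compact[OF _ compact_cball emeasure_lborel_cball_finite]) (auto intro!: continuous_intros)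
    then show ?thesis by (rule set_integrable_subset) (use that in auto)
  qed
  have bound: "s ^ j * (V * (\<Sum>i<?D. s ^ i)) \<le> R j * (\<Sum>i<?D + j. s ^ i) \<and> R j * (\<Sum>i<?D + j. s ^ i) \<le> V * (\<Sum>i<?D. s ^ i)"
    if s: "0 < s" "s < 1" for s
  proof -
    let ?A = "?B 1 - ?B s"
    have A: "?A \<subseteq> ?B 1" "?A \<in> sets borel" by (blast, intro sets.Diff borel_closed closed_cball)
    have un: "?B 1 = ?A \<union> ?B s" using s by auto
    have split: "(LINT x:?A|lborel. norm x ^ k) = R k - s ^ (?D + k) * R k" for k
    proof -
      have "R k = (LINT x:?A|lborel. norm x ^ k) + (LINT x:?B s|lborel. norm x ^ k)"
        unfolding R_def by (subst un, rule set_integral_Un[OF _ int[OF A] int]) (use s in \<open>auto intro: borel_closed\<close>)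
      then show ?thesis using scale[OF s(1), of k] by simp
    qed
    have R0: "R 0 = V" unfolding R_def V_def using s
      by (simp add: set_lebesgue_integral_def) 
    have vol: "(LINT x:?A|lborel. c) = c * ((1 - s ^ ?D) * V)" for c
    proof -
      have "(LINT x:?A|lborel. c) = c * (LINT x:?A|lborel. norm x ^ 0)"
        by (simp add: set_lebesgue_integral_def)
      then show ?thesis unfolding split using R0 by (simp add: algebra_simps)
    qed
    have ic: "set_integrable lborel ?A (\<lambda>_. c)" for c :: real
      using set_integrable_mult_right[of c, OF int[OF A, of 0]] by simp
    have lo: "(LINT x:?A|lborel. s ^ j) \<le> (LINT x:?A|lborel. norm x ^ j)"
      by (rule set_integral_mono[OF ic int[OF A]]) (use s in \<open>auto intro!: power_mono\<close>)
    have hi: "(LINT x:?A|lborel. norm x ^ j) \<le> (LINT x:?A|lborel. 1)"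
      by (rule set_integral_mono[OF int[OF A] ic]) (auto intro!: power_le_one)
    have geom: "1 - s ^ m = (1 - s) * (\<Sum>i<m. s ^ i)" for m
      by (rule one_diff_power_eq)
    have shell: "R j - s ^ (?D + j) * R j = (1 - s) * (R j * (\<Sum>i<?D + j. s ^ i))"
    proof -
      have "R j - s ^ (?D + j) * R j = (1 - s ^ (?D + j)) * R j" by (simp add: left_diff_distrib)
      then show ?thesis unfolding geom by (simp only: mult_ac)
    qed
    have "(1 - s) * (s ^ j * (V * (\<Sum>i<?D. s ^ i))) \<le> (1 - s) * (R j * (\<Sum>i<?D + j. s ^ i))"
      "(1 - s) * (R j * (\<Sum>i<?D + j. s ^ i)) \<le> (1 - s) * (V * (\<Sum>i<?D. s ^ i))"
      using lo hi unfolding vol split shell geom[of ?D] by (simp_all only: mult_ac mult_1)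
    then show ?thesis using s by simp
  qed
  have lim: "((\<lambda>s. g s) \<longlongrightarrow> g 1) (at_left 1)" if "continuous_on UNIV g" for g :: "real \<Rightarrow> real"
    using that by (metis UNIV_I continuous_on_def filterlim_at_split filterlim_at_within_not_equal
        at_le subset_UNIV tendsto_mono)
  have ev: "\<forall>\<^sub>F s in at_left (1 :: real). 0 < s \<and> s < 1"
    by (rule eventually_at_leftI[of 0]) auto
  have c1: "continuous_on UNIV (\<lambda>s. s ^ j * (V * (\<Sum>i<?D. s ^ i)))" "continuous_on UNIV (\<lambda>s. R j * (\<Sum>i<?D + j. s ^ i))"
    "continuous_on UNIV (\<lambda>s. V * (\<Sum>i<?D. s ^ i))" by (intro continuous_intros)+
  have "\<forall>\<^sub>F s in at_left 1. s ^ j * (V * (\<Sum>i<?D. s ^ i)) \<le> R j * (\<Sum>i<?D + j. s ^ i)"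
    using ev by eventually_elim (use bound in blast)
  from tendsto_le[OF trivial_limit_at_left_real lim[OF c1(2)] lim[OF c1(1)] this]
  have "V * real ?D \<le> R j * real (?D + j)" by simp
  moreover have "\<forall>\<^sub>F s in at_left 1. R j * (\<Sum>i<?D + j. s ^ i) \<le> V * (\<Sum>i<?D. s ^ i)"
    using ev by eventually_elim (use bound in blast)
  from tendsto_le[OF trivial_limit_at_left_real lim[OF c1(3)] lim[OF c1(2)] this]
  have "R j * real (?D + j) \<le> V * real ?D" by simp
  ultimately have "R j * real (?D + j) = V * real ?D" by simp
  moreover have "real (?D + j) \<noteq> 0" unfolding of_nat_eq_0_iff by simp
  ultimately have "R j = V * real ?D / real (?D + j)" by (metis nonzero_mult_div_cancel_right)
  then show ?thesis by (simp add: R_def V_def)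
qed

lemma reflect_mem_sphere: "reflect w x \<in> sphere 0 r \<longleftrightarrow> x \<in> sphere 0 r"
  by simp

lemma reflect_mem_cball: "reflect w x \<in> cball 0 r \<longleftrightarrow> x \<in> cball 0 r"
  by simp

lemma set_integral_lincomb:
  fixes f :: "'b \<Rightarrow> real ^ 'n::finite \<Rightarrow> real"
  assumes "sets M = sets borel" "compact S" "emeasure M S < \<infinity>" "\<And>i. continuous_on UNIV (f i)"
  shows "(LINT x:S|M. (\<Sum>i\<in>I. c i * f i x)) = (\<Sum>i\<in>I. c i * (LINT x:S|M. f i x))"
proof -
  have int: "integrable M (\<lambda>x. indicator S x * f i x)" for i
    using set_integrable_compact[OF assms(1-3) assms(4)[of i]] by (simp add: set_integrable_def)
  have "(LINT x:S|M. (\<Sum>i\<in>I. c i * f i x)) = (LINT x|M. (\<Sum>i\<in>I. c i * (indicator S x * f i x)))"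
    unfolding set_lebesgue_integral_def
    by (rule Bochner_Integration.integral_cong) (auto simp: sum_distrib_left mult_ac)
  also have "\<dots> = (\<Sum>i\<in>I. c i * (LINT x:S|M. f i x))"
    using int by (simp add: set_lebesgue_integral_def)
  finally show ?thesis .
qed

text \<open>Both integrals are multiples of \<open>norm a ^ j\<close>. Integrating \<open>(x \<bullet> y) ^ j\<close> over \<open>x\<close> in the ball and \<open>y\<close> in
  the sphere in both orders compares the factors.\<close>

lemma ball_sphere_power_moment:
  fixes a :: "real ^ 'n::finite"
  shows "(LINT x:cball 0 1|lborel. (a \<bullet> x) ^ j) * measure surface (sphere 0 1 :: (real ^ 'n) set)
    = measure lborel (cball 0 1 :: (real ^ 'n) set) * (real CARD('n) / real (CARD('n) + j))
      * (LINT y:sphere 0 1|surface. (a \<bullet> y) ^ j)"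
proof -
  let ?B = "cball 0 1 :: (real ^ 'n) set" and ?S = "sphere 0 1 :: (real ^ 'n) set"
  define e where "e = (axis undefined 1 :: real ^ 'n)"
  have e: "norm e = 1" by (simp add: e_def norm_axis_1)
  define b where "b = (LINT x:?B|lborel. (e \<bullet> x) ^ j)"
  define s where "s = (LINT y:?S|surface. (e \<bullet> y) ^ j)"
  have S: "?S \<in> sets borel" "?B \<in> sets borel" by (auto intro: borel_closed)
  have pb: "(LINT x:?B|lborel. (c \<bullet> x) ^ j) = norm c ^ j * b" for c
    unfolding b_def by (rule linear_power_integral[OF reflection_invariant_lborel S(2) reflect_mem_cball e])
  have ps: "(LINT y:?S|surface. (c \<bullet> y) ^ j) = norm c ^ j * s" for c
    unfolding s_def by (rule linear_power_integral[OF reflection_invariant_surface S(1) reflect_mem_sphere e])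
  define N1 where "N1 = restrict_space (lborel :: (real ^ 'n) measure) ?B"
  define N2 where "N2 = restrict_space (surface :: (real ^ 'n) measure) ?S"
  interpret N1: finite_measure N1
    using emeasure_lborel_cball_finite[of "0 :: real ^ 'n" 1]
    by (intro finite_measureI) (simp add: N1_def emeasure_restrict_space S space_restrict_space less_top)
  interpret N2: finite_measure N2
    using sphere_surface_finite[where 'n = 'n]
    by (intro finite_measureI) (simp add: N2_def emeasure_restrict_space S space_restrict_space)
  interpret pair_sigma_finite N1 N2 ..
  interpret P: finite_measure "N1 \<Otimes>\<^sub>M N2" by (rule finite_measure_pair_measure[OF N2.finite_measure_axioms N1.finite_measure_axioms])
  have r1: "(LINT x|N1. f x) = (LINT x:?B|lborel. f x)" for f :: "real ^ 'n \<Rightarrow> real"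
    unfolding N1_def set_lebesgue_integral_def by (rule integral_restrict_space) (simp add: S)
  have r2: "(LINT x|N2. f x) = (LINT x:?S|surface. f x)" for f :: "real ^ 'n \<Rightarrow> real"
    unfolding N2_def set_lebesgue_integral_def by (rule integral_restrict_space) (simp add: S)
  have m1: "(\<lambda>x. x) \<in> measurable N1 borel" unfolding N1_def by (rule measurable_restrict_space1) simp
  have m2: "(\<lambda>x. x) \<in> measurable N2 borel" unfolding N2_def by (rule measurable_restrict_space1) simp
  have mf: "fst \<in> borel_measurable (N1 \<Otimes>\<^sub>M N2)" by (rule measurable_compose[OF measurable_fst m1])
  have ms: "snd \<in> borel_measurable (N1 \<Otimes>\<^sub>M N2)" by (rule measurable_compose[OF measurable_snd m2])
  have int: "integrable (N1 \<Otimes>\<^sub>M N2) (\<lambda>(x, y). (x \<bullet> y) ^ j)"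
  proof (rule P.integrable_const_bound[where B = 1])
    have "(\<lambda>z. (fst z \<bullet> snd z) ^ j) \<in> borel_measurable (N1 \<Otimes>\<^sub>M N2)"
      using mf ms by simp
    then show "(\<lambda>(x, y). (x \<bullet> y) ^ j) \<in> borel_measurable (N1 \<Otimes>\<^sub>M N2)" by (simp add: case_prod_beta)
    have "norm ((x \<bullet> y) ^ j) \<le> 1" if "x \<in> ?B" "y \<in> ?S" for x y
    proof -
      have "\<bar>x \<bullet> y\<bar> \<le> norm x * norm y" by (rule Cauchy_Schwarz_ineq2)
      also have "\<dots> \<le> 1" using that by simp
      finally show ?thesis by (simp add: power_abs power_le_one)
    qed
    then show "AE z in N1 \<Otimes>\<^sub>M N2. norm (case z of (x, y) \<Rightarrow> (x \<bullet> y) ^ j) \<le> 1"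
      by (intro AE_I2) (auto simp: space_pair_measure N1_def N2_def space_restrict_space)
  qed
  have "(LINT y|N2. LINT x|N1. (x \<bullet> y) ^ j) = (LINT x|N1. LINT y|N2. (x \<bullet> y) ^ j)"
    by (rule Fubini_integral[OF int])
  moreover have "(LINT y|N2. LINT x|N1. (x \<bullet> y) ^ j) = measure surface ?S * b"
  proof -
    have "(LINT y|N2. LINT x|N1. (x \<bullet> y) ^ j) = (LINT y:?S|surface. norm y ^ j * b)"
      unfolding r1 r2 by (subst inner_commute) (simp only: pb)
    also have "\<dots> = (LINT y:?S|surface. b)"
      by (rule set_lebesgue_integral_cong) (auto simp: S)
    finally show ?thesis by (simp add: set_lebesgue_integral_def S)
  qed
  moreover have "(LINT x|N1. LINT y|N2. (x \<bullet> y) ^ j) = measure lborel ?B * (real CARD('n) / real (CARD('n) + j)) * s"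
  proof -
    have "(LINT x|N1. LINT y|N2. (x \<bullet> y) ^ j) = (LINT x:?B|lborel. norm x ^ j * s)"
      unfolding r1 r2 by (simp only: ps)
    then show ?thesis by (simp add: ball_norm_moment)
  qed
  ultimately have "measure surface ?S * b = measure lborel ?B * (real CARD('n) / real (CARD('n) + j)) * s"
    by simp
  then have "norm a ^ j * (measure surface ?S * b) = norm a ^ j * (measure lborel ?B * (real CARD('n) / real (CARD('n) + j)) * s)"
    by (rule arg_cong)
  then show ?thesis unfolding pb ps by (simp only: mult_ac)
qed

section \<open>Polynomial functions\<close>

lemma finite_exponents: "finite {\<alpha> :: 'n::finite \<Rightarrow> nat. (sum \<alpha> UNIV) \<le> k}"
proof (rule finite_subset)
  show "{\<alpha> :: 'n \<Rightarrow> nat. (sum \<alpha> UNIV) \<le> k} \<subseteq> PiE UNIV (\<lambda>_. {..k})"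
  proof (intro subsetI PiE_I)
    fix \<alpha> :: "'n \<Rightarrow> nat" and i assume "\<alpha> \<in> {\<alpha>. (sum \<alpha> UNIV) \<le> k}"
    then have "(sum \<alpha> UNIV) \<le> k" by simp
    moreover have "\<alpha> i \<le> (sum \<alpha> UNIV)" by (rule member_le_sum) auto
    ultimately show "\<alpha> i \<in> {..k}" by simp
  qed auto
qed (intro finite_PiE, auto)

lemma poly_fun_iff:
  "poly_fun_deg_le k U \<longleftrightarrow> (\<exists>c. \<forall>x. U x = (\<Sum>\<alpha> | (sum \<alpha> UNIV) \<le> k. c \<alpha> * monomial \<alpha> x))"
  unfolding poly_fun_deg_le_def monomial_def ..

lemma poly_fun_monomial:
  assumes "(sum \<alpha> UNIV) \<le> k"
  shows "poly_fun_deg_le k (\<lambda>x. a * monomial \<alpha> x)"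
  unfolding poly_fun_iff
proof (intro exI[of _ "\<lambda>\<beta>. if \<beta> = \<alpha> then a else 0"] allI)
  fix x
  have "(\<Sum>\<beta> | (\<Sum>i\<in>UNIV. \<beta> i) \<le> k. (if \<beta> = \<alpha> then a else 0) * monomial \<beta> x)
      = (\<Sum>\<beta> | (\<Sum>i\<in>UNIV. \<beta> i) \<le> k. if \<beta> = \<alpha> then a * monomial \<alpha> x else 0)"
    by (rule sum.cong) auto
  also have "\<dots> = a * monomial \<alpha> x" using assms finite_exponents by (subst sum.delta) auto
  finally show "a * monomial \<alpha> x = (\<Sum>\<beta> | (\<Sum>i\<in>UNIV. \<beta> i) \<le> k. (if \<beta> = \<alpha> then a else 0) * monomial \<beta> x)" ..
qed

lemma poly_fun_add:
  assumes "poly_fun_deg_le k U" "poly_fun_deg_le k V"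
  shows "poly_fun_deg_le k (\<lambda>x. U x + V x)"
proof -
  obtain c d where "\<And>x. U x = (\<Sum>\<alpha> | (sum \<alpha> UNIV) \<le> k. c \<alpha> * monomial \<alpha> x)"
    "\<And>x. V x = (\<Sum>\<alpha> | (sum \<alpha> UNIV) \<le> k. d \<alpha> * monomial \<alpha> x)"
    using assms unfolding poly_fun_iff by blast
  then show ?thesis unfolding poly_fun_iff
    by (intro exI[of _ "\<lambda>\<alpha>. c \<alpha> + d \<alpha>"]) (simp add: sum.distrib distrib_right)
qed

lemma poly_fun_const: "poly_fun_deg_le k (\<lambda>x. a)"
  using poly_fun_monomial[of "\<lambda>_. 0" k a] by (simp add: monomial_def)

lemma poly_fun_sum: "(\<And>i. i \<in> I \<Longrightarrow> poly_fun_deg_le k (f i)) \<Longrightarrow> poly_fun_deg_le k (\<lambda>x. \<Sum>i\<in>I. f i x)"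
  by (induction I rule: infinite_finite_induct) (auto intro: poly_fun_const poly_fun_add)

lemma poly_fun_mono:
  assumes "poly_fun_deg_le k U" "k \<le> l"
  shows "poly_fun_deg_le l U"
proof -
  obtain c where "\<And>x. U x = (\<Sum>\<alpha> | (sum \<alpha> UNIV) \<le> k. c \<alpha> * monomial \<alpha> x)"
    using assms unfolding poly_fun_iff by blast
  then have "U = (\<lambda>x. \<Sum>\<alpha> | (sum \<alpha> UNIV) \<le> k. c \<alpha> * monomial \<alpha> x)" by blast
  then show ?thesis using assms(2) by (auto intro!: poly_fun_sum poly_fun_monomial)
qed

lemma monomial_mult: "monomial \<alpha> x * monomial \<beta> x = monomial (\<lambda>i. \<alpha> i + \<beta> i) x"
  by (simp add: monomial_def power_add prod.distrib)

lemma poly_fun_mult: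
  assumes "poly_fun_deg_le k U" "poly_fun_deg_le l V"
  shows "poly_fun_deg_le (k + l) (\<lambda>x. U x * V x)"
proof -
  obtain c d where cd: "\<And>x. U x = (\<Sum>\<alpha> | (sum \<alpha> UNIV) \<le> k. c \<alpha> * monomial \<alpha> x)"
    "\<And>x. V x = (\<Sum>\<alpha> | (sum \<alpha> UNIV) \<le> l. d \<alpha> * monomial \<alpha> x)"
    using assms unfolding poly_fun_iff by blast
  have eq: "(\<lambda>x. U x * V x) = (\<lambda>x. \<Sum>\<alpha> | (sum \<alpha> UNIV) \<le> k. \<Sum>\<beta> | (\<Sum>i\<in>UNIV. \<beta> i) \<le> l.
      (c \<alpha> * d \<beta>) * monomial (\<lambda>i. \<alpha> i + \<beta> i) x)"
    unfolding cd sum_product monomial_mult[symmetric] by (simp add: mult_ac)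
  show ?thesis unfolding eq
    by (intro poly_fun_sum poly_fun_monomial) (auto simp: sum.distrib intro: add_mono)
qed

lemma poly_fun_cmult: "poly_fun_deg_le k U \<Longrightarrow> poly_fun_deg_le k (\<lambda>x. a * U x)"
  using poly_fun_mult[OF poly_fun_const[of 0 a], of k U] by simp

lemma poly_fun_power: "poly_fun_deg_le k U \<Longrightarrow> poly_fun_deg_le (k * m) (\<lambda>x. U x ^ m)"
proof (induction m)
  case (Suc m)
  then show ?case using poly_fun_mult[of k U "k * m" "\<lambda>x. U x ^ m"] by simp
qed (auto intro: poly_fun_const)

lemma poly_fun_prod:
  "finite I \<Longrightarrow> (\<And>i. i \<in> I \<Longrightarrow> poly_fun_deg_le (d i) (f i)) \<Longrightarrow> poly_fun_deg_le (\<Sum>i\<in>I. d i) (\<lambda>x. \<Prod>i\<in>I. f i x)"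
  by (induction I rule: finite_induct) (auto intro: poly_fun_const poly_fun_mult)

lemma poly_fun_coord:
  fixes i :: "'n::finite"
  shows "poly_fun_deg_le 1 (\<lambda>x. x $ i + a)"
proof -
  have "monomial (\<lambda>j. if j = i then 1 else 0) x = x $ i" for x :: "real ^ 'n"
    unfolding monomial_def by (subst prod.remove[of UNIV i]) (auto intro!: prod.neutral)
  moreover have "poly_fun_deg_le 1 (\<lambda>x. 1 * monomial (\<lambda>j. if j = i then 1 else 0) (x :: real ^ 'n))"
    by (rule poly_fun_monomial) simp
  ultimately show ?thesis using poly_fun_add[OF _ poly_fun_const] by fastforce
qed

lemma poly_fun_translate:
  assumes "poly_fun_deg_le k U"
  shows "poly_fun_deg_le k (\<lambda>x. U (x + z))"
proof -
  obtain c where c: "\<And>x. U x = (\<Sum>\<alpha> | (sum \<alpha> UNIV) \<le> k. c \<alpha> * monomial \<alpha> x)"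
    using assms unfolding poly_fun_iff by blast
  have "poly_fun_deg_le k (\<lambda>x. monomial \<alpha> (x + z))" if "(sum \<alpha> UNIV) \<le> k" for \<alpha>
  proof -
    have "poly_fun_deg_le (\<Sum>i\<in>UNIV. 1 * \<alpha> i) (\<lambda>x. \<Prod>i\<in>UNIV. (x $ i + z $ i) ^ \<alpha> i)"
      by (intro poly_fun_prod poly_fun_power poly_fun_coord) simp
    then show ?thesis using that by (auto simp: monomial_def intro: poly_fun_mono)
  qed
  then show ?thesis unfolding c by (intro poly_fun_sum poly_fun_cmult) auto
qed

lemma poly_fun_inner_self: "poly_fun_deg_le 2 (\<lambda>x :: real ^ 'n::finite. (x - z) \<bullet> (x - z))"
proof -
  have "poly_fun_deg_le (1 + 1) (\<lambda>x :: real ^ 'n. \<Sum>i\<in>UNIV. (x $ i + - z $ i) * (x $ i + - z $ i))"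
    by (intro poly_fun_sum poly_fun_mult poly_fun_coord)
  then show ?thesis by (simp add: inner_vec_def numeral_2_eq_2)
qed

lemma poly_fun_poly_compose:
  assumes "degree q \<le> n" "poly_fun_deg_le d U"
  shows "poly_fun_deg_le (d * n) (\<lambda>x. poly q (U x))"
  unfolding poly_altdef
  by (intro poly_fun_sum poly_fun_cmult poly_fun_mono[OF poly_fun_power[OF assms(2)]])
     (use assms(1) in auto)

lemma continuous_on_poly_fun: "poly_fun_deg_le k U \<Longrightarrow> continuous_on S U"
proof -
  assume "poly_fun_deg_le k U"
  then obtain c where "\<And>x. U x = (\<Sum>\<alpha> | (sum \<alpha> UNIV) \<le> k. c \<alpha> * monomial \<alpha> x)"
    unfolding poly_fun_iff by blast
  then have "U = (\<lambda>x. \<Sum>\<alpha> | (sum \<alpha> UNIV) \<le> k. c \<alpha> * monomial \<alpha> x)" by blast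
  then show ?thesis by (simp only:) (intro continuous_intros)
qed

lemma poly_eq_on_unit_interval:
  fixes p q :: "real poly"
  assumes "\<And>r. 0 \<le> r \<Longrightarrow> r \<le> 1 \<Longrightarrow> poly p (r\<^sup>2) = poly q (r\<^sup>2)"
  shows "p = q"
proof -
  have "{0..1} \<subseteq> {s. poly (p - q) s = 0}"
  proof
    fix s :: real assume "s \<in> {0..1}"
    then show "s \<in> {s. poly (p - q) s = 0}" using assms[of "sqrt s"] by auto
  qed
  moreover have "infinite {0..1 :: real}" by (simp add: infinite_Icc)
  ultimately have "p - q = 0" using poly_roots_finite[of "p - q"] infinite_super by blast
  then show ?thesis by simp
qed

section \<open>Cells with radial moments\<close>

text \<open>The properties of ball and cube that the extremal problem depends on. The moment identity
  \<open>cell_moment\<close> says that \<open>K\<close> is filled by cones of equal height over its boundary, tested on monomials about the centre \<open>z\<close>.\<close>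

locale radial_cell =
  fixes K :: "(real ^ 'n::finite) set" and z :: "real ^ 'n"
  assumes compact_cell: "compact K"
    and volume_pos: "0 < measure lborel K"
    and area_pos: "0 < measure surface (frontier K)"
    and starlike_frontier: "\<And>y r. y \<in> frontier K \<Longrightarrow> 0 \<le> r \<Longrightarrow> r \<le> 1 \<Longrightarrow> z + r *\<^sub>R (y - z) \<in> K"
    and cell_moment: "\<And>\<alpha>. cell_average K (\<lambda>x. monomial \<alpha> (x - z))
      = real CARD('n) / real (CARD('n) + (sum \<alpha> UNIV)) * boundary_average K (\<lambda>x. monomial \<alpha> (x - z))"
    and odd_moment: "\<And>\<alpha>. odd (sum \<alpha> UNIV) \<Longrightarrow> boundary_average K (\<lambda>x. monomial \<alpha> (x - z)) = 0"
begin

abbreviation "C \<equiv> cell_average K"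
abbreviation "B \<equiv> boundary_average K"

lemma area_finite: "emeasure surface (frontier K) < \<infinity>"
proof (rule ccontr)
  assume "\<not> emeasure surface (frontier K) < \<infinity>"
  then have "measure surface (frontier K) = 0" by (simp add: measure_def less_top[symmetric])
  then show False using area_pos by simp
qed

lemma volume_finite: "emeasure lborel K < \<infinity>"
  using emeasure_compact_finite[OF compact_cell] .

lemma compact_frontier_cell: "compact (frontier K)"
  by (rule compact_frontier[OF compact_cell])

lemma B_sum: "(\<And>i. continuous_on UNIV (f i)) \<Longrightarrow> B (\<lambda>x. \<Sum>i\<in>I. c i * f i x) = (\<Sum>i\<in>I. c i * B (f i))"
  unfolding boundary_average_def average_def
  by (subst set_integral_lincomb[OF sets_hausdorff compact_frontier_cell area_finite])
     (auto simp: sum_divide_distrib)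

lemma C_sum: "(\<And>i. continuous_on UNIV (f i)) \<Longrightarrow> C (\<lambda>x. \<Sum>i\<in>I. c i * f i x) = (\<Sum>i\<in>I. c i * C (f i))"
  unfolding cell_average_def average_def
  by (subst set_integral_lincomb[OF sets_lborel compact_cell volume_finite])
     (auto simp: sum_divide_distrib)

lemma B_mono:
  assumes "continuous_on UNIV f" "continuous_on UNIV g" "\<And>y. y \<in> frontier K \<Longrightarrow> f y \<le> g y"
  shows "B f \<le> B g"
  unfolding boundary_average_def average_def
  by (intro divide_right_mono set_integral_mono set_integrable_compact[OF sets_hausdorff compact_frontier_cell area_finite] assms)
     (auto simp: assms)

lemma B_const: "B (\<lambda>_. c) = c"
  using area_pos compact_frontier_cell
  by (simp add: boundary_average_def average_def set_lebesgue_integral_def borel_compact)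

lemma C_const: "C (\<lambda>_. c) = c"
  using volume_pos compact_cell
  by (simp add: cell_average_def average_def set_lebesgue_integral_def borel_compact)

lemma B_cong: "(\<And>y. y \<in> frontier K \<Longrightarrow> f y = g y) \<Longrightarrow> B f = B g"
  unfolding boundary_average_def average_def
  by (intro arg_cong2[where f = "(/)"] set_lebesgue_integral_cong refl)
     (auto simp: borel_closed)

lemma B_nonneg: "continuous_on UNIV f \<Longrightarrow> (\<And>y. y \<in> frontier K \<Longrightarrow> 0 \<le> f y) \<Longrightarrow> 0 \<le> B f"
  using B_mono[of "\<lambda>_. 0" f] by (simp add: B_const)

text \<open>Expand \<open>U\<close> in monomials about \<open>z\<close>. Scaling by \<open>r\<close> multiplies a monomial of degree \<open>j\<close> by \<open>r ^ j\<close>, and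
  \<open>B\<close> annihilates the odd ones, so the boundary average is a polynomial in \<open>r\<^sup>2\<close>; the moment identity
  turns the coefficients into those of \<open>C U\<close>.\<close>

lemma radial_profile:
  assumes U: "poly_fun_deg_le k U"
  obtains p where "degree p \<le> k div 2" "\<And>r. B (\<lambda>y. U (z + r *\<^sub>R (y - z))) = poly p (r\<^sup>2)"
    "C U = radial_functional CARD('n) p"
proof -
  let ?A = "{\<alpha> :: 'n \<Rightarrow> nat. (sum \<alpha> UNIV) \<le> k}"
  let ?s = "\<lambda>\<alpha> :: 'n \<Rightarrow> nat. \<Sum>i\<in>UNIV. \<alpha> i"
  obtain c where c: "\<And>v. U (v + z) = (\<Sum>\<alpha>\<in>?A. c \<alpha> * monomial \<alpha> v)"
    using poly_fun_translate[OF U, of z] unfolding poly_fun_iff by blast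
  define b where "b \<alpha> = B (\<lambda>y. monomial \<alpha> (y - z))" for \<alpha>
  define p where "p = (\<Sum>\<alpha>\<in>?A. if even (?s \<alpha>) then monom (c \<alpha> * b \<alpha>) (?s \<alpha> div 2) else 0)"
  have cont: "continuous_on UNIV (\<lambda>y. monomial \<alpha> (y - z))" for \<alpha> by (intro continuous_intros)
  have mscale: "monomial \<alpha> (r *\<^sub>R v) = r ^ ?s \<alpha> * monomial \<alpha> v" for \<alpha> :: "'n \<Rightarrow> nat" and r v
    by (simp add: monomial_def power_mult_distrib prod.distrib power_sum)
  show thesis
  proof
    show "degree p \<le> k div 2" unfolding p_def
      by (intro degree_sum_le) (auto simp: finite_exponents intro: order.trans[OF degree_monom_le] div_le_mono)
    show "B (\<lambda>y. U (z + r *\<^sub>R (y - z))) = poly p (r\<^sup>2)" for r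
    proof -
      have "U (z + r *\<^sub>R (y - z)) = (\<Sum>\<alpha>\<in>?A. (c \<alpha> * r ^ ?s \<alpha>) * monomial \<alpha> (y - z))" for y
        using c[of "r *\<^sub>R (y - z)"] by (simp add: mscale add.commute mult.assoc)
      then have "B (\<lambda>y. U (z + r *\<^sub>R (y - z))) = (\<Sum>\<alpha>\<in>?A. (c \<alpha> * r ^ ?s \<alpha>) * b \<alpha>)"
        unfolding b_def by (simp only: B_sum[OF cont])
      also have "\<dots> = (\<Sum>\<alpha>\<in>?A. poly (if even (?s \<alpha>) then monom (c \<alpha> * b \<alpha>) (?s \<alpha> div 2) else 0) (r\<^sup>2))"
      proof (rule sum.cong[OF refl])
        fix \<alpha> :: "'n \<Rightarrow> nat"
        show "(c \<alpha> * r ^ ?s \<alpha>) * b \<alpha> = poly (if even (?s \<alpha>) then monom (c \<alpha> * b \<alpha>) (?s \<alpha> div 2) else 0) (r\<^sup>2)"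
        proof (cases "even (?s \<alpha>)")
          case True
          then show ?thesis by (simp add: poly_monom power_mult[symmetric])
        next
          case False
          then show ?thesis using odd_moment[OF False] by (simp add: b_def)
        qed
      qed
      finally show ?thesis by (simp add: p_def poly_sum)
    qed
    show "C U = radial_functional CARD('n) p"
    proof -
      have "U x = (\<Sum>\<alpha>\<in>?A. c \<alpha> * monomial \<alpha> (x - z))" for x using c[of "x - z"] by simp
      then have "C U = C (\<lambda>x. \<Sum>\<alpha>\<in>?A. c \<alpha> * monomial \<alpha> (x - z))" by (intro arg_cong[where f = C] ext)
      also have "\<dots> = (\<Sum>\<alpha>\<in>?A. c \<alpha> * C (\<lambda>x. monomial \<alpha> (x - z)))" by (rule C_sum[OF cont])
      also have "\<dots> = (\<Sum>\<alpha>\<in>?A. radial_functional CARD('n) (if even (?s \<alpha>) then monom (c \<alpha> * b \<alpha>) (?s \<alpha> div 2) else 0))"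
      proof (rule sum.cong[OF refl])
        fix \<alpha> :: "'n \<Rightarrow> nat"
        show "c \<alpha> * C (\<lambda>x. monomial \<alpha> (x - z)) = radial_functional CARD('n) (if even (?s \<alpha>) then monom (c \<alpha> * b \<alpha>) (?s \<alpha> div 2) else 0)"
        proof (cases "even (?s \<alpha>)")
          case True
          then have e: "2 * (?s \<alpha> div 2) = ?s \<alpha>" by simp
          have "radial_functional CARD('n) (monom (c \<alpha> * b \<alpha>) (?s \<alpha> div 2))
              = (c \<alpha> * b \<alpha>) * (real CARD('n) / real (CARD('n) + ?s \<alpha>))"
            using radial_monom[of "CARD('n)" "c \<alpha> * b \<alpha>" "?s \<alpha> div 2"] unfolding e by simp
          then show ?thesis using True cell_moment[of \<alpha>] by (simp add: b_def)
        next
          case False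
          then show ?thesis using cell_moment[of \<alpha>] odd_moment[OF False] by (simp add: radial_zero)
        qed
      qed
      also have "\<dots> = radial_functional CARD('n) p" by (simp add: p_def radial_sum)
      finally show ?thesis .
    qed
  qed
qed

lemma profile_boundary:
  assumes "\<And>r. B (\<lambda>y. U (z + r *\<^sub>R (y - z))) = poly p (r\<^sup>2)"
  shows "B U = poly p 1"
  using assms[of 1] by simp

lemma profile_nonneg:
  assumes U: "poly_fun_deg_le k U" and pos: "\<forall>x\<in>K. 0 \<le> U x"
    and p: "\<And>r. B (\<lambda>y. U (z + r *\<^sub>R (y - z))) = poly p (r\<^sup>2)" and s: "0 \<le> s" "s \<le> 1"
  shows "0 \<le> poly p s"
proof -
  have "0 \<le> B (\<lambda>y. U (z + sqrt s *\<^sub>R (y - z)))"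
  proof (rule B_nonneg)
    show "continuous_on UNIV (\<lambda>y. U (z + sqrt s *\<^sub>R (y - z)))"
      by (rule continuous_on_compose2[OF continuous_on_poly_fun[OF U, of UNIV]]) (auto intro!: continuous_intros)
    show "0 \<le> U (z + sqrt s *\<^sub>R (y - z))" if "y \<in> frontier K" for y
      using pos starlike_frontier[OF that, of "sqrt s"] s by simp
  qed
  then show ?thesis using p[of "sqrt s"] s by simp
qed

text \<open>In the quadrature rule for the radial profile all terms except the one at \<open>1\<close> are nonnegative.\<close>

lemma interior_weight_le:
  "interior_weight K k \<le> ereal (radial_weight CARD('n) (k div 2))"
  unfolding interior_weight_def
proof (rule SUP_least)
  fix U assume "U \<in> {U. poly_fun_deg_le k U \<and> (\<forall>x\<in>K. 0 \<le> U x) \<and> 0 < cell_average K U}"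
  then have U: "poly_fun_deg_le k U" "\<forall>x\<in>K. 0 \<le> U x" "0 < C U" by auto
  obtain p where p: "degree p \<le> k div 2" "\<And>r. B (\<lambda>y. U (z + r *\<^sub>R (y - z))) = poly p (r\<^sup>2)"
    "C U = radial_functional CARD('n) p"
    by (rule radial_profile[OF U(1)]) (rule that)
  have D: "CARD('n) > 0" by simp
  obtain Z and w :: "real \<Rightarrow> real" and w0 where Zw: "finite Z" "Z \<subseteq> {0<..<1}" "card Z = (k div 2) div 2"
    "\<And>z. z \<in> Z \<Longrightarrow> w z > 0" "w0 \<ge> 0" "even (k div 2) \<Longrightarrow> w0 = 0"
    "\<And>p. degree p \<le> k div 2 \<Longrightarrow> radial_functional CARD('n) p
        = poly p 1 / radial_weight CARD('n) (k div 2) + w0 * poly p 0 + (\<Sum>z\<in>Z. w z * poly p z)"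
    by (rule endpoint_quadrature[OF D, of "k div 2"]) (rule that)
  note nn = profile_nonneg[OF U(1,2) p(2)]
  have "0 \<le> w0 * poly p 0" using nn[of 0] Zw(5) by simp
  moreover have "0 \<le> (\<Sum>z\<in>Z. w z * poly p z)"
    using Zw(2,4) by (intro sum_nonneg mult_nonneg_nonneg nn) (force simp: less_imp_le)+
  ultimately have "B U / radial_weight CARD('n) (k div 2) \<le> C U"
    unfolding p(3) Zw(7)[OF p(1)] profile_boundary[OF p(2)] by simp
  then have "B U / C U \<le> radial_weight CARD('n) (k div 2)"
    using U(3) radial_weight_pos[OF D, of "k div 2"] by (simp add: divide_simps mult.commute)
  then show "ereal (B U / C U) \<le> ereal (radial_weight CARD('n) (k div 2))" by simp
qed

lemma interior_weight_eqI:
  assumes "poly_fun_deg_le k U" "\<forall>x\<in>K. 0 \<le> U x" "0 < C U"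
    "B U = radial_weight CARD('n) (k div 2) * C U"
  shows "interior_weight K k = ereal (radial_weight CARD('n) (k div 2))"
proof (rule antisym[OF interior_weight_le])
  have "ereal (B U / C U) \<le> interior_weight K k"
    unfolding interior_weight_def by (rule SUP_upper) (use assms in auto)
  then show "ereal (radial_weight CARD('n) (k div 2)) \<le> interior_weight K k"
    using assms(3,4) by simp
qed

text \<open>If all boundary points have the same distance from the centre, the radial profile of
  \<open>q (norm (x - z) ^ 2 / \<rho>)\<close> is \<open>q\<close> itself.\<close>

lemma interior_weight_round_frontier:
  assumes \<rho>: "0 < \<rho>" "\<And>y. y \<in> frontier K \<Longrightarrow> (y - z) \<bullet> (y - z) = \<rho>"
  shows "interior_weight K k = ereal (radial_weight CARD('n) (k div 2))"
proof -
  let ?n = "k div 2"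
  have D: "CARD('n) > 0" by simp
  obtain q where q: "degree q \<le> ?n" "\<And>s. 0 \<le> s \<Longrightarrow> 0 \<le> poly q s" "poly q 1 > 0"
    "radial_functional CARD('n) q = poly q 1 / radial_weight CARD('n) ?n"
    by (rule extremal_radial_polynomial[OF D, of ?n]) (rule that)
  define U where "U x = poly q (1 / \<rho> * ((x - z) \<bullet> (x - z)))" for x
  have "poly_fun_deg_le (2 * ?n) U"
    unfolding U_def by (intro poly_fun_poly_compose[OF q(1)] poly_fun_cmult poly_fun_inner_self)
  then have U: "poly_fun_deg_le k U" by (rule poly_fun_mono) simp
  obtain p where p: "degree p \<le> ?n" "\<And>r. B (\<lambda>y. U (z + r *\<^sub>R (y - z))) = poly p (r\<^sup>2)"
    "C U = radial_functional CARD('n) p"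
    by (rule radial_profile[OF U]) (rule that)
  have "poly p (r\<^sup>2) = poly q (r\<^sup>2)" for r
  proof -
    have "B (\<lambda>y. U (z + r *\<^sub>R (y - z))) = B (\<lambda>_. poly q (r\<^sup>2))"
      by (rule B_cong) (use \<rho> in \<open>simp add: U_def power2_eq_square\<close>)
    then show ?thesis using p(2)[of r] by (simp add: B_const)
  qed
  then have pq: "p = q" by (intro poly_eq_on_unit_interval)
  show ?thesis
  proof (rule interior_weight_eqI[OF U])
    show "\<forall>x\<in>K. 0 \<le> U x" using q(2) \<rho>(1) by (simp add: U_def)
    show "0 < C U" unfolding p(3) pq q(4) using q(3) radial_weight_pos[OF D] by simp
    show "B U = radial_weight CARD('n) ?n * C U"
      unfolding p(3) profile_boundary[OF p(2)] pq q(4) using radial_weight_pos[OF D, of ?n] by simp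
  qed
qed

text \<open>Here \<open>norm (x - z) ^ 2\<close> is homogeneous, so its profile is a multiple of \<open>s\<close>, which is extremal for \<open>n = 1\<close>.\<close>

lemma interior_weight_low_degree:
  assumes k: "k < 4" and \<rho>: "0 < \<rho>" "\<And>y. y \<in> frontier K \<Longrightarrow> \<rho> \<le> (y - z) \<bullet> (y - z)"
  shows "interior_weight K k = ereal (radial_weight CARD('n) (k div 2))"
proof (cases "k < 2")
  case True
  then have "k div 2 = 0" by simp
  then show ?thesis
    by (intro interior_weight_eqI[of k "\<lambda>_. 1"]) (auto simp: poly_fun_const C_const B_const radial_weight_def)
next
  case False
  with k have n: "k div 2 = 1" by presburger
  have D: "CARD('n) > 0" by simp
  define U where "U x = (x - z) \<bullet> (x - z)" for x
  have "poly_fun_deg_le 2 U" unfolding U_def by (rule poly_fun_inner_self)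
  then have U: "poly_fun_deg_le k U" by (rule poly_fun_mono) (use False in simp)
  have cU: "continuous_on UNIV U" by (rule continuous_on_poly_fun[OF U])
  obtain p where p: "degree p \<le> k div 2" "\<And>r. B (\<lambda>y. U (z + r *\<^sub>R (y - z))) = poly p (r\<^sup>2)"
    "C U = radial_functional CARD('n) p"
    by (rule radial_profile[OF U]) (rule that)
  have "poly p (r\<^sup>2) = poly (monom (B U) 1) (r\<^sup>2)" for r
  proof -
    have "B (\<lambda>y. U (z + r *\<^sub>R (y - z))) = B (\<lambda>y. \<Sum>i\<in>{()}. r\<^sup>2 * U y)"
      by (rule B_cong) (simp add: U_def power2_eq_square)
    also have "\<dots> = r\<^sup>2 * B U" using B_sum[of "\<lambda>_. U" "\<lambda>_. r\<^sup>2" "{()}"] cU by simp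
    finally show ?thesis using p(2)[of r] by (simp add: poly_monom)
  qed
  then have "p = monom (B U) 1" by (intro poly_eq_on_unit_interval)
  then have CU: "C U = B U * (real CARD('n) / real (CARD('n) + 2 * 1))"
    using p(3) radial_monom[OF D, of "B U" 1] by simp
  have "\<rho> \<le> B U" using B_mono[of "\<lambda>_. \<rho>" U] cU \<rho>(2) by (simp add: B_const U_def)
  then have BU: "0 < B U" using \<rho>(1) by simp
  show ?thesis
  proof (rule interior_weight_eqI[OF U])
    show "\<forall>x\<in>K. 0 \<le> U x" by (simp add: U_def)
    show "0 < C U" unfolding CU using BU D by (intro mult_pos_pos divide_pos_pos) auto
    show "B U = radial_weight CARD('n) (k div 2) * C U"
      unfolding CU n radial_weight_def by (simp add: add.commute)
  qed
qed

end

section \<open>Ball and cube as radial cells\<close>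

text \<open>Since \<open>a\<close> and \<open>- a\<close> have the same norm, the odd powers of linear forms integrate to \<open>0\<close>.\<close>

lemma sphere_odd_moment:
  assumes "odd (sum \<alpha> UNIV)"
  shows "(LINT y:sphere 0 1|surface. monomial \<alpha> (y :: real ^ 'n::finite)) = 0"
proof -
  let ?S = "sphere 0 1 :: (real ^ 'n) set"
  let ?L = "\<lambda>f :: real ^ 'n \<Rightarrow> real. LINT y:?S|surface. f y"
  have lin: "?L (\<lambda>x. \<Sum>i\<le>n. c i * f i x) = (\<Sum>i\<le>n. c i * ?L (f i))"
    if "\<And>i. continuous_on UNIV (f i)" for f :: "nat \<Rightarrow> real ^ 'n \<Rightarrow> real" and c n
    using sphere_surface_finite that by (intro set_integral_lincomb) auto
  have pow: "?L (\<lambda>y. (a \<bullet> y) ^ j) = (if odd j then 0 else 1) * ?L (\<lambda>y. (a \<bullet> y) ^ j)" for a j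
  proof (cases "odd j")
    case True
    have S: "?S \<in> sets borel" by (intro borel_closed closed_sphere)
    define e where "e = (axis undefined 1 :: real ^ 'n)"
    have e: "norm e = 1" by (simp add: e_def norm_axis_1)
    have eq: "?L (\<lambda>y. (c \<bullet> y) ^ j) = norm c ^ j * ?L (\<lambda>y. (e \<bullet> y) ^ j)" for c
      by (rule linear_power_integral[OF reflection_invariant_surface S reflect_mem_sphere e])
    have "?L (\<lambda>y. (a \<bullet> y) ^ j) = ?L (\<lambda>y. ((- a) \<bullet> y) ^ j)" unfolding eq[of a] eq[of "- a"] by simp
    also have "\<dots> = - ?L (\<lambda>y. (a \<bullet> y) ^ j)" using True by (simp add: set_lebesgue_integral_def)
    finally show ?thesis using True by simp
  qed simp
  from monomial_from_powers[of ?L ?L "\<lambda>j. if odd j then 0 else 1" \<alpha>, OF lin lin pow]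
  show ?thesis using assms by simp
qed

lemma ball_monomial_moment:
  "(LINT x:cball 0 1|lborel. monomial \<alpha> (x :: real ^ 'n::finite)) * measure surface (sphere 0 1 :: (real ^ 'n) set)
    = measure lborel (cball 0 1 :: (real ^ 'n) set) * (real CARD('n) / real (CARD('n) + (sum \<alpha> UNIV)))
      * (LINT y:sphere 0 1|surface. monomial \<alpha> y)"
proof -
  let ?S = "sphere 0 1 :: (real ^ 'n) set" and ?B = "cball 0 1 :: (real ^ 'n) set"
  let ?L = "\<lambda>f :: real ^ 'n \<Rightarrow> real. LINT x:?B|lborel. f x"
  let ?L' = "\<lambda>f :: real ^ 'n \<Rightarrow> real. LINT y:?S|surface. f y"
  define K where "K j = measure lborel ?B * (real CARD('n) / real (CARD('n) + j)) / measure surface ?S" for j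
  have lin: "?L (\<lambda>x. \<Sum>i\<le>n. c i * f i x) = (\<Sum>i\<le>n. c i * ?L (f i))"
    if "\<And>i. continuous_on UNIV (f i)" for f :: "nat \<Rightarrow> real ^ 'n \<Rightarrow> real" and c n
    using emeasure_lborel_cball_finite that by (intro set_integral_lincomb) auto
  have lin': "?L' (\<lambda>x. \<Sum>i\<le>n. c i * f i x) = (\<Sum>i\<le>n. c i * ?L' (f i))"
    if "\<And>i. continuous_on UNIV (f i)" for f :: "nat \<Rightarrow> real ^ 'n \<Rightarrow> real" and c n
    using sphere_surface_finite that by (intro set_integral_lincomb) auto
  have pos: "measure surface ?S \<noteq> 0" using sphere_surface_pos[where 'n = 'n] by simp
  have pow: "?L (\<lambda>x. (a \<bullet> x) ^ j) = K j * ?L' (\<lambda>x. (a \<bullet> x) ^ j)" for a j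
  proof -
    have "?L (\<lambda>x. (a \<bullet> x) ^ j) = ?L (\<lambda>x. (a \<bullet> x) ^ j) * measure surface ?S / measure surface ?S"
      using pos by simp
    then show ?thesis unfolding ball_sphere_power_moment K_def by simp
  qed
  have "?L (monomial \<alpha>) = K (sum \<alpha> UNIV) * ?L' (monomial \<alpha>)"
    by (rule monomial_from_powers[of ?L ?L' K, OF lin lin' pow])
  then show ?thesis using pos by (simp add: K_def)
qed

lemma radial_cell_ball: "radial_cell (cball 0 1 :: (real ^ 'n::finite) set) 0"
proof
  let ?B = "cball 0 1 :: (real ^ 'n) set"
  have fr: "frontier ?B = sphere 0 1" by (simp add: frontier_cball)
  have vol: "0 < measure lborel ?B" using content_cball_pos[of 1 "0 :: real ^ 'n"] by simp
  show "compact ?B" "0 < measure lborel ?B" using vol by auto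
  show "0 < measure surface (frontier ?B)" unfolding fr by (rule sphere_surface_pos)
  show "0 + r *\<^sub>R (y - 0) \<in> ?B" if "y \<in> frontier ?B" "0 \<le> r" "r \<le> 1" for y r
    using that by (simp add: fr)
  show "cell_average ?B (\<lambda>x. monomial \<alpha> (x - 0)) = real CARD('n) / real (CARD('n) + (sum \<alpha> UNIV)) *
      boundary_average ?B (\<lambda>x. monomial \<alpha> (x - 0))" for \<alpha>
  proof -
    have ratio: "a / V = q * (b / S)" if "a * S = V * q * b" "0 < V" "0 < S" for a b q S V :: real
      using that by (simp add: divide_simps mult_ac)
    show ?thesis
      unfolding cell_average_def boundary_average_def average_def fr diff_zero
      by (rule ratio[OF ball_monomial_moment vol sphere_surface_pos])
  qed
  show "boundary_average ?B (\<lambda>x. monomial \<alpha> (x - 0)) = 0" if "odd (sum \<alpha> UNIV)" for \<alpha>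
    using sphere_odd_moment[OF that] by (simp add: boundary_average_def average_def fr)
qed

abbreviation cube_center :: "real ^ 'n::finite" where
  "cube_center \<equiv> (\<chi> i. 1 / 2)"

lemma measure_cube: "measure lborel (cbox 0 (1 :: real ^ 'n::finite)) = 1"
  using emeasure_lborel_cbox_vec[of 0 "1 :: real ^ 'n"] by (simp add: measure_def)

lemma frontier_cube_area:
  fixes i :: "'n::finite"
  shows "measure surface (frontier (cbox 0 (1 :: real ^ 'n))) = 2 * measure surface (facet i 0) * real CARD('n)"
proof -
  have "measure surface (frontier (cbox 0 (1 :: real ^ 'n))) = (LINT y:frontier (cbox 0 (1 :: real ^ 'n))|surface. 1)"
    by (simp add: set_lebesgue_integral_def borel_closed)
  also have "\<dots> = measure surface (facet i 0) * (\<Sum>i\<in>(UNIV :: 'n set). (LINT x:cbox 0 (1 :: real ^ 'n)|lborel. 1) + (LINT x:cbox 0 (1 :: real ^ 'n)|lborel. 1))"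
    by (rule frontier_cube_integral) simp
  also have "(LINT x:cbox 0 (1 :: real ^ 'n)|lborel. 1) = (1 :: real)"
    by (simp add: set_lebesgue_integral_def measure_cube)
  finally show ?thesis by simp
qed

lemma cube_shrink:
  assumes "y \<in> frontier (cbox 0 (1 :: real ^ 'n::finite))" "0 \<le> r" "r \<le> 1"
  shows "cube_center + r *\<^sub>R (y - cube_center) \<in> cbox 0 1"
proof -
  have "y \<in> cbox 0 1" using assms(1) unfolding frontier_cube facet_def by blast
  moreover have "cube_center \<in> cbox 0 (1 :: real ^ 'n)" by (simp add: mem_cbox_01)
  ultimately have "(1 - r) *\<^sub>R cube_center + r *\<^sub>R y \<in> cbox 0 (1 :: real ^ 'n)"
    using assms(2,3) convex_box(1) by (intro convexD) auto
  then show ?thesis by (simp add: algebra_simps)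
qed

lemma radial_cell_cube: "radial_cell (cbox 0 1 :: (real ^ 'n::finite) set) cube_center"
proof
  let ?K = "cbox 0 1 :: (real ^ 'n) set"
  define i where "i = (undefined :: 'n)"
  define h where "h = measure surface (facet i 0)"
  have h: "0 < h" unfolding h_def by (rule facet_area_pos)
  have area: "measure surface (frontier ?K) = 2 * h * real CARD('n)"
    unfolding h_def by (rule frontier_cube_area)
  show "compact ?K" by (rule compact_cbox)
  show "0 < measure lborel ?K" by (simp only: measure_cube zero_less_one)
  show "0 < measure surface (frontier ?K)" unfolding area using h by simp
  show "cube_center + r *\<^sub>R (y - cube_center) \<in> ?K" if "y \<in> frontier ?K" "0 \<le> r" "r \<le> 1" for y r
    by (rule cube_shrink[OF that])
  have C: "cell_average ?K (\<lambda>x. monomial \<alpha> (x - cube_center)) = (\<Prod>i\<in>UNIV. interval_moment (\<alpha> i))" for \<alpha> :: "'n \<Rightarrow> nat"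
    unfolding cell_average_def average_def measure_cube cube_moment by simp
  have B: "boundary_average ?K (\<lambda>x. monomial \<alpha> (x - cube_center))
      = real (CARD('n) + (sum \<alpha> UNIV)) / real CARD('n) * (\<Prod>i\<in>UNIV. interval_moment (\<alpha> i))" for \<alpha> :: "'n \<Rightarrow> nat"
    unfolding boundary_average_def average_def area frontier_cube_moment[of \<alpha> i] h_def[symmetric]
    using h by (simp add: field_simps)
  have nz: "real (CARD('n) + m) \<noteq> 0" for m unfolding of_nat_eq_0_iff by simp
  show "cell_average ?K (\<lambda>x. monomial \<alpha> (x - cube_center)) = real CARD('n) / real (CARD('n) + (sum \<alpha> UNIV)) *
      boundary_average ?K (\<lambda>x. monomial \<alpha> (x - cube_center))" for \<alpha>
    unfolding B C using nz[of "\<Sum>i\<in>UNIV. \<alpha> i"] by (simp del: of_nat_add)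
  show "boundary_average ?K (\<lambda>x. monomial \<alpha> (x - cube_center)) = 0" if "odd (sum \<alpha> UNIV)" for \<alpha>
  proof -
    have "\<exists>i. odd (\<alpha> i)"
    proof (rule ccontr)
      assume "\<not> ?thesis"
      then have "even (sum \<alpha> UNIV)" by (intro dvd_sum) auto
      then show False using that by simp
    qed
    then obtain i where "odd (\<alpha> i)" ..
    then have "interval_moment (\<alpha> i) = 0" by (rule interval_moment_odd)
    then have "(\<Prod>i\<in>UNIV. interval_moment (\<alpha> i)) = 0" by (intro prod_zero) auto
    then show ?thesis unfolding B by simp
  qed
qed

lemma frontier_cube_distance:
  assumes "y \<in> frontier (cbox 0 (1 :: real ^ 'n::finite))"
  shows "1 / 4 \<le> (y - cube_center) \<bullet> (y - cube_center)"
    and "CARD('n) = 1 \<Longrightarrow> (y - cube_center) \<bullet> (y - cube_center) = 1 / 4"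
proof -
  obtain i where "y $ i = 0 \<or> y $ i = 1" using assms unfolding frontier_cube facet_def by blast
  then have i: "(y $ i - 1 / 2)\<^sup>2 = 1 / 4" by (auto simp: power2_eq_square)
  have s: "(y - cube_center) \<bullet> (y - cube_center) = (y $ i - 1 / 2)\<^sup>2 + (\<Sum>j\<in>UNIV - {i}. (y $ j - 1 / 2)\<^sup>2)"
    unfolding inner_vec_def by (subst sum.remove[of UNIV i]) (auto simp: power2_eq_square)
  show "1 / 4 \<le> (y - cube_center) \<bullet> (y - cube_center)"
    unfolding s i by (simp add: sum_nonneg)
  show "(y - cube_center) \<bullet> (y - cube_center) = 1 / 4" if "CARD('n) = 1"
  proof -
    have "card (UNIV - {i}) = 0" using that by (simp add: card_Diff_singleton)
    then have e: "UNIV - {i} = {}" by (subst (asm) card_0_eq) auto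
    show ?thesis unfolding s i e by (simp only: sum.empty add_0_right)
  qed
qed

lemma interior_weight_ball:
  "interior_weight (cball 0 1 :: (real ^ 'n::finite) set) k = ereal (radial_weight CARD('n) (k div 2))"
  by (rule radial_cell.interior_weight_round_frontier[OF radial_cell_ball, of 1])
     (auto simp: frontier_cball dot_square_norm)

lemma interior_weight_cube_le:
  "interior_weight (cbox 0 1 :: (real ^ 'n::finite) set) k \<le> ereal (radial_weight CARD('n) (k div 2))"
  by (rule radial_cell.interior_weight_le[OF radial_cell_cube])

lemma interior_weight_interval:
  assumes "CARD('n) = 1"
  shows "interior_weight (cbox 0 1 :: (real ^ 'n::finite) set) k = ereal (radial_weight CARD('n) (k div 2))"
  by (rule radial_cell.interior_weight_round_frontier[OF radial_cell_cube, of "1 / 4"],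
      simp, rule frontier_cube_distance(2)[OF _ assms])

lemma interior_weight_cube_low_degree:
  assumes "k < 4"
  shows "interior_weight (cbox 0 1 :: (real ^ 'n::finite) set) k = ereal (radial_weight CARD('n) (k div 2))"
  by (rule radial_cell.interior_weight_low_degree[OF radial_cell_cube assms, of "1 / 4"],
      simp, rule frontier_cube_distance(1))

section \<open>Independence of monomials and compactness in coefficient space\<close>

text \<open>Dedekind's argument for independence of characters: monomials are multiplicative under the
  coordinatewise product, and multiplying \<open>x\<close> by a vector \<open>y\<close> that distinguishes two of them eliminates
  one.\<close>

lemma monomials_independent:
  fixes c :: "('n::finite \<Rightarrow> nat) \<Rightarrow> real"
  assumes "finite A" "\<And>x :: real ^ 'n. (\<Sum>\<alpha>\<in>A. c \<alpha> * monomial \<alpha> x) = 0" "\<alpha> \<in> A"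
  shows "c \<alpha> = 0"
  using assms
proof (induction A arbitrary: c \<alpha> rule: finite_induct)
  case empty
  then show ?case by simp
next
  case (insert \<beta> A)
  have mult: "monomial \<gamma> (\<chi> i. x $ i * y $ i) = monomial \<gamma> x * monomial \<gamma> y" for \<gamma> and x y :: "real ^ 'n"
    by (simp add: monomial_def power_mult_distrib prod.distrib)
  have zero: "c \<gamma> = 0" if \<gamma>: "\<gamma> \<in> A" for \<gamma>
  proof -
    have "\<gamma> \<noteq> \<beta>" using \<gamma> insert(2) by blast
    then obtain i where i: "\<gamma> i \<noteq> \<beta> i" by (auto simp: fun_eq_iff)
    define y :: "real ^ 'n" where "y = (\<chi> j. if j = i then 2 else 1)"
    have my: "monomial \<delta> y = 2 ^ \<delta> i" for \<delta>
      unfolding monomial_def y_def by (subst prod.remove[of UNIV i]) (auto intro!: prod.neutral)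
    have "(\<Sum>\<delta>\<in>A. (c \<delta> * (monomial \<delta> y - monomial \<beta> y)) * monomial \<delta> x) = 0" for x
    proof -
      have "(\<Sum>\<delta>\<in>insert \<beta> A. c \<delta> * monomial \<delta> (\<chi> i. x $ i * y $ i))
          - monomial \<beta> y * (\<Sum>\<delta>\<in>insert \<beta> A. c \<delta> * monomial \<delta> x) = 0"
        unfolding insert.prems(1) by simp
      then have "(\<Sum>\<delta>\<in>insert \<beta> A. (c \<delta> * (monomial \<delta> y - monomial \<beta> y)) * monomial \<delta> x) = 0"
        unfolding mult sum_distrib_left sum_subtractf[symmetric] by (simp add: algebra_simps)
      then show ?thesis using insert(1,2) by simp
    qed
    from insert.IH[OF this \<gamma>] have "c \<gamma> * (2 ^ \<gamma> i - 2 ^ \<beta> i) = 0" by (simp add: my)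
    then show ?thesis using i by simp
  qed
  then have "(\<Sum>\<delta>\<in>insert \<beta> A. c \<delta> * monomial \<delta> x) = c \<beta> * monomial \<beta> x" for x
    using insert(1,2) by simp
  then have "c \<beta> * monomial \<beta> (\<chi> i. 1) = 0" using insert.prems(1) by metis
  then have "c \<beta> = 0" by (simp add: monomial_def)
  then show ?case using zero insert.prems(2) by blast
qed

lemma convergent_subsequence_on_finite:
  fixes f :: "nat \<Rightarrow> 'a \<Rightarrow> real"
  assumes "finite A" "\<And>n a. a \<in> A \<Longrightarrow> \<bar>f n a\<bar> \<le> b"
  shows "\<exists>l r. strict_mono (r :: nat \<Rightarrow> nat) \<and> (\<forall>a\<in>A. (\<lambda>n. f (r n) a) \<longlonglongrightarrow> l a)"
  using assms
proof (induction A rule: finite_induct)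
  case empty
  show ?case by (intro exI[of _ undefined] exI[of _ id]) (simp add: strict_mono_def)
next
  case (insert x A)
  then obtain l r where r: "strict_mono (r :: nat \<Rightarrow> nat)" "\<forall>a\<in>A. (\<lambda>n. f (r n) a) \<longlonglongrightarrow> l a"
    by auto
  have "bounded (range (\<lambda>n. f (r n) x))"
    unfolding bounded_iff using insert.prems by auto
  from bounded_imp_convergent_subsequence[OF this]
  obtain m s where s: "strict_mono (s :: nat \<Rightarrow> nat)" "((\<lambda>n. f (r n) x) \<circ> s) \<longlonglongrightarrow> m" by blast
  have "(\<lambda>n. f ((r \<circ> s) n) a) \<longlonglongrightarrow> (l(x := m)) a" if "a \<in> insert x A" for a
  proof (cases "a = x")
    case True
    then show ?thesis using s(2) by (simp add: o_def)
  next
    case False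
    then have "(\<lambda>n. f (r n) a) \<longlonglongrightarrow> l a" using r(2) that by simp
    from LIMSEQ_subseq_LIMSEQ[OF this s(1)] show ?thesis using False by (simp add: o_def)
  qed
  moreover have "strict_mono (r \<circ> s)" by (rule strict_mono_o[OF r(1) s(1)])
  ultimately show ?case by blast
qed

text \<open>Normalise to \<open>(\<Sum>a\<in>A. \<bar>c a\<bar>) = 1\<close>; on the resulting compact set a positive continuous functional is
  bounded away from zero.\<close>

lemma positive_functional_coercive:
  fixes \<phi> :: "'a \<Rightarrow> real"
  assumes A: "finite A"
    and closed: "\<And>f c. (\<And>n. f n \<in> S) \<Longrightarrow> (\<And>a. a \<in> A \<Longrightarrow> (\<lambda>n. f n a) \<longlonglongrightarrow> c a) \<Longrightarrow> c \<in> S"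
    and cone: "\<And>c t. c \<in> S \<Longrightarrow> 0 < t \<Longrightarrow> (\<lambda>a. t * c a) \<in> S"
    and pos: "\<And>c. c \<in> S \<Longrightarrow> (\<exists>a\<in>A. c a \<noteq> 0) \<Longrightarrow> 0 < (\<Sum>a\<in>A. c a * \<phi> a)"
  shows "\<exists>\<epsilon>>0. \<forall>c\<in>S. \<epsilon> * (\<Sum>a\<in>A. \<bar>c a\<bar>) \<le> (\<Sum>a\<in>A. c a * \<phi> a)"
proof (rule ccontr)
  assume neg: "\<not> ?thesis"
  have "\<exists>c\<in>S. (\<Sum>a\<in>A. \<bar>c a\<bar>) = 1 \<and> (\<Sum>a\<in>A. c a * \<phi> a) < 1 / real (Suc n)" for n
  proof -
    obtain c where c: "c \<in> S" "(\<Sum>a\<in>A. c a * \<phi> a) < 1 / real (Suc n) * (\<Sum>a\<in>A. \<bar>c a\<bar>)"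
      using neg by (metis not_le of_nat_0_less_iff zero_less_Suc zero_less_divide_1_iff)
    define N where "N = (\<Sum>a\<in>A. \<bar>c a\<bar>)"
    have "N \<noteq> 0"
    proof
      assume "N = 0"
      then have "\<forall>a\<in>A. c a = 0" using A by (simp add: N_def sum_nonneg_eq_0_iff)
      then show False using c(2) by simp
    qed
    then have N: "0 < N" using sum_nonneg[of A "\<lambda>a. \<bar>c a\<bar>"] by (simp add: N_def less_le)
    have "(\<Sum>a\<in>A. \<bar>1 / N * c a\<bar>) = 1 / N * N"
      unfolding N_def sum_distrib_left using N by (simp add: abs_mult N_def)
    moreover have "(\<Sum>a\<in>A. (1 / N * c a) * \<phi> a) = 1 / N * (\<Sum>a\<in>A. c a * \<phi> a)"
      unfolding sum_distrib_left by (simp add: mult.assoc)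
    moreover have "1 / N * (\<Sum>a\<in>A. c a * \<phi> a) < 1 / N * (1 / real (Suc n) * N)"
      using N c(2) unfolding N_def[symmetric] by (intro mult_strict_left_mono) auto
    moreover have "(\<lambda>a. 1 / N * c a) \<in> S" using cone[OF c(1), of "1 / N"] N by simp
    ultimately show ?thesis using N by (intro bexI[of _ "\<lambda>a. 1 / N * c a"]) auto
  qed
  then obtain f where f: "\<And>n. f n \<in> S" "\<And>n. (\<Sum>a\<in>A. \<bar>f n a\<bar>) = 1"
    "\<And>n. (\<Sum>a\<in>A. f n a * \<phi> a) < 1 / real (Suc n)" by metis
  have bnd: "\<bar>f n a\<bar> \<le> 1" if "a \<in> A" for n a
    using member_le_sum[OF that, of "\<lambda>a. \<bar>f n a\<bar>"] A f(2)[of n] by simp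
  obtain c r where r: "strict_mono (r :: nat \<Rightarrow> nat)" "\<forall>a\<in>A. (\<lambda>n. f (r n) a) \<longlonglongrightarrow> c a"
    using convergent_subsequence_on_finite[OF A, of f 1] bnd by blast
  have cS: "c \<in> S"
  proof (rule closed[of "\<lambda>n. f (r n)"])
    show "f (r n) \<in> S" for n by (rule f(1))
    show "(\<lambda>n. f (r n) a) \<longlonglongrightarrow> c a" if "a \<in> A" for a using r(2) that by (rule bspec)
  qed
  have "(\<lambda>n. \<Sum>a\<in>A. \<bar>f (r n) a\<bar>) \<longlonglongrightarrow> (\<Sum>a\<in>A. \<bar>c a\<bar>)"
    using r(2) by (intro tendsto_sum tendsto_rabs) auto
  then have "(\<Sum>a\<in>A. \<bar>c a\<bar>) = 1" unfolding f(2) by (rule LIMSEQ_unique[OF _ tendsto_const])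
  then have "\<exists>a\<in>A. c a \<noteq> 0" by (metis abs_zero sum.neutral zero_neq_one)
  then have "0 < (\<Sum>a\<in>A. c a * \<phi> a)" by (rule pos[OF cS])
  moreover have "(\<Sum>a\<in>A. c a * \<phi> a) \<le> 0"
  proof (rule LIMSEQ_le)
    show "(\<lambda>n. \<Sum>a\<in>A. f (r n) a * \<phi> a) \<longlonglongrightarrow> (\<Sum>a\<in>A. c a * \<phi> a)"
      using r(2) by (intro tendsto_sum tendsto_mult tendsto_const) auto
    show "(\<lambda>n. 1 / real (Suc (r n))) \<longlonglongrightarrow> 0"
      using LIMSEQ_subseq_LIMSEQ[OF LIMSEQ_Suc[OF lim_1_over_n] r(1)] by (simp add: o_def)
    show "\<exists>N. \<forall>n\<ge>N. (\<Sum>a\<in>A. f (r n) a * \<phi> a) \<le> 1 / real (Suc (r n))"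
      using f(3) less_imp_le by blast
  qed
  ultimately show False by simp
qed

section \<open>Nonnegative polynomials vanishing on concentric cubes\<close>

lemma poly_fun_line:
  assumes "poly_fun_deg_le k U"
  obtains p where "degree p \<le> k" "\<And>t. U (u + t *\<^sub>R w) = poly p t"
proof -
  obtain c where c: "\<And>x. U x = (\<Sum>\<alpha> | (sum \<alpha> UNIV) \<le> k. c \<alpha> * monomial \<alpha> x)"
    using assms unfolding poly_fun_iff by blast
  define q where "q \<alpha> = (\<Prod>i\<in>UNIV. [:u $ i, w $ i:] ^ \<alpha> i)" for \<alpha>
  have dq: "degree (q \<alpha>) \<le> (sum \<alpha> UNIV)" for \<alpha>
  proof -
    have "degree (q \<alpha>) \<le> (\<Sum>i\<in>UNIV. degree ([:u $ i, w $ i:] ^ \<alpha> i))"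
      unfolding q_def using degree_prod_sum_le[of UNIV "\<lambda>i. [:u $ i, w $ i:] ^ \<alpha> i"] by (simp add: o_def)
    also have "\<dots> \<le> (sum \<alpha> UNIV)"
      by (intro sum_mono order.trans[OF degree_power_le]) simp
    finally show ?thesis .
  qed
  define p where "p = (\<Sum>\<alpha> | (sum \<alpha> UNIV) \<le> k. smult (c \<alpha>) (q \<alpha>))"
  show thesis
  proof
    show "degree p \<le> k" unfolding p_def
      by (intro degree_sum_le finite_exponents) (auto intro: order.trans[OF degree_smult_le] order.trans[OF dq])
    show "U (u + t *\<^sub>R w) = poly p t" for t
      unfolding c p_def by (simp add: poly_sum q_def poly_prod poly_power monomial_def mult.commute)
  qed
qed

text \<open>A double root contributes two linear factors, which can be split off while the others stay double.\<close>

lemma double_roots_degree: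
  fixes p :: "real poly"
  assumes "finite T" "\<And>t. t \<in> T \<Longrightarrow> poly p t = 0 \<and> poly (pderiv p) t = 0" "p \<noteq> 0"
  shows "2 * card T \<le> degree p"
  using assms
proof (induction T arbitrary: p rule: finite_induct)
  case empty
  then show ?case by simp
next
  case (insert t T)
  obtain r where r: "p = [:- t, 1:] * r"
    using insert.prems(1)[of t] by (auto simp: poly_eq_0_iff_dvd dvd_def)
  have "pderiv p = r + [:- t, 1:] * pderiv r" unfolding r pderiv_mult by (simp add: pderiv_pCons)
  then have "poly r t = 0" using insert.prems(1)[of t] by simp
  then obtain s where s: "r = [:- t, 1:] * s" by (auto simp: poly_eq_0_iff_dvd dvd_def)
  have ps: "p = [:- t, 1:] * [:- t, 1:] * s" by (simp only: r s mult.assoc)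
  have s0: "s \<noteq> 0" using insert.prems(2) ps by auto
  have "poly s x = 0 \<and> poly (pderiv s) x = 0" if "x \<in> T" for x
  proof -
    have x: "poly p x = 0" "poly (pderiv p) x = 0" "x \<noteq> t" using that insert by auto
    have "poly p x = (x - t) * (x - t) * poly s x" by (simp add: ps algebra_simps)
    then have sx: "poly s x = 0" using x(1,3) by simp
    have "pderiv p = [:- t, 1:] * [:- t, 1:] * pderiv s + pderiv ([:- t, 1:] * [:- t, 1:]) * s"
      unfolding ps pderiv_mult by (simp add: algebra_simps)
    then have "poly (pderiv p) x = (x - t) * (x - t) * poly (pderiv s) x"
      using sx by (simp add: algebra_simps)
    then show ?thesis using x sx by simp
  qed
  then have "2 * card T \<le> degree s" using insert.IH s0 by blast
  moreover have "degree p = 2 + degree s"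
    unfolding ps using s0 by (subst degree_mult_eq, simp, simp) (subst degree_mult_eq, auto)
  ultimately show ?case using insert(1,2) by simp
qed

lemma poly_fun_zero_near:
  assumes f: "poly_fun_deg_le k f" and \<rho>: "0 < \<rho>"
    and z: "\<And>t. \<bar>t\<bar> < \<rho> \<Longrightarrow> f (u + t *\<^sub>R w) = 0"
  shows "f (u + t *\<^sub>R w) = 0"
proof -
  obtain p where p: "\<And>t. f (u + t *\<^sub>R w) = poly p t" using poly_fun_line[OF f] by blast
  have "{0<..<\<rho>} \<subseteq> {t. poly p t = 0}" using z p by auto
  moreover have "infinite {0<..<\<rho>}" using \<rho> by (simp add: infinite_Ioo)
  ultimately have "p = 0" using poly_roots_finite infinite_super by blast
  then show ?thesis by (simp add: p)
qed

text \<open>Join \<open>v\<close> to the centre of the facet: along this line \<open>f\<close> is a polynomial in one variable with an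
  interval of zeros.\<close>

lemma poly_fun_zero_facet_hyperplane:
  fixes f :: "real ^ 'n::finite \<Rightarrow> real"
  assumes f: "poly_fun_deg_le k f" and \<rho>: "0 < \<rho>"
    and z: "\<And>v. v $ i = \<sigma> \<Longrightarrow> (\<And>j. j \<noteq> i \<Longrightarrow> \<bar>v $ j\<bar> < \<rho>) \<Longrightarrow> f v = 0"
    and v: "v $ i = \<sigma>"
  shows "f v = 0"
proof -
  define u where "u = \<sigma> *\<^sub>R axis i (1 :: real)"
  define w where "w = v - u"
  have u: "u $ j = (if j = i then \<sigma> else 0)" for j by (simp add: u_def axis_def)
  have "f (u + 1 *\<^sub>R w) = 0"
  proof (rule poly_fun_zero_near[OF f, of "\<rho> / (1 + norm w)"])
    have n: "0 < 1 + norm w" by (simp add: add_pos_nonneg)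
    show "0 < \<rho> / (1 + norm w)" using \<rho> n by simp
    fix t assume t: "\<bar>t\<bar> < \<rho> / (1 + norm w)"
    show "f (u + t *\<^sub>R w) = 0"
    proof (rule z)
      show "(u + t *\<^sub>R w) $ i = \<sigma>" by (simp add: w_def v u)
      fix j assume "j \<noteq> i"
      then have "\<bar>(u + t *\<^sub>R w) $ j\<bar> = \<bar>t\<bar> * \<bar>w $ j\<bar>" by (simp add: u abs_mult)
      also have "\<dots> \<le> \<bar>t\<bar> * (1 + norm w)"
        using component_le_norm_cart[of w j] by (intro mult_left_mono) auto
      also have "\<dots> < \<rho>" using t n by (simp add: pos_less_divide_eq)
      finally show "\<bar>(u + t *\<^sub>R w) $ j\<bar> < \<rho>" .
    qed
  qed
  then show ?thesis by (simp add: w_def)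
qed

lemma pderiv_sum: "pderiv (\<Sum>i\<in>I. f i) = (\<Sum>i\<in>I. pderiv (f i))"
  by (induction I rule: infinite_finite_induct) (auto simp: pderiv_add)

text \<open>On polynomials of degree at most \<open>k\<close> in one variable, differentiation at \<open>0\<close> is a fixed linear
  combination of the values at \<open>0, ..., k\<close>. So the directional derivative is a combination of
  translates of \<open>f\<close> and therefore again a polynomial of degree at most \<open>k\<close>.\<close>

lemma directional_derivative_poly_fun:
  assumes "poly_fun_deg_le k f"
  obtains Df where "poly_fun_deg_le k Df"
    "\<And>u p t. degree p \<le> k \<Longrightarrow> (\<And>t. f (u + t *\<^sub>R w) = poly p t) \<Longrightarrow> Df (u + t *\<^sub>R w) = poly (pderiv p) t"
proof -
  define N where "N = real ` {..k}"
  have N: "finite N" "card N = Suc k" by (auto simp: N_def card_image)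
  define Df where "Df x = (\<Sum>l\<in>N. poly (pderiv (lagrange_basis N l)) 0 * f (x + l *\<^sub>R w))" for x
  show thesis
  proof
    show "poly_fun_deg_le k Df" unfolding Df_def
      by (intro poly_fun_sum poly_fun_cmult poly_fun_translate assms)
    fix u t and p :: "real poly"
    assume p: "degree p \<le> k" "\<And>t. f (u + t *\<^sub>R w) = poly p t"
    define q where "q = pcompose p [:t, 1:]"
    have dq: "degree q < card N"
      using p(1) N by (simp add: q_def degree_pcompose)
    have qs: "poly q s = f (u + t *\<^sub>R w + s *\<^sub>R w)" for s
      using p(2)[of "t + s"] by (simp add: q_def poly_pcompose scaleR_add_left add.assoc)
    have "pderiv q = (\<Sum>l\<in>N. smult (poly q l) (pderiv (lagrange_basis N l)))"
      by (subst lagrange_interpolation[OF N(1) dq]) (simp add: pderiv_sum pderiv_smult)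
    then have "poly (pderiv q) 0 = Df (u + t *\<^sub>R w)"
      by (simp add: poly_sum Df_def qs mult.commute)
    moreover have "poly (pderiv q) 0 = poly (pderiv p) t"
      by (simp add: q_def pderiv_pcompose poly_pcompose pderiv_pCons)
    ultimately show "Df (u + t *\<^sub>R w) = poly (pderiv p) t" by simp
  qed
qed

text \<open>On the facets \<open>W\<close> is minimal, so \<open>W\<close> and its derivative in direction \<open>w = e_i + e_j\<close> vanish there,
  hence on the whole hyperplanes. A line in direction \<open>w\<close> meets the hyperplanes orthogonal to \<open>e_i\<close> and
  to \<open>e_j\<close> in \<open>4 * card R\<close> points, all of them double roots, which is too many for degree \<open>k\<close>.\<close>

lemma nonneg_vanishing_on_cubes:
  fixes W :: "real ^ 'n::finite \<Rightarrow> real"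
  assumes W: "poly_fun_deg_le k W"
    and pos: "\<And>v. (\<And>j. \<bar>v $ j\<bar> \<le> 1 / 2) \<Longrightarrow> 0 \<le> W v"
    and R: "finite R" "\<And>\<rho>. \<rho> \<in> R \<Longrightarrow> 0 < \<rho> \<and> \<rho> < 1 / 2"
    and zero: "\<And>\<rho> v i. \<rho> \<in> R \<Longrightarrow> (\<And>j. \<bar>v $ j\<bar> \<le> \<rho>) \<Longrightarrow> \<bar>v $ i\<bar> = \<rho> \<Longrightarrow> W v = 0"
    and k: "k < 8 * card R" and D: "CARD('n) \<noteq> 1"
  shows "W s = 0"
proof -
  obtain i j :: 'n where ij: "i \<noteq> j"
  proof -
    have "\<not> is_singleton (UNIV :: 'n set)" using D by (simp add: is_singleton_altdef)
    then show thesis using that unfolding is_singleton_def by blast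
  qed
  define w where "w = axis i (1 :: real) + axis j 1"
  have wc: "w $ l = (if l = i \<or> l = j then 1 else 0)" for l using ij by (auto simp: w_def axis_def)
  obtain DW where DW: "poly_fun_deg_le k DW"
    "\<And>u p t. degree p \<le> k \<Longrightarrow> (\<And>t. W (u + t *\<^sub>R w) = poly p t) \<Longrightarrow> DW (u + t *\<^sub>R w) = poly (pderiv p) t"
    using directional_derivative_poly_fun[OF W, of w] by blast
  define S where "S = R \<union> uminus ` R"
  have "\<bar>\<sigma>\<bar> = \<sigma>" if "\<sigma> \<in> R" for \<sigma> using R(2)[OF that] by simp
  then have S: "finite S" "\<And>\<sigma>. \<sigma> \<in> S \<Longrightarrow> \<bar>\<sigma>\<bar> \<in> R" using R(1) by (auto simp: S_def)
  have cS: "card S = 2 * card R"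
  proof -
    have "R \<inter> uminus ` R = {}"
    proof (rule ccontr)
      assume "R \<inter> uminus ` R \<noteq> {}"
      then obtain a b where "a \<in> R" "b \<in> R" "a = - b" by blast
      then show False using R(2)[of a] R(2)[of b] by simp
    qed
    then have "card S = card R + card (uminus ` R)" unfolding S_def using R by (intro card_Un_disjoint) auto
    then show ?thesis by (simp add: card_image)
  qed
  have face: "W v = 0 \<and> DW v = 0" if \<sigma>: "\<sigma> \<in> S" and l: "v $ l = \<sigma>" for \<sigma> v l
  proof -
    let ?\<rho> = "\<bar>\<sigma>\<bar>"
    have \<rho>: "?\<rho> \<in> R" "0 < ?\<rho>" "?\<rho> < 1 / 2" using S(2)[OF \<sigma>] R(2)[OF S(2)[OF \<sigma>]] by auto
    have W0: "W v = 0" if "v $ l = \<sigma>" "\<And>j. j \<noteq> l \<Longrightarrow> \<bar>v $ j\<bar> < ?\<rho>" for v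
    proof (rule zero[OF \<rho>(1)])
      show "\<bar>v $ l\<bar> = ?\<rho>" using that by simp
      show "\<bar>v $ j\<bar> \<le> ?\<rho>" for j using that by (cases "j = l") (auto intro: less_imp_le)
    qed
    have D0: "DW v = 0" if v: "v $ l = \<sigma>" "\<And>j. j \<noteq> l \<Longrightarrow> \<bar>v $ j\<bar> < ?\<rho>" for v
    proof -
      obtain p where p: "degree p \<le> k" "\<And>t. W (v + t *\<^sub>R w) = poly p t" using poly_fun_line[OF W] by blast
      have p0: "poly p 0 = 0" using p(2)[of 0] W0[OF v] by simp
      have "poly (pderiv p) 0 = 0"
      proof (rule DERIV_local_min[OF poly_DERIV, of "1 / 2 - ?\<rho>"])
        show "0 < 1 / 2 - ?\<rho>" using \<rho> by simp
        show "\<forall>y. \<bar>0 - y\<bar> < 1 / 2 - ?\<rho> \<longrightarrow> poly p 0 \<le> poly p y"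
        proof (intro allI impI)
          fix t :: real assume t: "\<bar>0 - t\<bar> < 1 / 2 - ?\<rho>"
          have "\<bar>(v + t *\<^sub>R w) $ j\<bar> \<le> 1 / 2" for j
          proof -
            have "\<bar>v $ j\<bar> \<le> ?\<rho>" using v by (cases "j = l") (auto intro: less_imp_le)
            moreover have "\<bar>t * w $ j\<bar> \<le> \<bar>t\<bar>" by (simp add: wc)
            ultimately have "\<bar>v $ j + t * w $ j\<bar> \<le> 1 / 2"
              using t abs_triangle_ineq[of "v $ j" "t * w $ j"] by linarith
            then show ?thesis by simp
          qed
          then have "0 \<le> poly p t" unfolding p(2)[symmetric] by (rule pos)
          then show "poly p 0 \<le> poly p t" by (simp only: p0)
        qed
      qed
      then show ?thesis using DW(2)[OF p, of 0] by simp
    qed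
    show ?thesis
      using poly_fun_zero_facet_hyperplane[OF W \<rho>(2) W0 l] poly_fun_zero_facet_hyperplane[OF DW(1) \<rho>(2) D0 l] by blast
  qed
  \<comment> \<open>The condition on \<open>s\<close> makes the crossing points of the two families of hyperplanes distinct.\<close>
  have generic: "W s = 0" if s: "s $ i - s $ j \<notin> (\<lambda>(a, b). a - b) ` (S \<times> S)" for s
  proof -
    obtain p where p: "degree p \<le> k" "\<And>t. W (s + t *\<^sub>R w) = poly p t" using poly_fun_line[OF W] by blast
    define T where "T = (\<lambda>\<sigma>. \<sigma> - s $ i) ` S \<union> (\<lambda>\<sigma>. \<sigma> - s $ j) ` S"
    have "(\<lambda>\<sigma>. \<sigma> - s $ i) ` S \<inter> (\<lambda>\<sigma>. \<sigma> - s $ j) ` S = {}"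
    proof (rule ccontr)
      assume "\<not> ?thesis"
      then obtain a b where ab: "a \<in> S" "b \<in> S" "a - s $ i = b - s $ j" by blast
      have "s $ i - s $ j \<in> (\<lambda>(a, b). a - b) ` (S \<times> S)"
        by (rule image_eqI[of _ _ "(a, b)"]) (use ab in \<open>auto simp: algebra_simps\<close>)
      then show False using s by contradiction
    qed
    then have cT: "card T = 4 * card R"
      unfolding T_def using S(1) cS by (subst card_Un_disjoint) (auto simp: card_image inj_on_def)
    have "poly p t = 0 \<and> poly (pderiv p) t = 0" if "t \<in> T" for t
    proof -
      obtain \<sigma> l where \<sigma>: "\<sigma> \<in> S" "l = i \<or> l = j" "t = \<sigma> - s $ l" using \<open>t \<in> T\<close> by (auto simp: T_def)
      then have "(s + t *\<^sub>R w) $ l = \<sigma>" by (auto simp: wc)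
      from face[OF \<sigma>(1) this] show ?thesis using p(2) DW(2)[OF p] by simp
    qed
    then have "p = 0" using double_roots_degree[of T p] p(1) k cT S(1) by (fastforce simp: T_def)
    then show ?thesis using p(2)[of 0] by simp
  qed
  \<comment> \<open>An arbitrary \<open>s\<close> lies on a line in direction \<open>e_i\<close> with only finitely many exceptional points.\<close>
  obtain p where p: "\<And>t. W (s + t *\<^sub>R axis i 1) = poly p t" using poly_fun_line[OF W] by blast
  have "- ((\<lambda>d. d - (s $ i - s $ j)) ` (\<lambda>(a, b). a - b) ` (S \<times> S)) \<subseteq> {t. poly p t = 0}"
  proof
    fix t assume t: "t \<in> - ((\<lambda>d. d - (s $ i - s $ j)) ` (\<lambda>(a, b). a - b) ` (S \<times> S))"
    have e: "(s + t *\<^sub>R axis i 1) $ i - (s + t *\<^sub>R axis i 1) $ j = t + (s $ i - s $ j)"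
      using ij by (simp add: axis_def)
    have ne: "t + (s $ i - s $ j) \<notin> (\<lambda>(a, b). a - b) ` (S \<times> S)"
    proof
      assume "t + (s $ i - s $ j) \<in> (\<lambda>(a, b). a - b) ` (S \<times> S)"
      then have "t + (s $ i - s $ j) - (s $ i - s $ j) \<in> (\<lambda>d. d - (s $ i - s $ j)) ` (\<lambda>(a, b). a - b) ` (S \<times> S)"
        by (rule imageI)
      then show False using t by simp
    qed
    have "W (s + t *\<^sub>R axis i 1) = 0" by (rule generic, unfold e, rule ne)
    then show "t \<in> {t. poly p t = 0}" using p by simp
  qed
  moreover have "infinite (- ((\<lambda>d. d - (s $ i - s $ j)) ` (\<lambda>(a, b). a - b) ` (S \<times> S)) :: real set)"
    using S(1) by (intro Compl_eq_Diff_UNIV[THEN arg_cong[where f = infinite], THEN iffD2] Diff_infinite_finite)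
      (auto simp: infinite_UNIV_char_0)
  ultimately have "p = 0" using poly_roots_finite infinite_super by blast
  then show ?thesis using p[of 0] by simp
qed

section \<open>Strict inequality for the cube\<close>

text \<open>By the projection formula the average is a sum of integrals of continuous nonnegative functions over
  the cube.\<close>

lemma cube_boundary_average_zero:
  fixes g :: "real ^ 'n::finite \<Rightarrow> real"
  assumes g: "continuous_on UNIV g" and nonneg: "\<And>y. y \<in> frontier (cbox 0 1) \<Longrightarrow> 0 \<le> g y"
    and zero: "boundary_average (cbox 0 1) g = 0" and y: "y \<in> frontier (cbox 0 1)"
  shows "g y = 0"
proof -
  let ?K = "cbox 0 1 :: (real ^ 'n) set"
  define i' where "i' = (undefined :: 'n)"
  define I where "I i e = (LINT x:?K|lborel. g (slice i e x))" for i e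
  have c: "continuous_on S (\<lambda>x. g (slice i e x))" for S i e
    by (rule continuous_on_compose2[OF g continuous_slice]) simp
  have mem: "slice i e x \<in> frontier ?K" if "x \<in> ?K" "e = 0 \<or> e = 1" for i e x
  proof -
    have "slice i e x \<in> facet i e" using that by (auto simp: facet_def mem_cbox_01)
    then show ?thesis using that(2) unfolding frontier_cube by blast
  qed
  have I_HK: "I i e = integral ?K (\<lambda>x. g (slice i e x))" for i e
    unfolding I_def
    by (rule set_borel_integral_eq_integral(2),
        rule set_integrable_compact[OF sets_lborel compact_cbox emeasure_compact_finite[OF compact_cbox] c])
  have I0: "0 \<le> I i e" if "e = 0 \<or> e = 1" for i e
    unfolding I_HK by (intro integral_nonneg integrable_continuous c) (use mem that nonneg in blast)
  have "(LINT y:frontier ?K|surface. g y) = 0"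
    using zero radial_cell.area_pos[OF radial_cell_cube, where 'n = 'n]
    by (simp add: boundary_average_def average_def)
  then have "(\<Sum>i\<in>UNIV. I i 0 + I i 1) = 0"
    unfolding frontier_cube_integral[OF g, of i'] I_def[symmetric] using facet_area_pos[of i'] by simp
  then have "I i 0 + I i 1 = 0" for i
    using I0 by (subst (asm) sum_nonneg_eq_0_iff) (auto intro: add_nonneg_nonneg)
  then have "I i e = 0" if "e = 0 \<or> e = 1" for i e
    using I0[of 0 i] I0[of 1 i] that by (metis add_nonneg_eq_0_iff)
  moreover obtain i e where ie: "y \<in> facet i e" "e = 0 \<or> e = 1" using y unfolding frontier_cube by blast
  ultimately have "integral ?K (\<lambda>x. g (slice i e x)) = 0" unfolding I_HK by blast
  moreover have "box 0 (1 :: real ^ 'n) \<noteq> {}" by (auto simp: box_ne_empty inner_axis Basis_vec_def)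
  ultimately have "\<forall>x\<in>?K. g (slice i e x) = 0"
    using integral_cbox_eq_0_iff[of 0 "1 :: real ^ 'n" "\<lambda>x. g (slice i e x)"] c mem[OF _ ie(2)] nonneg by blast
  moreover have "y \<in> ?K" "slice i e y = y" using ie(1) by (auto simp: facet_def vec_eq_iff)
  ultimately show ?thesis by metis
qed

text \<open>Otherwise \<open>U\<close> has average zero, hence vanishes, on the boundary of every cube shrunk by \<open>sqrt \<zeta>\<close>.\<close>

lemma cube_concentric_average_pos:
  fixes c :: "('n::finite \<Rightarrow> nat) \<Rightarrow> real"
  assumes D: "CARD('n) \<noteq> 1"
    and Z: "finite Z" "Z \<subseteq> {0<..<1}" "k < 8 * card Z" "\<And>\<zeta>. \<zeta> \<in> Z \<Longrightarrow> 0 < (w \<zeta> :: real)"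
    and U: "\<And>v. U (cube_center + v) = (\<Sum>\<alpha> | (sum \<alpha> UNIV) \<le> k. c \<alpha> * monomial \<alpha> v)"
    and pos: "\<forall>x\<in>cbox 0 1. 0 \<le> U x"
    and c: "(sum \<alpha> UNIV) \<le> k" "c \<alpha> \<noteq> 0"
  shows "0 < (\<Sum>\<zeta>\<in>Z. w \<zeta> * boundary_average (cbox 0 1) (\<lambda>y. U (cube_center + sqrt \<zeta> *\<^sub>R (y - cube_center))))"
proof (rule ccontr)
  let ?K = "cbox 0 1 :: (real ^ 'n) set" and ?z = "cube_center :: real ^ 'n"
  let ?g = "\<lambda>\<zeta> y. U (?z + sqrt \<zeta> *\<^sub>R (y - ?z))"
  interpret radial_cell ?K ?z by (rule radial_cell_cube)
  define W where "W v = U (?z + v)" for v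
  have W: "poly_fun_deg_le k W" unfolding poly_fun_iff W_def U by blast
  have cont: "continuous_on UNIV (?g \<zeta>)" for \<zeta>
    unfolding W_def[symmetric]
    by (rule continuous_on_compose2[OF continuous_on_poly_fun[OF W, of UNIV]]) (auto intro!: continuous_intros)
  have nn: "0 \<le> ?g \<zeta> y" if "\<zeta> \<in> Z" "y \<in> frontier ?K" for \<zeta> y
    using pos cube_shrink[OF that(2), of "sqrt \<zeta>"] Z(2) that(1) by (force simp: less_imp_le)
  have B0: "0 \<le> w \<zeta> * B (?g \<zeta>)" if "\<zeta> \<in> Z" for \<zeta>
    using Z(4)[OF that] B_nonneg[OF cont nn[OF that]] by (simp add: less_imp_le)
  assume "\<not> ?thesis"
  then have "(\<Sum>\<zeta>\<in>Z. w \<zeta> * B (?g \<zeta>)) = 0" using sum_nonneg[of Z "\<lambda>\<zeta>. w \<zeta> * B (?g \<zeta>)"] B0 by force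
  then have "\<forall>\<zeta>\<in>Z. w \<zeta> * B (?g \<zeta>) = 0"
    using sum_nonneg_eq_0_iff[of Z "\<lambda>\<zeta>. w \<zeta> * B (?g \<zeta>)"] Z(1) B0 by blast
  then have Bz: "B (?g \<zeta>) = 0" if "\<zeta> \<in> Z" for \<zeta> using Z(4)[OF that] that by force
  have gz: "?g \<zeta> y = 0" if "\<zeta> \<in> Z" "y \<in> frontier ?K" for \<zeta> y
    by (rule cube_boundary_average_zero[OF cont nn[OF that(1)] Bz[OF that(1)] that(2)])
  define R where "R = (\<lambda>\<zeta>. sqrt \<zeta> / 2) ` Z"
  have cR: "card R = card Z" unfolding R_def by (rule card_image) (auto simp: inj_on_def)
  have "W v = 0" for v
  proof (rule nonneg_vanishing_on_cubes[OF W])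
    show "0 \<le> W v" if "\<And>j. \<bar>v $ j\<bar> \<le> 1 / 2" for v
    proof -
      have "0 \<le> 1 / 2 + v $ j \<and> 1 / 2 + v $ j \<le> 1" for j using that[of j] by (auto simp: abs_le_iff)
      then have "?z + v \<in> ?K" unfolding mem_cbox_01 by simp
      then show ?thesis using pos by (simp add: W_def)
    qed
    show "finite R" using Z(1) by (simp add: R_def)
    show "0 < \<rho> \<and> \<rho> < 1 / 2" if "\<rho> \<in> R" for \<rho> using that Z(2) by (auto simp: R_def)
    show "W v = 0" if \<rho>: "\<rho> \<in> R" and v: "\<And>j. \<bar>v $ j\<bar> \<le> \<rho>" "\<bar>v $ i\<bar> = \<rho>" for \<rho> v i
    proof -
      obtain \<zeta> where \<zeta>: "\<zeta> \<in> Z" "\<rho> = sqrt \<zeta> / 2" using \<rho> by (auto simp: R_def)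
      have s: "0 < sqrt \<zeta>" using \<zeta>(1) Z(2) by auto
      define y where "y = ?z + (1 / sqrt \<zeta>) *\<^sub>R v"
      have yj: "y $ j = 1 / 2 + v $ j / sqrt \<zeta>" for j by (simp add: y_def)
      have "\<bar>v $ j / sqrt \<zeta>\<bar> \<le> 1 / 2" for j using v(1)[of j] s \<zeta>(2) by (simp add: divide_simps)
      then have y01: "0 \<le> y $ j \<and> y $ j \<le> 1" for j unfolding yj using abs_le_iff by (smt (verit) field_sum_of_halves)
      have "\<bar>v $ i / sqrt \<zeta>\<bar> = 1 / 2" using v(2) s \<zeta>(2) by (simp add: abs_divide)
      then have "y $ i = 0 \<or> y $ i = 1" unfolding yj by (smt (verit) field_sum_of_halves)
      then have "y \<in> frontier ?K" unfolding frontier_cube facet_def mem_cbox_01 using y01 by blast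
      from gz[OF \<zeta>(1) this] show "W v = 0" using s by (simp add: W_def y_def)
    qed
  qed (use Z(3) D cR in auto)
  then have "(\<Sum>\<alpha> | (sum \<alpha> UNIV) \<le> k. c \<alpha> * monomial \<alpha> v) = 0" for v
    unfolding U[symmetric] W_def .
  from monomials_independent[OF finite_exponents this, of \<alpha>] show False using c by simp
qed

text \<open>The interior quadrature nodes contribute at least a fixed proportion \<open>\<delta>\<close> of the cell average, so
  that the ratio is at most \<open>1 - \<delta>\<close> times the value for the ball.\<close>

lemma interior_weight_cube_strict:
  assumes D: "CARD('n::finite) \<noteq> 1" and k: "4 \<le> k"
  shows "interior_weight (cbox 0 1 :: (real ^ 'n) set) k < ereal (radial_weight CARD('n) (k div 2))"
proof -
  let ?K = "cbox 0 1 :: (real ^ 'n) set" and ?z = "cube_center :: real ^ 'n"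
  interpret radial_cell ?K ?z by (rule radial_cell_cube)
  define M where "M = radial_weight CARD('n) (k div 2)"
  have D0: "CARD('n) > 0" by simp
  have M: "0 < M" unfolding M_def by (rule radial_weight_pos[OF D0])
  obtain Z and w :: "real \<Rightarrow> real" and w0 where Z: "finite Z" "Z \<subseteq> {0<..<1}" "card Z = (k div 2) div 2"
    "\<And>\<zeta>. \<zeta> \<in> Z \<Longrightarrow> w \<zeta> > 0" "w0 \<ge> 0" "even (k div 2) \<Longrightarrow> w0 = 0"
    "\<And>p. degree p \<le> k div 2 \<Longrightarrow> radial_functional CARD('n) p
        = poly p 1 / M + w0 * poly p 0 + (\<Sum>\<zeta>\<in>Z. w \<zeta> * poly p \<zeta>)"
    by (rule endpoint_quadrature[OF D0, of "k div 2", folded M_def]) (rule that)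
  \<comment> \<open>With \<open>m = card Z \<ge> 1\<close> the degree satisfies \<open>k \<le> 4 * m + 3 < 8 * m\<close>.\<close>
  have k8: "k < 8 * card Z" unfolding Z(3) using k by presburger
  let ?A = "{\<alpha> :: 'n \<Rightarrow> nat. (sum \<alpha> UNIV) \<le> k}"
  define V where "V c x = (\<Sum>\<alpha>\<in>?A. c \<alpha> * monomial \<alpha> (x - ?z))" for c x
  define \<Phi> where "\<Phi> U = (\<Sum>\<zeta>\<in>Z. w \<zeta> * B (\<lambda>y. U (?z + sqrt \<zeta> *\<^sub>R (y - ?z))))" for U
  define \<phi> where "\<phi> \<alpha> = (\<Sum>\<zeta>\<in>Z. w \<zeta> * B (\<lambda>y. monomial \<alpha> (sqrt \<zeta> *\<^sub>R (y - ?z))))" for \<alpha>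
  define S where "S = {c. \<forall>x\<in>?K. 0 \<le> V c x}"
  have \<Phi>V: "\<Phi> (V c) = (\<Sum>\<alpha>\<in>?A. c \<alpha> * \<phi> \<alpha>)" for c
  proof -
    have "B (\<lambda>y. V c (?z + sqrt \<zeta> *\<^sub>R (y - ?z))) = (\<Sum>\<alpha>\<in>?A. c \<alpha> * B (\<lambda>y. monomial \<alpha> (sqrt \<zeta> *\<^sub>R (y - ?z))))" for \<zeta>
      unfolding V_def add_diff_cancel_left' by (rule B_sum) (intro continuous_intros)
    then have "\<Phi> (V c) = (\<Sum>\<zeta>\<in>Z. \<Sum>\<alpha>\<in>?A. w \<zeta> * (c \<alpha> * B (\<lambda>y. monomial \<alpha> (sqrt \<zeta> *\<^sub>R (y - ?z)))))"
      unfolding \<Phi>_def by (simp only: sum_distrib_left)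
    also have "\<dots> = (\<Sum>\<alpha>\<in>?A. \<Sum>\<zeta>\<in>Z. w \<zeta> * (c \<alpha> * B (\<lambda>y. monomial \<alpha> (sqrt \<zeta> *\<^sub>R (y - ?z)))))"
      by (rule sum.swap)
    also have "\<dots> = (\<Sum>\<alpha>\<in>?A. c \<alpha> * \<phi> \<alpha>)"
      unfolding \<phi>_def sum_distrib_left by (simp only: mult.left_commute)
    finally show ?thesis .
  qed
  have "\<exists>\<epsilon>>0. \<forall>c\<in>S. \<epsilon> * (\<Sum>\<alpha>\<in>?A. \<bar>c \<alpha>\<bar>) \<le> (\<Sum>\<alpha>\<in>?A. c \<alpha> * \<phi> \<alpha>)"
  proof (rule positive_functional_coercive[OF finite_exponents])
    show "c \<in> S" if f: "\<And>n. f n \<in> S" and lim: "\<And>\<alpha>. \<alpha> \<in> ?A \<Longrightarrow> (\<lambda>n. f n \<alpha>) \<longlonglongrightarrow> c \<alpha>" for f c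
      unfolding S_def
    proof (intro CollectI ballI)
      fix x assume x: "x \<in> ?K"
      have "(\<lambda>n. V (f n) x) \<longlonglongrightarrow> V c x"
        unfolding V_def by (intro tendsto_sum tendsto_mult tendsto_const lim)
      moreover have "0 \<le> V (f n) x" for n using f[of n] x by (simp add: S_def)
      ultimately show "0 \<le> V c x" by (intro LIMSEQ_le_const) auto
    qed
    show "(\<lambda>\<alpha>. t * c \<alpha>) \<in> S" if "c \<in> S" "0 < t" for c t
    proof -
      have "V (\<lambda>\<alpha>. t * c \<alpha>) x = t * V c x" for x
        unfolding V_def sum_distrib_left by (simp only: mult.assoc)
      then show ?thesis using that by (simp add: S_def)
    qed
    show "0 < (\<Sum>\<alpha>\<in>?A. c \<alpha> * \<phi> \<alpha>)" if cS: "c \<in> S" and ex: "\<exists>\<alpha>\<in>?A. c \<alpha> \<noteq> 0" for c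
    proof -
      obtain \<alpha> where "(sum \<alpha> UNIV) \<le> k" "c \<alpha> \<noteq> 0" using ex by blast
      then show ?thesis
        unfolding \<Phi>V[symmetric] \<Phi>_def
        by (intro cube_concentric_average_pos[where U = "V c" and c = c and \<alpha> = \<alpha>, OF D Z(1,2) k8 Z(4)])
           (use cS in \<open>auto simp: S_def V_def\<close>)
    qed
  qed
  then obtain \<epsilon> where \<epsilon>: "0 < \<epsilon>" "\<And>c. c \<in> S \<Longrightarrow> \<epsilon> * (\<Sum>\<alpha>\<in>?A. \<bar>c \<alpha>\<bar>) \<le> \<Phi> (V c)"
    unfolding \<Phi>V by blast
  define \<gamma> where "\<gamma> \<alpha> = C (\<lambda>x. monomial \<alpha> (x - ?z))" for \<alpha>
  define G where "G = 1 + (\<Sum>\<alpha>\<in>?A. \<bar>\<gamma> \<alpha>\<bar>)"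
  have G: "0 < G" unfolding G_def by (intro add_pos_nonneg sum_nonneg) auto
  have CG: "C (V c) \<le> G * (\<Sum>\<alpha>\<in>?A. \<bar>c \<alpha>\<bar>)" for c
  proof -
    have "C (V c) = (\<Sum>\<alpha>\<in>?A. c \<alpha> * \<gamma> \<alpha>)"
      unfolding V_def \<gamma>_def by (rule C_sum) (intro continuous_intros)
    also have "\<dots> \<le> (\<Sum>\<alpha>\<in>?A. G * \<bar>c \<alpha>\<bar>)"
    proof (rule sum_mono)
      fix \<alpha> assume \<alpha>: "\<alpha> \<in> ?A"
      have "\<bar>\<gamma> \<alpha>\<bar> \<le> (\<Sum>\<alpha>\<in>?A. \<bar>\<gamma> \<alpha>\<bar>)"
        by (rule member_le_sum[OF \<alpha>]) (auto intro: finite_exponents)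
      then have "\<bar>\<gamma> \<alpha>\<bar> \<le> G" by (simp add: G_def)
      then have "\<bar>c \<alpha>\<bar> * \<bar>\<gamma> \<alpha>\<bar> \<le> \<bar>c \<alpha>\<bar> * G" by (rule mult_left_mono) simp
      moreover have "c \<alpha> * \<gamma> \<alpha> \<le> \<bar>c \<alpha>\<bar> * \<bar>\<gamma> \<alpha>\<bar>" by (metis abs_ge_self abs_mult)
      ultimately show "c \<alpha> * \<gamma> \<alpha> \<le> G * \<bar>c \<alpha>\<bar>" by (simp add: mult.commute)
    qed
    finally show ?thesis by (simp add: sum_distrib_left)
  qed
  define \<delta> where "\<delta> = \<epsilon> / G"
  have \<delta>: "0 < \<delta>" using \<epsilon>(1) G by (simp add: \<delta>_def)
  have "interior_weight ?K k \<le> ereal (M * (1 - \<delta>))"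
    unfolding interior_weight_def
  proof (rule SUP_least)
    fix U assume "U \<in> {U. poly_fun_deg_le k U \<and> (\<forall>x\<in>?K. 0 \<le> U x) \<and> 0 < C U}"
    then have U: "poly_fun_deg_le k U" "\<forall>x\<in>?K. 0 \<le> U x" "0 < C U" by auto
    obtain p where p: "degree p \<le> k div 2" "\<And>r. B (\<lambda>y. U (?z + r *\<^sub>R (y - ?z))) = poly p (r\<^sup>2)"
      "C U = radial_functional CARD('n) p"
      by (rule radial_profile[OF U(1)]) (rule that)
    obtain c where c: "\<And>v. U (v + ?z) = (\<Sum>\<alpha>\<in>?A. c \<alpha> * monomial \<alpha> v)"
      using poly_fun_translate[OF U(1), of ?z] unfolding poly_fun_iff by blast
    have UV: "U = V c"
    proof
      fix x show "U x = V c x" using c[of "x - ?z"] by (simp add: V_def)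
    qed
    have cS: "c \<in> S" using U(2) unfolding UV S_def by blast
    have "\<Phi> U = (\<Sum>\<zeta>\<in>Z. w \<zeta> * poly p \<zeta>)"
      unfolding \<Phi>_def p(2) using Z(2) by (intro sum.cong) (auto simp: real_sqrt_pow2_iff)
    moreover have "0 \<le> w0 * poly p 0" using profile_nonneg[OF U(1,2) p(2), of 0] Z(5) by simp
    ultimately have "B U / M + \<Phi> U \<le> C U"
      unfolding p(3) Z(7)[OF p(1)] profile_boundary[OF p(2)] by simp
    moreover have "\<delta> * C U \<le> \<Phi> U"
    proof -
      have "\<delta> * C U \<le> \<delta> * (G * (\<Sum>\<alpha>\<in>?A. \<bar>c \<alpha>\<bar>))"
        unfolding UV using CG[of c] \<delta> by (intro mult_left_mono) auto
      also have "\<dots> = \<epsilon> * (\<Sum>\<alpha>\<in>?A. \<bar>c \<alpha>\<bar>)" using G by (simp add: \<delta>_def)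
      also have "\<dots> \<le> \<Phi> U" unfolding UV by (rule \<epsilon>(2)[OF cS])
      finally show ?thesis .
    qed
    ultimately have "B U / M \<le> (1 - \<delta>) * C U" by (simp add: left_diff_distrib)
    then have "B U / C U \<le> M * (1 - \<delta>)"
      using M U(3) by (simp add: divide_simps mult_ac)
    then show "ereal (B U / C U) \<le> ereal (M * (1 - \<delta>))" by simp
  qed
  also have "M * (1 - \<delta>) < M" using M \<delta> by (simp add: algebra_simps)
  then have "ereal (M * (1 - \<delta>)) < ereal M" by simp
  finally show ?thesis unfolding M_def .
qed

theorem theorem6p13:
  shows "(\<forall>n. interior_weight (cball 0 1 :: (real ^ 'n) set) (2 * n)
               = interior_weight (cball 0 1 :: (real ^ 'n) set) (2 * n + 1)
           \<and> interior_weight (cball 0 1 :: (real ^ 'n) set) (2 * n + 1)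
               = ereal (real ((n div 2 + 1) * (2 * ((n + 1) div 2) + CARD('n))) / real CARD('n)))
       \<and> (\<forall>k. interior_weight (cbox 0 1 :: (real ^ 'n) set) k
               \<le> interior_weight (cball 0 1 :: (real ^ 'n) set) k
           \<and> (interior_weight (cbox 0 1 :: (real ^ 'n) set) k
                = interior_weight (cball 0 1 :: (real ^ 'n) set) k
              \<longleftrightarrow> CARD('n) = 1 \<or> k < 4))"
proof (intro conjI allI)
  fix n :: nat
  have "(2 * n) div 2 = n" "(2 * n + 1) div 2 = n" by simp_all
  then show "interior_weight (cball 0 1 :: (real ^ 'n) set) (2 * n)
      = interior_weight (cball 0 1 :: (real ^ 'n) set) (2 * n + 1)"
    "interior_weight (cball 0 1 :: (real ^ 'n) set) (2 * n + 1)
      = ereal (real ((n div 2 + 1) * (2 * ((n + 1) div 2) + CARD('n))) / real CARD('n))"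
    unfolding interior_weight_ball by (simp_all only: radial_weight_def)
next
  fix k
  show "interior_weight (cbox 0 1 :: (real ^ 'n) set) k \<le> interior_weight (cball 0 1 :: (real ^ 'n) set) k"
    unfolding interior_weight_ball by (rule interior_weight_cube_le)
  show "interior_weight (cbox 0 1 :: (real ^ 'n) set) k = interior_weight (cball 0 1 :: (real ^ 'n) set) k
      \<longleftrightarrow> CARD('n) = 1 \<or> k < 4"
    unfolding interior_weight_ball
    using interior_weight_interval[where 'n = 'n, of k] interior_weight_cube_low_degree[of k, where 'n = 'n]
      interior_weight_cube_strict[where 'n = 'n, of k]
    by (metis less_irrefl not_le)
qed

end
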